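(* There exist absolute constants $\varepsilon_0>0$ and $C>0$ such that, if $0<\varepsilon<\varepsilon_0$, $f:\mathbb{H}\to\mathbb{H}$ is a $(1+\varepsilon)$-biLipschitz map, $R>0$ and $P_0\in\mathbb{H}$, then there exists an isometry $T$ of $(\mathbb{H},d)$ such that $$d(f(P),T(P))\le C\varepsilon^{1/2^{11}}R\qquad\text{whenever } d(P,P_0)\le R.$$
   Context: The Heisenberg group $\mathbb{H}$ is $\mathbb{R}^3$ with product $(x,y,t)\cdot(x',y',t')=(x+x',y+y',t+t'+2(x'y-xy'))$. Left-invariant horizontal fields: $X=\partial_x+2y\,\partial_t$, $Y=\partial_y-2x\,\partial_t$. A horizontal curve is an absolutely continuous $\gamma:[\alpha,\beta]\to\mathbb{H}$ with $\dot\gamma=aX_\gamma+bY_\gamma$ a.e. for some measurable $a,b$; its length is $\int_\alpha^\beta\sqrt{a^2+b^2}$. The control distance $d(P,Q)$ is the infimum of lengths of horizontal curves joining $P$ and $Q$. A map $f:\mathbb{H}\to\mathbb{H}$ is $(1+\varepsilon)$-biLipschitz if $(1+\varepsilon)^{-1}d(P,Q)\le d(f(P),f(Q))\le(1+\varepsilon)d(P,Q)$ for all $P,Q\in\mathbb{H}$. An isometry is a map $T:\mathbb{H}\to\mathbb{H}$ with $d(T(P),T(Q))=d(P,Q)$ for all $P,Q$. *)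

theory Defs
  imports "HOL-Analysis.Analysis"
begin

type_synonym heis = "real \<times> real \<times> real"

definition heis_mult :: "heis \<Rightarrow> heis \<Rightarrow> heis" where
  "heis_mult = (\<lambda>(x, y, t) (x', y', t'). (x + x', y + y', t + t' + 2 * (x' * y - x * y')))"

definition heis_X :: "heis \<Rightarrow> heis" where
  "heis_X = (\<lambda>(x, y, t). (1, 0, 2 * y))"

definition heis_Y :: "heis \<Rightarrow> heis" where
  "heis_Y = (\<lambda>(x, y, t). (0, 1, - 2 * x))"

lemma heis_X_left_invariant:
  "((\<lambda>s. heis_mult P (s, 0, 0)) has_vector_derivative heis_X P) (at 0)"
  unfolding heis_mult_def heis_X_def
  by (cases P)
    (auto intro!: derivative_eq_intros has_vector_derivative_Pair
      simp: has_real_derivative_iff_has_vector_derivative[symmetric])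

lemma heis_Y_left_invariant:
  "((\<lambda>s. heis_mult P (0, s, 0)) has_vector_derivative heis_Y P) (at 0)"
  unfolding heis_mult_def heis_Y_def
  by (cases P)
    (auto intro!: derivative_eq_intros has_vector_derivative_Pair
      simp: has_real_derivative_iff_has_vector_derivative[symmetric])

text \<open>
  Absolute continuity of functions (as opposed to measures) is not in the library. A finite family
  of subintervals is given by its sets of endpoint pairs; subintervals may share endpoints.
\<close>

definition absolutely_continuous_curve ::
    "real \<Rightarrow> real \<Rightarrow> (real \<Rightarrow> 'a::real_normed_vector) \<Rightarrow> bool" where
  "absolutely_continuous_curve \<alpha> \<beta> g \<longleftrightarrow>
    (\<forall>e>0. \<exists>\<delta>>0. \<forall>D :: (real \<times> real) set.
      finite D \<longrightarrow>
      (\<forall>(u, v)\<in>D. \<alpha> \<le> u \<and> u < v \<and> v \<le> \<beta>) \<longrightarrow>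
      disjoint_family_on (\<lambda>(u, v). {u<..<v}) D \<longrightarrow>
      (\<Sum>(u, v)\<in>D. v - u) < \<delta> \<longrightarrow>
      (\<Sum>(u, v)\<in>D. norm (g v - g u)) < e)"

text \<open>
  \<open>a\<close> and \<open>b\<close> are the coordinates of the velocity of \<open>\<gamma>\<close> in the horizontal frame; the curve
  determines them almost everywhere.
\<close>

definition horizontal_velocity ::
    "real \<Rightarrow> real \<Rightarrow> (real \<Rightarrow> heis) \<Rightarrow> (real \<Rightarrow> real) \<Rightarrow> (real \<Rightarrow> real) \<Rightarrow> bool" where
  "horizontal_velocity \<alpha> \<beta> \<gamma> a b \<longleftrightarrow>
    a \<in> borel_measurable (lebesgue_on {\<alpha>..\<beta>}) \<and>
    b \<in> borel_measurable (lebesgue_on {\<alpha>..\<beta>}) \<and>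
    (AE s in lebesgue_on {\<alpha>..\<beta>}.
      (\<gamma> has_vector_derivative a s *\<^sub>R heis_X (\<gamma> s) + b s *\<^sub>R heis_Y (\<gamma> s))
        (at s within {\<alpha>..\<beta>}))"

definition horizontal_curve :: "real \<Rightarrow> real \<Rightarrow> (real \<Rightarrow> heis) \<Rightarrow> bool" where
  "horizontal_curve \<alpha> \<beta> \<gamma> \<longleftrightarrow>
    \<alpha> < \<beta> \<and> absolutely_continuous_curve \<alpha> \<beta> \<gamma> \<and> (\<exists>a b. horizontal_velocity \<alpha> \<beta> \<gamma> a b)"

definition horizontal_speed_length :: "real \<Rightarrow> real \<Rightarrow> (real \<Rightarrow> real) \<Rightarrow> (real \<Rightarrow> real) \<Rightarrow> real" where
  "horizontal_speed_length \<alpha> \<beta> a b = (LINT s|lebesgue_on {\<alpha>..\<beta>}. sqrt ((a s)\<^sup>2 + (b s)\<^sup>2))"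

text \<open>
  The set below is bounded below by 0 and, as any two points are joined by a horizontal curve,
  nonempty, so the real-valued infimum is the intended one. Absolute continuity of \<open>\<gamma>\<close> makes
  \<open>a\<close> and \<open>b\<close> integrable, so every length in it is a genuine integral.
\<close>

definition control_dist :: "heis \<Rightarrow> heis \<Rightarrow> real" where
  "control_dist P Q =
    Inf {horizontal_speed_length \<alpha> \<beta> a b | \<alpha> \<beta> \<gamma> a b.
      horizontal_curve \<alpha> \<beta> \<gamma> \<and> horizontal_velocity \<alpha> \<beta> \<gamma> a b \<and> \<gamma> \<alpha> = P \<and> \<gamma> \<beta> = Q}"

definition heis_biLipschitz :: "real \<Rightarrow> (heis \<Rightarrow> heis) \<Rightarrow> bool" where
  "heis_biLipschitz K f \<longleftrightarrow>
    (\<forall>P Q. inverse K * control_dist P Q \<le> control_dist (f P) (f Q) \<and>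
           control_dist (f P) (f Q) \<le> K * control_dist P Q)"

definition heis_isometry :: "(heis \<Rightarrow> heis) \<Rightarrow> bool" where
  "heis_isometry T \<longleftrightarrow> (\<forall>P Q. control_dist (T P) (T Q) = control_dist P Q)"

end

theory Submission
  imports Defs
begin

text \<open>
  Only three properties of the control distance matter: it is invariant under the similarities of the
  group, the distance from the origin to \<open>(z, t)\<close> is at most \<open>|z| + 2 sqrt |t|\<close>, and its fourth power is at
  least \<open>|z|^4 + t^2\<close>. Along a chain of \<open>n\<close> equal steps whose lengths almost add up, the vertical
  parts of the steps contribute to the distance of the endpoints only through the square root of their
  sum; hence some steps are almost horizontal. In the image under \<open>f\<close> of a segment from 0 to a
  unit horizontal vector \<open>e\<close>, bending such a step shows that for \<open>P\<close> near \<open>f 0 = 0\<close> the distance from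
  \<open>P\<close> to \<open>f e\<close> is at most \<open>1 - v \<bullet> z\<close> up to a quadratic error, where \<open>z\<close> is the projection of \<open>P\<close> to the
  plane. The analogous bounds for \<open>e\<close> and \<open>- e\<close> and \<open>d (f e, f (- e)) \<ge> 2 - 2 \<epsilon>\<close> force equality up to the
  error, so that on the ball of radius \<open>sqrt \<epsilon>\<close> the projection of \<open>f\<close> is almost linear, and then almost
  orthogonal. The vertical coordinate is controlled by travelling along five horizontal segments, and
  a dilation carries any ball to that radius. The argument gives the exponent \<open>1 / 16\<close>.
\<close>

subsection \<open>Absolutely continuous curves\<close>

text \<open>A vertical displacement \<tau> of an endpoint normally costs
  \<open>sqrt \<bar>\<tau>\<bar>\<close>, which would spoil every first-order estimate. A nearly
  horizontal step of length \<open>s\<close> absorbs it at a cost of order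
  \<open>\<bar>\<tau>\<bar> / s\<close>, since a sideways detour around the step changes the
  vertical coordinate linearly. Hence the search for one straight step whose length is an absolute
  constant: it makes the error quadratic on a ball of radius \<open>r\<close>, and
  \<open>r = sqrt \<epsilon>\<close> balances this error against the bi-Lipschitz error \<epsilon>.

  The exponent arises as follows. Put \<open>\<epsilon> = \<omega> ^ 16\<close> and
  \<open>r = \<omega> ^ 8\<close>. Linearity holds up to order \<open>r^2\<close>, a relative error
  of order \<open>\<omega> ^ 8\<close>; comparing directions takes a square root, so the projection
  of \<open>f\<close> is known up to order \<open>\<omega> ^ 4 * r = \<omega> ^ 12\<close>. By the
  lower bound for the fourth power, a length deficit of that order at scale \<open>r\<close> leaves
  a vertical error of order \<open>sqrt (\<omega> ^ 12 * r ^ 3) = \<omega> ^ 18\<close>. In distance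
  this is \<open>\<omega> ^ 9\<close>, and relative to the radius it is
  \<open>\<omega>\<close>.\<close>

lemma absolutely_continuous_curve_indexed:
  assumes g: "absolutely_continuous_curve \<alpha> \<beta> g" and "0 < e"
  shows "\<exists>\<delta>>0. \<forall>(I :: 'i set) lo hi. finite I \<longrightarrow> (\<forall>i\<in>I. \<alpha> \<le> lo i \<and> lo i \<le> hi i \<and> hi i \<le> \<beta>) \<longrightarrow>
      disjoint_family_on (\<lambda>i. {lo i<..<hi i}) I \<longrightarrow> (\<Sum>i\<in>I. hi i - lo i) < \<delta> \<longrightarrow>
      (\<Sum>i\<in>I. norm (g (hi i) - g (lo i))) < e"
proof -
  obtain \<delta> where \<delta>: "0 < \<delta>" and ac: "\<forall>D :: (real \<times> real) set. finite D \<longrightarrow>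
      (\<forall>(u, v)\<in>D. \<alpha> \<le> u \<and> u < v \<and> v \<le> \<beta>) \<longrightarrow> disjoint_family_on (\<lambda>(u, v). {u<..<v}) D \<longrightarrow>
      (\<Sum>(u, v)\<in>D. v - u) < \<delta> \<longrightarrow> (\<Sum>(u, v)\<in>D. norm (g v - g u)) < e"
    using g[unfolded absolutely_continuous_curve_def, rule_format, OF \<open>0 < e\<close>] by blast
  show ?thesis
  proof (intro exI[of _ \<delta>] conjI \<delta> allI impI)
    fix I :: "'i set" and lo hi
    assume fin: "finite I" and bds0: "\<forall>i\<in>I. \<alpha> \<le> lo i \<and> lo i \<le> hi i \<and> hi i \<le> \<beta>"
      and disj0: "disjoint_family_on (\<lambda>i. {lo i<..<hi i}) I"
      and small: "(\<Sum>i\<in>I. hi i - lo i) < \<delta>"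
    have bds: "\<alpha> \<le> lo i \<and> lo i \<le> hi i \<and> hi i \<le> \<beta>" if "i \<in> I" for i
      using bds0 that by blast
    have disj: "{lo i<..<hi i} \<inter> {lo j<..<hi j} = {}" if "i \<in> I" "j \<in> I" "i \<noteq> j" for i j
      using disj0[unfolded disjoint_family_on_def, rule_format, OF that] .
    \<comment> \<open>Indices with equal endpoints can differ only for degenerate intervals, because
      the open intervals are disjoint. Dropping the degenerate ones changes neither sum and makes
      the map to endpoint pairs injective.\<close>
    define J where "J = {i \<in> I. lo i < hi i}"
    have J: "finite J" "J \<subseteq> I" using fin by (auto simp: J_def)
    have inj: "inj_on (\<lambda>i. (lo i, hi i)) J"
    proof (rule inj_onI, rule ccontr)
      fix i j assume ij: "i \<in> J" "j \<in> J" "(lo i, hi i) = (lo j, hi j)" "i \<noteq> j"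
      then have "{lo i<..<hi i} \<inter> {lo j<..<hi j} = {}"
        by (intro disj) (auto simp: J_def)
      then show False using ij by (auto simp: J_def)
    qed
    have 1: "(\<Sum>i\<in>J. F (lo i) (hi i)) = (\<Sum>i\<in>I. F (lo i) (hi i))"
      if "\<And>u. F u u = 0" for F :: "real \<Rightarrow> real \<Rightarrow> real"
    proof (rule sum.mono_neutral_left)
      have "lo i = hi i" if "i \<in> I - J" for i
        using that bds[of i] by (auto simp: J_def)
      with \<open>\<And>u. F u u = 0\<close> show "\<forall>i\<in>I - J. F (lo i) (hi i) = 0" by metis
    qed (use fin J in auto)
    have 2: "(\<Sum>(u, v)\<in>(\<lambda>i. (lo i, hi i)) ` J. F u v) = (\<Sum>i\<in>I. F (lo i) (hi i))"
      if "\<And>u. F u u = 0" for F :: "real \<Rightarrow> real \<Rightarrow> real"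
      using 1[of F] that by (simp add: sum.reindex[OF inj])
    have "(\<Sum>(u, v)\<in>(\<lambda>i. (lo i, hi i)) ` J. norm (g v - g u)) < e"
    proof (rule ac[rule_format])
      show "disjoint_family_on (\<lambda>(u, v). {u<..<v}) ((\<lambda>i. (lo i, hi i)) ` J)"
        unfolding disjoint_family_on_def
      proof (intro ballI impI)
        fix p q assume "p \<in> (\<lambda>i. (lo i, hi i)) ` J" "q \<in> (\<lambda>i. (lo i, hi i)) ` J" "p \<noteq> q"
        then obtain i j where ij: "i \<in> I" "j \<in> I" "i \<noteq> j" "p = (lo i, hi i)" "q = (lo j, hi j)"
          using J(2) by blast
        then show "(case p of (u, v) \<Rightarrow> {u<..<v}) \<inter> (case q of (u, v) \<Rightarrow> {u<..<v}) = {}"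
          using disj[OF ij(1-3)] by simp
      qed
      show "(\<Sum>(u, v)\<in>(\<lambda>i. (lo i, hi i)) ` J. v - u) < \<delta>"
        using small by (subst 2) auto
      show "finite ((\<lambda>i. (lo i, hi i)) ` J)" using J by simp
      show "\<And>p. p \<in> (\<lambda>i. (lo i, hi i)) ` J \<Longrightarrow> case p of (u, v) \<Rightarrow> \<alpha> \<le> u \<and> u < v \<and> v \<le> \<beta>"
        using bds by (auto simp: J_def)
    qed
    then show "(\<Sum>i\<in>I. norm (g (hi i) - g (lo i))) < e"
      by (subst (asm) 2) auto
  qed
qed

lemma sum_disjoint_intervals_le_measure:
  fixes lo hi :: "'i \<Rightarrow> real"
  assumes "finite I" and T: "T \<in> lmeasurable"
    and sub: "\<And>i. i \<in> I \<Longrightarrow> lo i \<le> hi i \<and> {lo i..hi i} \<subseteq> T"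
    and disj: "\<And>i j. \<lbrakk>i \<in> I; j \<in> I; i \<noteq> j\<rbrakk> \<Longrightarrow> {lo i<..<hi i} \<inter> {lo j<..<hi j} = {}"
  shows "(\<Sum>i\<in>I. hi i - lo i) \<le> measure lebesgue T"
proof -
  have m: "{lo i<..<hi i} \<in> lmeasurable" for i
    by (metis box_real(1) lmeasurable_box)
  have "(\<Sum>i\<in>I. hi i - lo i) = (\<Sum>i\<in>I. measure lebesgue {lo i<..<hi i})"
    using sub by (intro sum.cong) auto
  also have "\<dots> = measure lebesgue (\<Union>i\<in>I. {lo i<..<hi i})"
    using assms(1) disj m by (subst measure_UNION') (auto simp: pairwise_def disjnt_def)
  also have "\<dots> \<le> measure lebesgue T"
  proof (rule measure_mono_fmeasurable)
    have "{lo i<..<hi i} \<subseteq> T" if "i \<in> I" for i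
      using sub[OF that] by (meson greaterThanLessThan_subseteq_atLeastAtMost_iff order_refl subset_trans)
    then show "(\<Union>i\<in>I. {lo i<..<hi i}) \<subseteq> T" by blast
    show "(\<Union>i\<in>I. {lo i<..<hi i}) \<in> sets lebesgue" using assms(1) m by (intro sets.finite_UN) auto
  qed (use T in auto)
  finally show ?thesis .
qed

text \<open>A gauge argument. Off \<open>E\<close>, differentiability bounds the error on an
  interval by a small multiple of its length. Intervals with a tag in \<open>E\<close> lie in an
  open set of measure below \<delta>, where absolute continuity bounds the sum of the
  increments.\<close>

lemma absolutely_continuous_curve_has_integral:
  fixes g :: "real \<Rightarrow> 'a::banach"
  assumes ac: "absolutely_continuous_curve \<alpha> \<beta> g" and "\<alpha> \<le> \<beta>" and E: "negligible E"
    and deriv: "\<And>s. s \<in> {\<alpha>..\<beta>} - E \<Longrightarrow> (g has_vector_derivative g' s) (at s within {\<alpha>..\<beta>})"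
  shows "(g' has_integral (g \<beta> - g \<alpha>)) {\<alpha>..\<beta>}"
proof -
  \<comment> \<open>With the value 0 on \<open>E\<close>, a tag in \<open>E\<close> contributes only
    an increment of \<open>g\<close>, whatever \<open>g'\<close> is there.\<close>
  define h where "h s = (if s \<in> E then 0 else g' s)" for s
  have "(h has_integral (g \<beta> - g \<alpha>)) {\<alpha>..\<beta>}"
    unfolding has_integral_real
  proof (intro allI impI)
    fix e :: real
    assume "e > 0"
    define e1 where "e1 = e / (2 * (\<beta> - \<alpha> + 1))"
    have e1: "e1 > 0" "e1 * (\<beta> - \<alpha>) \<le> e / 2"
      using \<open>e > 0\<close> \<open>\<alpha> \<le> \<beta>\<close> by (auto simp: e1_def field_simps)
    have "e / 2 > 0" using \<open>e > 0\<close> by simp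
    from absolutely_continuous_curve_indexed[OF ac this, where 'i="real \<times> real set"]
    obtain \<delta> where \<delta>: "0 < \<delta>" and
    acd: "\<forall>(I :: (real \<times> real set) set) lo hi. finite I \<longrightarrow> (\<forall>i\<in>I. \<alpha> \<le> lo i \<and> lo i \<le> hi i \<and> hi i \<le> \<beta>) \<longrightarrow>
      disjoint_family_on (\<lambda>i. {lo i<..<hi i}) I \<longrightarrow> (\<Sum>i\<in>I. hi i - lo i) < \<delta> \<longrightarrow>
      (\<Sum>i\<in>I. norm (g (hi i) - g (lo i))) < e / 2"
    by blast
    obtain T where T: "open T" "E \<subseteq> T" "T - E \<in> lmeasurable" "emeasure lebesgue (T - E) < ennreal \<delta>"
      using sets_lebesgue_outer_open[of E \<delta>] \<delta> E negligible_imp_sets by blast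
    have Tm: "T \<in> lmeasurable"
      by (metis E T(2,3) Un_Diff_cancel2 fmeasurable.Un negligible_imp_measurable sup.absorb1)
    have Tl: "measure lebesgue T < \<delta>"
    proof -
      have "measure lebesgue T = measure lebesgue (T - E)"
        using E Tm by (metis fmeasurableD measure_Diff_null_set negligible_iff_null_sets)
      then show ?thesis
        using T(3,4) \<delta> by (metis emeasure_eq_measure2 ennreal_less_iff measure_nonneg)
    qed
    have "\<forall>x. \<exists>d>0. (x \<in> {\<alpha>..\<beta>} - E \<longrightarrow>
         (\<forall>y\<in>{\<alpha>..\<beta>}. norm (y-x) < d \<longrightarrow> norm (g y - g x - (y-x) *\<^sub>R g' x) \<le> e1 * norm (y-x)))
         \<and> (x \<in> E \<longrightarrow> ball x d \<subseteq> T)"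
    proof
      fix x
      show "\<exists>d>0. (x \<in> {\<alpha>..\<beta>} - E \<longrightarrow>
         (\<forall>y\<in>{\<alpha>..\<beta>}. norm (y-x) < d \<longrightarrow> norm (g y - g x - (y-x) *\<^sub>R g' x) \<le> e1 * norm (y-x)))
         \<and> (x \<in> E \<longrightarrow> ball x d \<subseteq> T)"
      proof (cases "x \<in> E")
        case True
        then show ?thesis using T by (metis DiffD2 open_contains_ball subsetD)
      next
        case False
        then show ?thesis
          using deriv[of x] e1 unfolding has_vector_derivative_def has_derivative_within_alt
          by (metis zero_less_one)
      qed
    qed
    then obtain d where d: "\<And>x. 0 < d x"
      "\<And>x y. \<lbrakk>x \<in> {\<alpha>..\<beta>}; x \<notin> E; y \<in> {\<alpha>..\<beta>}; norm (y-x) < d x\<rbrakk>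
          \<Longrightarrow> norm (g y - g x - (y-x) *\<^sub>R g' x) \<le> e1 * norm (y-x)"
      "\<And>x. x \<in> E \<Longrightarrow> ball x (d x) \<subseteq> T"
      by (metis DiffI)
    show "\<exists>\<gamma>. gauge \<gamma> \<and> (\<forall>\<D>. \<D> tagged_division_of {\<alpha>..\<beta>} \<and> \<gamma> fine \<D> \<longrightarrow>
        norm ((\<Sum>(x, k)\<in>\<D>. measure lborel k *\<^sub>R h x) - (g \<beta> - g \<alpha>)) < e)"
    proof (rule exI[of _ "\<lambda>x. ball x (d x)"], safe)
      show "gauge (\<lambda>x. ball x (d x))"
        using d(1) gauge_ball_dependent by blast
    next
      fix p
      assume ptag: "p tagged_division_of {\<alpha>..\<beta>}" and finep: "(\<lambda>x. ball x (d x)) fine p"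
      define lo hi where "lo i = Inf (snd i)" and "hi i = Sup (snd i)" for i :: "real \<times> real set"
      have fin: "finite p" using ptag by blast
      have p: "fst i \<in> {lo i..hi i}" "snd i = {lo i..hi i}" "\<alpha> \<le> lo i" "lo i \<le> hi i" "hi i \<le> \<beta>"
        "{lo i..hi i} \<subseteq> ball (fst i) (d (fst i))" if i: "i \<in> p" for i
      proof -
        obtain x K where xK: "i = (x, K)" by (cases i)
        then obtain u v where "K = cbox u v" "x \<in> K" "K \<subseteq> {\<alpha>..\<beta>}"
          using ptag i by (metis tagged_division_ofD(2-4))
        moreover then have "u \<le> v" by auto
        moreover have "K \<subseteq> ball x (d x)" using finep i xK by blast
        ultimately show "fst i \<in> {lo i..hi i}" "snd i = {lo i..hi i}" "\<alpha> \<le> lo i" "lo i \<le> hi i" "hi i \<le> \<beta>"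
          "{lo i..hi i} \<subseteq> ball (fst i) (d (fst i))"
          by (auto simp: xK lo_def hi_def)
      qed
      have disj: "{lo i<..<hi i} \<inter> {lo j<..<hi j} = {}" if "i \<in> p" "j \<in> p" "i \<noteq> j" for i j
      proof -
        have "interior (snd i) \<inter> interior (snd j) = {}"
          using tagged_division_ofD(5)[OF ptag] that by (metis prod.collapse)
        then show ?thesis using p(2) that by (metis interior_atLeastAtMost_real)
      qed
      define q where "q = {i \<in> p. fst i \<in> E}"
      have q: "finite q" "q \<subseteq> p" using fin by (auto simp: q_def)
      have "g \<beta> - g \<alpha> = (\<Sum>i\<in>p. g (hi i) - g (lo i))"
        using additive_tagged_division_1[OF \<open>\<alpha> \<le> \<beta>\<close> ptag, of g]
        by (simp add: lo_def hi_def case_prod_beta)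
      moreover have "(\<Sum>(x, k)\<in>p. measure lborel k *\<^sub>R h x) = (\<Sum>i\<in>p. (hi i - lo i) *\<^sub>R h (fst i))"
        using p(2,4) by (intro sum.cong) (auto simp: case_prod_beta)
      ultimately have "norm ((\<Sum>(x, k)\<in>p. measure lborel k *\<^sub>R h x) - (g \<beta> - g \<alpha>)) =
          norm (\<Sum>i\<in>p. (hi i - lo i) *\<^sub>R h (fst i) - (g (hi i) - g (lo i)))"
        by (simp only: sum_subtractf)
      also have "\<dots> \<le> (\<Sum>i\<in>p. norm ((hi i - lo i) *\<^sub>R h (fst i) - (g (hi i) - g (lo i))))"
        by (rule norm_sum)
      also have "\<dots> = (\<Sum>i\<in>p - q. norm ((hi i - lo i) *\<^sub>R h (fst i) - (g (hi i) - g (lo i))))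
          + (\<Sum>i\<in>q. norm ((hi i - lo i) *\<^sub>R h (fst i) - (g (hi i) - g (lo i))))"
        using q fin by (metis (no_types, lifting) sum.subset_diff)
      also have "\<dots> = (\<Sum>i\<in>p - q. norm ((hi i - lo i) *\<^sub>R h (fst i) - (g (hi i) - g (lo i))))
          + (\<Sum>i\<in>q. norm (g (hi i) - g (lo i)))"
        by (simp add: q_def h_def norm_minus_commute)
      also have "\<dots> < e1 * (\<beta> - \<alpha>) + e / 2"
      proof (rule add_le_less_mono)
        have "(\<Sum>i\<in>p - q. norm ((hi i - lo i) *\<^sub>R h (fst i) - (g (hi i) - g (lo i))))
            \<le> (\<Sum>i\<in>p - q. e1 * (hi i - lo i))"
        proof (rule sum_mono)
          fix i assume i: "i \<in> p - q"
          define x where "x = fst i"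
          have x: "x \<notin> E" "lo i \<le> x" "x \<le> hi i" "x \<in> {\<alpha>..\<beta>}" using i p[of i] by (auto simp: q_def x_def)
          have lh: "norm (lo i - x) < d x" "norm (hi i - x) < d x" "lo i \<in> {\<alpha>..\<beta>}" "hi i \<in> {\<alpha>..\<beta>}"
            using i p[of i] subsetD[OF p(6)[of i], of "lo i"] subsetD[OF p(6)[of i], of "hi i"]
            by (auto simp: x_def dist_norm norm_minus_commute)
          have "norm ((hi i - lo i) *\<^sub>R h x - (g (hi i) - g (lo i))) =
            norm (g (lo i) - g x - (lo i - x) *\<^sub>R g' x - (g (hi i) - g x - (hi i - x) *\<^sub>R g' x))"
            using x by (auto simp: algebra_simps h_def)
          also have "\<dots> \<le> norm (g (lo i) - g x - (lo i - x) *\<^sub>R g' x) + norm (g (hi i) - g x - (hi i - x) *\<^sub>R g' x)"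
            by (rule norm_triangle_ineq4)
          also have "\<dots> \<le> e1 * norm (lo i - x) + e1 * norm (hi i - x)"
            by (intro add_mono d x lh)
          also have "\<dots> = e1 * (hi i - lo i)" using x by (simp add: algebra_simps)
          finally show "norm ((hi i - lo i) *\<^sub>R h (fst i) - (g (hi i) - g (lo i))) \<le> e1 * (hi i - lo i)"
            by (simp add: x_def)
        qed
        also have "\<dots> \<le> (\<Sum>i\<in>p. e1 * (hi i - lo i))"
          using fin p e1 by (intro sum_mono2) auto
        also have "\<dots> = e1 * (\<beta> - \<alpha>)"
          using additive_tagged_division_1[OF \<open>\<alpha> \<le> \<beta>\<close> ptag, of "\<lambda>x. x"]
          by (simp add: lo_def hi_def case_prod_beta sum_distrib_left[symmetric])
        finally show "(\<Sum>i\<in>p - q. norm ((hi i - lo i) *\<^sub>R h (fst i) - (g (hi i) - g (lo i)))) \<le> e1 * (\<beta> - \<alpha>)" .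
        show "(\<Sum>i\<in>q. norm (g (hi i) - g (lo i))) < e / 2"
        proof -
          have bd: "\<alpha> \<le> lo i \<and> lo i \<le> hi i \<and> hi i \<le> \<beta>" if "i \<in> q" for i
            using p(3-5)[of i] q that by blast
          have dj: "disjoint_family_on (\<lambda>i. {lo i<..<hi i}) q"
            unfolding disjoint_family_on_def using disj q by blast
          have "(\<Sum>i\<in>q. hi i - lo i) \<le> measure lebesgue T"
          proof (rule sum_disjoint_intervals_le_measure[OF q(1) Tm])
            show "lo i \<le> hi i \<and> {lo i..hi i} \<subseteq> T" if "i \<in> q" for i
              using that p[of i] d(3)[of "fst i"] by (auto simp: q_def)
            show "{lo i<..<hi i} \<inter> {lo j<..<hi j} = {}" if "i \<in> q" "j \<in> q" "i \<noteq> j" for i j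
              by (rule disj[OF subsetD[OF q(2)] subsetD[OF q(2)]]) (fact that)+
          qed
          then have "(\<Sum>i\<in>q. hi i - lo i) < \<delta>" using Tl by simp
          then show ?thesis using acd[rule_format, OF q(1) bd dj] by blast
        qed
      qed
      finally show "norm ((\<Sum>(x, k)\<in>p. measure lborel k *\<^sub>R h x) - (g \<beta> - g \<alpha>)) < e"
        using e1 by simp
    qed
  qed
  moreover have "g' s = h s" if "s \<in> {\<alpha>..\<beta>} - E" for s
    using that by (simp add: h_def)
  ultimately show ?thesis
    using has_integral_spike[OF E] by blast
qed

lemma absolutely_continuous_curve_subinterval:
  assumes g: "absolutely_continuous_curve \<alpha> \<beta> g" and "\<alpha> \<le> u" "v \<le> \<beta>"
  shows "absolutely_continuous_curve u v g"
proof -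
  have "(\<forall>(p, q)\<in>D. \<alpha> \<le> p \<and> p < q \<and> q \<le> \<beta>)" if "\<forall>(p, q)\<in>D. u \<le> p \<and> p < q \<and> q \<le> v" for D
    using that assms(2,3) by (auto dest!: bspec)
  then show ?thesis
    using g unfolding absolutely_continuous_curve_def by (meson order_refl)
qed

text \<open>Absolute continuity with tolerance 1 bounds the variation of \<open>g\<close> on every
  interval shorter than the matching \<delta>, and a bounded variation of the indefinite integral
  gives absolute integrability. Finitely many such intervals cover
  \<open>{\<alpha>..\<beta>}\<close>.\<close>

lemma absolutely_continuous_curve_absolutely_integrable:
  fixes g :: "real \<Rightarrow> 'a::euclidean_space"
  assumes ac: "absolutely_continuous_curve \<alpha> \<beta> g" and "\<alpha> \<le> \<beta>" and E: "negligible E"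
    and deriv: "\<And>s. s \<in> {\<alpha>..\<beta>} - E \<Longrightarrow> (g has_vector_derivative g' s) (at s within {\<alpha>..\<beta>})"
  shows "g' absolutely_integrable_on {\<alpha>..\<beta>}"
proof -
  from absolutely_continuous_curve_indexed[OF ac zero_less_one, where 'i="real set"]
  obtain \<delta> where \<delta>: "0 < \<delta>" and
    acd: "\<forall>(I :: (real set) set) lo hi. finite I \<longrightarrow> (\<forall>i\<in>I. \<alpha> \<le> lo i \<and> lo i \<le> hi i \<and> hi i \<le> \<beta>) \<longrightarrow>
      disjoint_family_on (\<lambda>i. {lo i<..<hi i}) I \<longrightarrow> (\<Sum>i\<in>I. hi i - lo i) < \<delta> \<longrightarrow>
      (\<Sum>i\<in>I. norm (g (hi i) - g (lo i))) < 1"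
    by blast
  have int: "(g' has_integral (g v - g u)) {u..v}" if "\<alpha> \<le> u" "u \<le> v" "v \<le> \<beta>" for u v
  proof (rule absolutely_continuous_curve_has_integral[OF _ that(2) E])
    show "absolutely_continuous_curve u v g"
      using absolutely_continuous_curve_subinterval[OF ac] that by blast
    show "(g has_vector_derivative g' s) (at s within {u..v})" if s: "s \<in> {u..v} - E" for s
      using deriv[of s] s that \<open>\<alpha> \<le> u\<close> \<open>v \<le> \<beta>\<close>
      by (auto intro: has_vector_derivative_within_subset)
  qed
  have short: "g' absolutely_integrable_on {u..v}" if uv: "\<alpha> \<le> u" "u \<le> v" "v \<le> \<beta>" "v - u < \<delta>" for u v
    unfolding box_real(2)[symmetric]
  proof (rule bounded_variation_absolutely_integrable_interval)
    show "g' integrable_on cbox u v" using int[OF uv(1-3)] by auto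
    fix \<D> assume "\<D> division_of cbox u v"
    then have div: "\<D> division_of {u..v}" by simp
    have K: "K = {Inf K..Sup K}" "u \<le> Inf K" "Inf K \<le> Sup K" "Sup K \<le> v" if KD: "K \<in> \<D>" for K
    proof -
      obtain a b where "K = cbox a b" using division_ofD(4)[OF div KD] by auto
      moreover have "K \<noteq> {}" "K \<subseteq> {u..v}" using division_ofD(2,3)[OF div KD] by auto
      ultimately show "K = {Inf K..Sup K}" "u \<le> Inf K" "Inf K \<le> Sup K" "Sup K \<le> v" by auto
    qed
    have disj: "{Inf i<..<Sup i} \<inter> {Inf j<..<Sup j} = {}" if "i \<in> \<D>" "j \<in> \<D>" "i \<noteq> j" for i j
      using division_ofD(5)[OF div that] K(1) that by (metis interior_atLeastAtMost_real)
    have "(\<Sum>K\<in>\<D>. norm (integral K g')) = (\<Sum>K\<in>\<D>. norm (g (Sup K) - g (Inf K)))"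
    proof (rule sum.cong)
      fix x assume x: "x \<in> \<D>"
      have "integral {Inf x..Sup x} g' = g (Sup x) - g (Inf x)"
        using int[of "Inf x" "Sup x"] K(2-4)[OF x] uv by (intro integral_unique) auto
      then show "norm (integral x g') = norm (g (Sup x) - g (Inf x))" using K(1)[OF x] by simp
    qed simp
    also have "\<dots> < 1"
    proof -
      have bd: "\<alpha> \<le> Inf i \<and> Inf i \<le> Sup i \<and> Sup i \<le> \<beta>" if "i \<in> \<D>" for i
        using K(2-4)[OF that] uv by auto
      have dj: "disjoint_family_on (\<lambda>i. {Inf i<..<Sup i}) \<D>"
        unfolding disjoint_family_on_def using disj by blast
      have "(\<Sum>K\<in>\<D>. Sup K - Inf K) \<le> measure lebesgue {u..v}"
      proof (rule sum_disjoint_intervals_le_measure[OF division_of_finite[OF div]])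
        show "{u..v} \<in> lmeasurable" by (simp add: fmeasurable_compact)
        show "Inf i \<le> Sup i \<and> {Inf i..Sup i} \<subseteq> {u..v}" if "i \<in> \<D>" for i
          using K(2-4)[OF that] by auto
      qed (rule disj)
      then have "(\<Sum>K\<in>\<D>. Sup K - Inf K) < \<delta>" using uv by simp
      then show ?thesis using acd[rule_format, OF division_of_finite[OF div] bd dj] by blast
    qed
    finally show "(\<Sum>K\<in>\<D>. norm (integral K g')) \<le> 1" by simp
  qed
  \<comment> \<open>Pieces of length \<open>\<delta> / 2\<close> stay strictly below \<delta>; the
    cut-off at \<beta> makes the claim meaningful for every \<open>n\<close>.\<close>
  have "g' absolutely_integrable_on {\<alpha>..min \<beta> (\<alpha> + real n * (\<delta> / 2))}" for n
  proof (induction n)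
    case 0
    then show ?case using \<open>\<alpha> \<le> \<beta>\<close> short[of \<alpha> \<alpha>] \<delta> by simp
  next
    case (Suc n)
    have step: "\<alpha> + real (Suc n) * (\<delta> / 2) = \<alpha> + real n * (\<delta> / 2) + \<delta> / 2"
      by (simp add: algebra_simps add_divide_distrib)
    have "0 \<le> real n * (\<delta> / 2)" using \<delta> by simp
    show ?case
    proof (rule absolutely_integrable_on_combine[OF Suc])
      show "g' absolutely_integrable_on {min \<beta> (\<alpha> + real n * (\<delta> / 2))..min \<beta> (\<alpha> + real (Suc n) * (\<delta> / 2))}"
        unfolding step using \<delta> \<open>\<alpha> \<le> \<beta>\<close> \<open>0 \<le> real n * (\<delta> / 2)\<close> by (intro short) linarith+
      show "min \<beta> (\<alpha> + real n * (\<delta> / 2)) \<le> min \<beta> (\<alpha> + real (Suc n) * (\<delta> / 2))"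
        unfolding step using \<delta> by linarith
      show "\<alpha> \<le> min \<beta> (\<alpha> + real n * (\<delta> / 2))"
        using \<open>\<alpha> \<le> \<beta>\<close> \<open>0 \<le> real n * (\<delta> / 2)\<close> by linarith
    qed
  qed
  moreover obtain n where "(\<beta> - \<alpha>) / (\<delta> / 2) < real n"
    using reals_Archimedean2 by blast
  moreover from this have "min \<beta> (\<alpha> + real n * (\<delta> / 2)) = \<beta>"
    using \<delta> by (simp add: field_simps)
  ultimately show ?thesis
    by metis
qed

lemma AE_lebesgue_on_iff_negligible:
  assumes "S \<in> sets lebesgue"
  shows "(AE s in lebesgue_on S. P s) \<longleftrightarrow> (\<exists>E. negligible E \<and> (\<forall>s\<in>S - E. P s))"
proof -
  have "(AE s in lebesgue_on S. P s) \<longleftrightarrow> (AE s in lebesgue. s \<in> S \<longrightarrow> P s)"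
    using assms by (intro AE_restrict_space_iff) auto
  also have "\<dots> \<longleftrightarrow> (\<exists>E. negligible E \<and> {s. \<not> (s \<in> S \<longrightarrow> P s)} \<subseteq> E)"
    by (auto simp: eventually_ae_filter negligible_iff_null_sets)
  also have "\<dots> \<longleftrightarrow> (\<exists>E. negligible E \<and> (\<forall>s\<in>S - E. P s))"
    by blast
  finally show ?thesis .
qed

section \<open>Operations that preserve absolute continuity\<close>

lemma absolutely_continuous_curve_lipschitz:
  assumes g: "absolutely_continuous_curve \<alpha> \<beta> g"
    and F: "\<And>x y. norm (F x - F y) \<le> K * norm (x - y)"
  shows "absolutely_continuous_curve \<alpha> \<beta> (\<lambda>s. F (g s))"
  unfolding absolutely_continuous_curve_def
proof (intro allI impI)
  fix e :: real assume "e > 0"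
  \<comment> \<open>Positive even if \<open>K\<close> is not, so that \<open>e / M\<close> can serve
    as a tolerance.\<close>
  define M where "M = max K 1"
  have M: "M > 0" "\<And>x y. norm (F x - F y) \<le> M * norm (x - y)"
    using order_trans[OF F mult_right_mono[of K M "norm _"]] by (auto simp: M_def)
  obtain \<delta> where \<delta>: "\<delta> > 0" and ac: "\<forall>D :: (real \<times> real) set. finite D \<longrightarrow>
      (\<forall>(u, v)\<in>D. \<alpha> \<le> u \<and> u < v \<and> v \<le> \<beta>) \<longrightarrow> disjoint_family_on (\<lambda>(u, v). {u<..<v}) D \<longrightarrow>
      (\<Sum>(u, v)\<in>D. v - u) < \<delta> \<longrightarrow> (\<Sum>(u, v)\<in>D. norm (g v - g u)) < e / M"
    using g[unfolded absolutely_continuous_curve_def, rule_format, of "e / M"] \<open>e > 0\<close> M(1) by auto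
  have "(\<Sum>(u, v)\<in>D. norm (F (g v) - F (g u))) < e"
    if "(\<Sum>(u, v)\<in>D. norm (g v - g u)) < e / M" for D
  proof -
    have "(\<Sum>(u, v)\<in>D. norm (F (g v) - F (g u))) \<le> (\<Sum>(u, v)\<in>D. M * norm (g v - g u))"
      by (intro sum_mono) (use M(2) in auto)
    also have "\<dots> = M * (\<Sum>(u, v)\<in>D. norm (g v - g u))"
      by (simp add: sum_distrib_left case_prod_beta)
    also have "\<dots> < e" using that M(1) by (simp add: field_simps)
    finally show ?thesis .
  qed
  then show "\<exists>\<delta>>0. \<forall>D. finite D \<longrightarrow> (\<forall>(u, v)\<in>D. \<alpha> \<le> u \<and> u < v \<and> v \<le> \<beta>) \<longrightarrow>
      disjoint_family_on (\<lambda>(u, v). {u<..<v}) D \<longrightarrow>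
      (\<Sum>(u, v)\<in>D. v - u) < \<delta> \<longrightarrow> (\<Sum>(u, v)\<in>D. norm (F (g v) - F (g u))) < e"
    using \<delta> ac by (intro exI[of _ \<delta>]) simp
qed

lemma absolutely_continuous_curve_shift:
  assumes g: "absolutely_continuous_curve \<alpha> \<beta> g"
  shows "absolutely_continuous_curve (\<alpha> + c) (\<beta> + c) (\<lambda>s. g (s - c))"
  unfolding absolutely_continuous_curve_def
proof (intro allI impI)
  fix e :: real assume "e > 0"
  from absolutely_continuous_curve_indexed[OF g this, where 'i="real \<times> real"]
  obtain \<delta> where \<delta>: "0 < \<delta>" and
    ac: "\<forall>(I :: (real \<times> real) set) lo hi. finite I \<longrightarrow> (\<forall>i\<in>I. \<alpha> \<le> lo i \<and> lo i \<le> hi i \<and> hi i \<le> \<beta>) \<longrightarrow>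
      disjoint_family_on (\<lambda>i. {lo i<..<hi i}) I \<longrightarrow> (\<Sum>i\<in>I. hi i - lo i) < \<delta> \<longrightarrow>
      (\<Sum>i\<in>I. norm (g (hi i) - g (lo i))) < e"
    by blast
  show "\<exists>\<delta>>0. \<forall>D. finite D \<longrightarrow> (\<forall>(u, v)\<in>D. \<alpha> + c \<le> u \<and> u < v \<and> v \<le> \<beta> + c) \<longrightarrow>
      disjoint_family_on (\<lambda>(u, v). {u<..<v}) D \<longrightarrow>
      (\<Sum>(u, v)\<in>D. v - u) < \<delta> \<longrightarrow> (\<Sum>(u, v)\<in>D. norm (g (v - c) - g (u - c))) < e"
  proof (intro exI[of _ \<delta>] conjI \<delta> allI impI)
    fix D :: "(real \<times> real) set"
    assume D: "finite D" "\<forall>(u, v)\<in>D. \<alpha> + c \<le> u \<and> u < v \<and> v \<le> \<beta> + c"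
      "disjoint_family_on (\<lambda>(u, v). {u<..<v}) D" "(\<Sum>(u, v)\<in>D. v - u) < \<delta>"
    have bd: "\<forall>i\<in>D. \<alpha> \<le> fst i - c \<and> fst i - c \<le> snd i - c \<and> snd i - c \<le> \<beta>"
      using D(2) by (auto dest!: bspec)
    have "{fst i - c<..<snd i - c} \<inter> {fst j - c<..<snd j - c} = {}"
      if "i \<in> D" "j \<in> D" "i \<noteq> j" for i j
    proof -
      have "{fst i<..<snd i} \<inter> {fst j<..<snd j} = {}"
        using D(3) that unfolding disjoint_family_on_def by (metis case_prod_beta)
      moreover have "x + c \<in> {fst i<..<snd i} \<inter> {fst j<..<snd j}"
        if "x \<in> {fst i - c<..<snd i - c} \<inter> {fst j - c<..<snd j - c}" for x
        using that by (simp add: algebra_simps)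
      ultimately show ?thesis by (metis empty_iff equals0I)
    qed
    then have dj: "disjoint_family_on (\<lambda>i. {fst i - c<..<snd i - c}) D"
      by (simp only: disjoint_family_on_def) blast
    have "(\<Sum>i\<in>D. (snd i - c) - (fst i - c)) < \<delta>" using D(4) by (simp add: case_prod_beta)
    then have "(\<Sum>i\<in>D. norm (g (snd i - c) - g (fst i - c))) < e"
      using ac[THEN spec, of D, THEN spec, of "\<lambda>i. fst i - c", THEN spec, of "\<lambda>i. snd i - c"] D(1) bd dj
      by blast
    then show "(\<Sum>(u, v)\<in>D. norm (g (v - c) - g (u - c))) < e" by (simp add: case_prod_beta)
  qed
qed

text \<open>Clipping endpoints at \<open>c\<close> with \<open>min\<close> and \<open>max\<close>
  splits every interval into a part on each side. An interval that lies on one side becomes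
  degenerate on the other, which is why the indexed form of absolute continuity is applied.\<close>

lemma absolutely_continuous_curve_combine:
  assumes g1: "absolutely_continuous_curve \<alpha> c g" and g2: "absolutely_continuous_curve c \<beta> g"
    and c: "\<alpha> \<le> c" "c \<le> \<beta>"
  shows "absolutely_continuous_curve \<alpha> \<beta> g"
  unfolding absolutely_continuous_curve_def
proof (intro allI impI)
  fix e :: real assume "e > 0"
  then have e2: "e / 2 > 0" by simp
  from absolutely_continuous_curve_indexed[OF g1 e2, where 'i="real \<times> real"]
  obtain \<delta>1 where \<delta>1: "0 < \<delta>1" and
    ac1: "\<forall>(I :: (real \<times> real) set) lo hi. finite I \<longrightarrow> (\<forall>i\<in>I. \<alpha> \<le> lo i \<and> lo i \<le> hi i \<and> hi i \<le> c) \<longrightarrow>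
      disjoint_family_on (\<lambda>i. {lo i<..<hi i}) I \<longrightarrow> (\<Sum>i\<in>I. hi i - lo i) < \<delta>1 \<longrightarrow>
      (\<Sum>i\<in>I. norm (g (hi i) - g (lo i))) < e / 2"
    by blast
  from absolutely_continuous_curve_indexed[OF g2 e2, where 'i="real \<times> real"]
  obtain \<delta>2 where \<delta>2: "0 < \<delta>2" and
    ac2: "\<forall>(I :: (real \<times> real) set) lo hi. finite I \<longrightarrow> (\<forall>i\<in>I. c \<le> lo i \<and> lo i \<le> hi i \<and> hi i \<le> \<beta>) \<longrightarrow>
      disjoint_family_on (\<lambda>i. {lo i<..<hi i}) I \<longrightarrow> (\<Sum>i\<in>I. hi i - lo i) < \<delta>2 \<longrightarrow>
      (\<Sum>i\<in>I. norm (g (hi i) - g (lo i))) < e / 2"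
    by blast
  show "\<exists>\<delta>>0. \<forall>D. finite D \<longrightarrow> (\<forall>(u, v)\<in>D. \<alpha> \<le> u \<and> u < v \<and> v \<le> \<beta>) \<longrightarrow>
      disjoint_family_on (\<lambda>(u, v). {u<..<v}) D \<longrightarrow>
      (\<Sum>(u, v)\<in>D. v - u) < \<delta> \<longrightarrow> (\<Sum>(u, v)\<in>D. norm (g v - g u)) < e"
  proof (intro exI[of _ "min \<delta>1 \<delta>2"] conjI allI impI)
    show "0 < min \<delta>1 \<delta>2" using \<delta>1 \<delta>2 by simp
    fix D :: "(real \<times> real) set"
    assume D: "finite D" "\<forall>(u, v)\<in>D. \<alpha> \<le> u \<and> u < v \<and> v \<le> \<beta>"
      "disjoint_family_on (\<lambda>(u, v). {u<..<v}) D" "(\<Sum>(u, v)\<in>D. v - u) < min \<delta>1 \<delta>2"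
    have bd: "\<alpha> \<le> fst i" "fst i < snd i" "snd i \<le> \<beta>" if "i \<in> D" for i
      using D(2) that by (auto dest!: bspec)
    have dj: "{fst i<..<snd i} \<inter> {fst j<..<snd j} = {}" if "i \<in> D" "j \<in> D" "i \<noteq> j" for i j
      using D(3) that unfolding disjoint_family_on_def by (metis case_prod_beta)
    have *: "disjoint_family_on (\<lambda>i. {lo i<..<hi i}) D"
      if "\<And>i. i \<in> D \<Longrightarrow> {lo i<..<hi i} \<subseteq> {fst i<..<snd i}" for lo hi
    proof (unfold disjoint_family_on_def, intro ballI impI)
      fix i j assume ij: "i \<in> D" "j \<in> D" "i \<noteq> j"
      show "{lo i<..<hi i} \<inter> {lo j<..<hi j} = {}"
        using that[OF ij(1)] that[OF ij(2)] dj[OF ij] by (meson disjoint_iff subsetD)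
    qed
    have len: "(\<Sum>i\<in>D. hi i - lo i) < min \<delta>1 \<delta>2"
      if "\<And>i. i \<in> D \<Longrightarrow> hi i - lo i \<le> snd i - fst i" for lo hi
      using sum_mono[of D "\<lambda>i. hi i - lo i" "\<lambda>i. snd i - fst i"] that D(4)
      by (simp add: case_prod_beta)
    have 1: "(\<Sum>i\<in>D. norm (g (min (snd i) c) - g (min (fst i) c))) < e / 2"
    proof -
      have "\<forall>i\<in>D. \<alpha> \<le> min (fst i) c \<and> min (fst i) c \<le> min (snd i) c \<and> min (snd i) c \<le> c"
      proof
        fix i assume "i \<in> D"
        from bd[OF this] show "\<alpha> \<le> min (fst i) c \<and> min (fst i) c \<le> min (snd i) c \<and> min (snd i) c \<le> c"
          using c by (simp add: min_def)
      qed
      moreover have "disjoint_family_on (\<lambda>i. {min (fst i) c<..<min (snd i) c}) D"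
        by (rule *) auto
      moreover have "(\<Sum>i\<in>D. min (snd i) c - min (fst i) c) < \<delta>1"
      proof -
        have "min (snd i) c - min (fst i) c \<le> snd i - fst i" if "i \<in> D" for i
          using bd(2)[OF that] by (simp add: min_def)
        then show ?thesis using len[of "\<lambda>i. min (snd i) c" "\<lambda>i. min (fst i) c"] by simp
      qed
      ultimately show ?thesis
        using ac1[THEN spec, of D, THEN spec, of "\<lambda>i. min (fst i) c", THEN spec, of "\<lambda>i. min (snd i) c"] D(1)
        by blast
    qed
    have 2: "(\<Sum>i\<in>D. norm (g (max (snd i) c) - g (max (fst i) c))) < e / 2"
    proof -
      have "\<forall>i\<in>D. c \<le> max (fst i) c \<and> max (fst i) c \<le> max (snd i) c \<and> max (snd i) c \<le> \<beta>"
      proof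
        fix i assume "i \<in> D"
        from bd[OF this] show "c \<le> max (fst i) c \<and> max (fst i) c \<le> max (snd i) c \<and> max (snd i) c \<le> \<beta>"
          using c by (simp add: max_def)
      qed
      moreover have "disjoint_family_on (\<lambda>i. {max (fst i) c<..<max (snd i) c}) D"
        by (rule *) auto
      moreover have "(\<Sum>i\<in>D. max (snd i) c - max (fst i) c) < \<delta>2"
      proof -
        have "max (snd i) c - max (fst i) c \<le> snd i - fst i" if "i \<in> D" for i
          using bd(2)[OF that] by (simp add: max_def)
        then show ?thesis using len[of "\<lambda>i. max (snd i) c" "\<lambda>i. max (fst i) c"] by simp
      qed
      ultimately show ?thesis
        using ac2[THEN spec, of D, THEN spec, of "\<lambda>i. max (fst i) c", THEN spec, of "\<lambda>i. max (snd i) c"] D(1)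
        by blast
    qed
    have "norm (g (snd i) - g (fst i)) \<le> norm (g (min (snd i) c) - g (min (fst i) c))
        + norm (g (max (snd i) c) - g (max (fst i) c))" for i
    proof -
      have "g (snd i) - g (fst i) = (g (min (snd i) c) - g (min (fst i) c))
        + (g (max (snd i) c) - g (max (fst i) c))"
        by (auto simp: min_def max_def)
      then show ?thesis by (metis norm_triangle_ineq)
    qed
    then have "(\<Sum>i\<in>D. norm (g (snd i) - g (fst i))) \<le> (\<Sum>i\<in>D. norm (g (min (snd i) c) - g (min (fst i) c)))
        + (\<Sum>i\<in>D. norm (g (max (snd i) c) - g (max (fst i) c)))"
      by (simp add: sum.distrib[symmetric] sum_mono)
    then show "(\<Sum>(u, v)\<in>D. norm (g v - g u)) < e" using 1 2 by (simp add: case_prod_beta)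
  qed
qed

lemma absolutely_continuous_curve_cong:
  assumes g: "absolutely_continuous_curve \<alpha> \<beta> g" and eq: "\<And>s. s \<in> {\<alpha>..\<beta>} \<Longrightarrow> g s = h s"
  shows "absolutely_continuous_curve \<alpha> \<beta> h"
proof -
  have "(\<Sum>(u, v)\<in>D. norm (g v - g u)) = (\<Sum>(u, v)\<in>D. norm (h v - h u))"
    if D: "\<forall>(u, v)\<in>D. \<alpha> \<le> u \<and> u < v \<and> v \<le> \<beta>" for D
  proof (rule sum.cong)
    fix i assume "i \<in> D"
    obtain u v where uv: "i = (u, v)" by (cases i)
    with bspec[OF D \<open>i \<in> D\<close>] have "u \<in> {\<alpha>..\<beta>}" "v \<in> {\<alpha>..\<beta>}" by auto
    then show "(case i of (u, v) \<Rightarrow> norm (g v - g u)) = (case i of (u, v) \<Rightarrow> norm (h v - h u))"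
      using eq uv by simp
  qed simp
  then have "absolutely_continuous_curve \<alpha> \<beta> g \<longleftrightarrow> absolutely_continuous_curve \<alpha> \<beta> h"
    unfolding absolutely_continuous_curve_def
    by (intro all_cong1 imp_cong ex_cong1 conj_cong refl) simp
  with g show ?thesis by simp
qed

subsection \<open>Lengths of horizontal curves\<close>

text \<open>
  Absolute continuity makes measurability and integrability of the velocity automatic, so that they
  need not be recorded.
\<close>

definition horizontal_path :: "real \<Rightarrow> real \<Rightarrow> (real \<Rightarrow> heis) \<Rightarrow> (real \<Rightarrow> real) \<Rightarrow> (real \<Rightarrow> real) \<Rightarrow> real \<Rightarrow> bool" where
  "horizontal_path \<alpha> \<beta> \<gamma> a b L \<longleftrightarrow> \<alpha> < \<beta> \<and> absolutely_continuous_curve \<alpha> \<beta> \<gamma> \<and>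
    (\<exists>E. negligible E \<and> (\<forall>s\<in>{\<alpha><..<\<beta>} - E.
      (\<gamma> has_vector_derivative a s *\<^sub>R heis_X (\<gamma> s) + b s *\<^sub>R heis_Y (\<gamma> s)) (at s))) \<and>
    ((\<lambda>s. sqrt ((a s)\<^sup>2 + (b s)\<^sup>2)) has_integral L) {\<alpha>..\<beta>}"

definition joins :: "heis \<Rightarrow> heis \<Rightarrow> real \<Rightarrow> bool" where
  "joins P Q L \<longleftrightarrow> (\<exists>\<alpha> \<beta> \<gamma> a b. horizontal_path \<alpha> \<beta> \<gamma> a b L \<and> \<gamma> \<alpha> = P \<and> \<gamma> \<beta> = Q)"

text \<open>\<open>a\<close> and \<open>b\<close> are the derivatives of the first two coordinates
  of the curve, and the projection to these coordinates is Lipschitz.\<close>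

lemma horizontal_velocity_absolutely_integrable:
  assumes ac: "absolutely_continuous_curve \<alpha> \<beta> \<gamma>" and "\<alpha> < \<beta>" and E: "negligible E"
    and deriv: "\<And>s. s \<in> {\<alpha>..\<beta>} - E \<Longrightarrow>
      (\<gamma> has_vector_derivative a s *\<^sub>R heis_X (\<gamma> s) + b s *\<^sub>R heis_Y (\<gamma> s)) (at s within {\<alpha>..\<beta>})"
  shows "(\<lambda>s. (a s, b s)) absolutely_integrable_on {\<alpha>..\<beta>}"
proof (rule absolutely_continuous_curve_absolutely_integrable[OF _ _ E])
  let ?p = "\<lambda>P :: heis. (fst P, fst (snd P))"
  have bl: "bounded_linear ?p"
    by (intro bounded_linear_Pair bounded_linear_fst bounded_linear_compose[OF bounded_linear_fst bounded_linear_snd])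
  then obtain K where K: "\<And>x. norm (?p x) \<le> norm x * K"
    using bounded_linear.bounded by blast
  show "absolutely_continuous_curve \<alpha> \<beta> (\<lambda>s. ?p (\<gamma> s))"
  proof (rule absolutely_continuous_curve_lipschitz[OF ac])
    show "norm (?p x - ?p y) \<le> K * norm (x - y)" for x y
      using K[of "x - y"] by (simp add: mult.commute)
  qed
  show "((\<lambda>s. ?p (\<gamma> s)) has_vector_derivative (a s, b s)) (at s within {\<alpha>..\<beta>})"
    if "s \<in> {\<alpha>..\<beta>} - E" for s
    using bounded_linear.has_vector_derivative[OF bl deriv[OF that]]
    by (simp add: heis_X_def heis_Y_def case_prod_beta)
qed (use \<open>\<alpha> < \<beta>\<close> in simp)

text \<open>At interior points the derivative within the closed interval is the ordinary one, so
  adding both endpoints to the exceptional set turns one formulation into the other. Measurability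
  and the value of the integral follow from absolute integrability of the velocity.\<close>

lemma horizontal_path_iff:
  "horizontal_path \<alpha> \<beta> \<gamma> a b L \<longleftrightarrow>
    horizontal_curve \<alpha> \<beta> \<gamma> \<and> horizontal_velocity \<alpha> \<beta> \<gamma> a b \<and> L = horizontal_speed_length \<alpha> \<beta> a b"
proof -
  have key: "a \<in> borel_measurable (lebesgue_on {\<alpha>..\<beta>}) \<and> b \<in> borel_measurable (lebesgue_on {\<alpha>..\<beta>}) \<and>
      ((\<lambda>s. sqrt ((a s)\<^sup>2 + (b s)\<^sup>2)) has_integral horizontal_speed_length \<alpha> \<beta> a b) {\<alpha>..\<beta>}"
    if "absolutely_continuous_curve \<alpha> \<beta> \<gamma>" "\<alpha> < \<beta>" "negligible E"
      "\<And>s. s \<in> {\<alpha>..\<beta>} - E \<Longrightarrow>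
        (\<gamma> has_vector_derivative a s *\<^sub>R heis_X (\<gamma> s) + b s *\<^sub>R heis_Y (\<gamma> s)) (at s within {\<alpha>..\<beta>})" for E
  proof -
    have ai: "(\<lambda>s. (a s, b s)) absolutely_integrable_on {\<alpha>..\<beta>}"
      using horizontal_velocity_absolutely_integrable[OF that] by blast
    have S: "{\<alpha>..\<beta>} \<in> sets lebesgue" by simp
    have m: "(\<lambda>s. (a s, b s)) \<in> borel_measurable (lebesgue_on {\<alpha>..\<beta>})"
      and i: "integrable (lebesgue_on {\<alpha>..\<beta>}) (\<lambda>s. sqrt ((a s)\<^sup>2 + (b s)\<^sup>2))"
      using ai by (simp_all add: absolutely_integrable_measurable[OF S] o_def norm_Pair)
    have "(\<lambda>s. fst (a s, b s)) \<in> borel_measurable (lebesgue_on {\<alpha>..\<beta>})"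
      "(\<lambda>s. snd (a s, b s)) \<in> borel_measurable (lebesgue_on {\<alpha>..\<beta>})"
      using m by (intro borel_measurable_continuous_on[OF _ m] continuous_intros)+
    with has_integral_integral_lebesgue_on[OF i S] show ?thesis
      by (simp add: horizontal_speed_length_def)
  qed
  show ?thesis
  proof
    assume hp: "horizontal_path \<alpha> \<beta> \<gamma> a b L"
    then obtain E where E: "\<alpha> < \<beta>" "absolutely_continuous_curve \<alpha> \<beta> \<gamma>" "negligible E"
      and d: "\<And>s. s \<in> {\<alpha><..<\<beta>} - E \<Longrightarrow>
        (\<gamma> has_vector_derivative a s *\<^sub>R heis_X (\<gamma> s) + b s *\<^sub>R heis_Y (\<gamma> s)) (at s)"
      and L: "((\<lambda>s. sqrt ((a s)\<^sup>2 + (b s)\<^sup>2)) has_integral L) {\<alpha>..\<beta>}"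
      unfolding horizontal_path_def by blast
    have E': "negligible (E \<union> {\<alpha>, \<beta>})" using E(3) by (simp add: negligible_Un)
    have d': "(\<gamma> has_vector_derivative a s *\<^sub>R heis_X (\<gamma> s) + b s *\<^sub>R heis_Y (\<gamma> s)) (at s within {\<alpha>..\<beta>})"
      if "s \<in> {\<alpha>..\<beta>} - (E \<union> {\<alpha>, \<beta>})" for s
    proof (rule has_vector_derivative_at_within[OF d])
      show "s \<in> {\<alpha><..<\<beta>} - E" using that by (simp add: less_le)
    qed
    note k = key[OF E(2,1) E' d']
    have "horizontal_velocity \<alpha> \<beta> \<gamma> a b"
      unfolding horizontal_velocity_def
    proof (intro conjI)
      show "AE s in lebesgue_on {\<alpha>..\<beta>}. (\<gamma> has_vector_derivative a s *\<^sub>R heis_X (\<gamma> s) + b s *\<^sub>R heis_Y (\<gamma> s))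
          (at s within {\<alpha>..\<beta>})"
        by (subst AE_lebesgue_on_iff_negligible) (use E' d' in \<open>simp, blast\<close>)
    qed (use k in blast)+
    moreover have "L = horizontal_speed_length \<alpha> \<beta> a b"
      using k L has_integral_unique by blast
    ultimately show "horizontal_curve \<alpha> \<beta> \<gamma> \<and> horizontal_velocity \<alpha> \<beta> \<gamma> a b \<and> L = horizontal_speed_length \<alpha> \<beta> a b"
      using E unfolding horizontal_curve_def by blast
  next
    assume h: "horizontal_curve \<alpha> \<beta> \<gamma> \<and> horizontal_velocity \<alpha> \<beta> \<gamma> a b \<and> L = horizontal_speed_length \<alpha> \<beta> a b"
    then obtain E where E: "negligible E" and d: "\<And>s. s \<in> {\<alpha>..\<beta>} - E \<Longrightarrow>
        (\<gamma> has_vector_derivative a s *\<^sub>R heis_X (\<gamma> s) + b s *\<^sub>R heis_Y (\<gamma> s)) (at s within {\<alpha>..\<beta>})"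
      unfolding horizontal_velocity_def by (subst (asm) AE_lebesgue_on_iff_negligible) (simp, blast)
    have ab: "\<alpha> < \<beta>" "absolutely_continuous_curve \<alpha> \<beta> \<gamma>" using h by (auto simp: horizontal_curve_def)
    have "(\<gamma> has_vector_derivative a s *\<^sub>R heis_X (\<gamma> s) + b s *\<^sub>R heis_Y (\<gamma> s)) (at s)"
      if "s \<in> {\<alpha><..<\<beta>} - E" for s
      using d[of s] that by (simp add: at_within_Icc_at)
    then show "horizontal_path \<alpha> \<beta> \<gamma> a b L"
      unfolding horizontal_path_def using ab E key[OF ab(2,1) E d] h by blast
  qed
qed

lemma control_dist_eq_Inf: "control_dist P Q = Inf {L. joins P Q L}"
  unfolding control_dist_def joins_def horizontal_path_iff
  by (rule arg_cong[of _ _ Inf]) blast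

section \<open>Shifting, concatenating and transforming horizontal paths\<close>

lemma horizontal_path_shift:
  assumes "horizontal_path \<alpha> \<beta> \<gamma> a b L"
  shows "horizontal_path (\<alpha> + c) (\<beta> + c) (\<lambda>s. \<gamma> (s - c)) (\<lambda>s. a (s - c)) (\<lambda>s. b (s - c)) L"
proof -
  obtain E where E: "\<alpha> < \<beta>" "absolutely_continuous_curve \<alpha> \<beta> \<gamma>" "negligible E"
    and d: "\<And>s. s \<in> {\<alpha><..<\<beta>} - E \<Longrightarrow>
      (\<gamma> has_vector_derivative a s *\<^sub>R heis_X (\<gamma> s) + b s *\<^sub>R heis_Y (\<gamma> s)) (at s)"
    and L: "((\<lambda>s. sqrt ((a s)\<^sup>2 + (b s)\<^sup>2)) has_integral L) {\<alpha>..\<beta>}"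
    using assms unfolding horizontal_path_def by blast
  have "((\<lambda>s. \<gamma> (s - c)) has_vector_derivative
      a (s - c) *\<^sub>R heis_X (\<gamma> (s - c)) + b (s - c) *\<^sub>R heis_Y (\<gamma> (s - c))) (at s)"
    if "s \<in> {\<alpha> + c<..<\<beta> + c} - (+) c ` E" for s
  proof -
    have "s - c \<in> {\<alpha><..<\<beta>} - E" using that by (auto simp: image_iff algebra_simps)
    have "((\<lambda>s. s - c) has_vector_derivative 1) (at s)"
      by (auto intro!: derivative_eq_intros simp: has_real_derivative_iff_has_vector_derivative[symmetric])
    from vector_diff_chain_at[OF this d[OF \<open>s - c \<in> _\<close>]] show ?thesis
      by (simp add: o_def)
  qed
  moreover have "negligible ((+) c ` E)" using E(3) by (rule negligible_translation)
  moreover have "((\<lambda>s. sqrt ((a (s - c))\<^sup>2 + (b (s - c))\<^sup>2)) has_integral L) {\<alpha> + c..\<beta> + c}"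
    using L has_integral_shift_Icc_real[of "\<lambda>s. sqrt ((a (s - c))\<^sup>2 + (b (s - c))\<^sup>2)" c L \<alpha> \<beta>]
    by (simp add: o_def)
  ultimately show ?thesis
    unfolding horizontal_path_def using E absolutely_continuous_curve_shift[OF E(2), of c] by auto
qed

lemma horizontal_path_combine:
  assumes p: "horizontal_path \<alpha> c \<gamma> a b L" and q: "horizontal_path c \<beta> \<gamma>' a' b' L'"
    and eq: "\<gamma> c = \<gamma>' c"
  shows "horizontal_path \<alpha> \<beta> (\<lambda>s. if s \<le> c then \<gamma> s else \<gamma>' s)
    (\<lambda>s. if s \<le> c then a s else a' s) (\<lambda>s. if s \<le> c then b s else b' s) (L + L')"
    (is "horizontal_path \<alpha> \<beta> ?g ?a ?b _")
proof -
  obtain E where E: "\<alpha> < c" "absolutely_continuous_curve \<alpha> c \<gamma>" "negligible E"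
    and d: "\<And>s. s \<in> {\<alpha><..<c} - E \<Longrightarrow>
      (\<gamma> has_vector_derivative a s *\<^sub>R heis_X (\<gamma> s) + b s *\<^sub>R heis_Y (\<gamma> s)) (at s)"
    and L: "((\<lambda>s. sqrt ((a s)\<^sup>2 + (b s)\<^sup>2)) has_integral L) {\<alpha>..c}"
    using p unfolding horizontal_path_def by blast
  obtain E' where E': "c < \<beta>" "absolutely_continuous_curve c \<beta> \<gamma>'" "negligible E'"
    and d': "\<And>s. s \<in> {c<..<\<beta>} - E' \<Longrightarrow>
      (\<gamma>' has_vector_derivative a' s *\<^sub>R heis_X (\<gamma>' s) + b' s *\<^sub>R heis_Y (\<gamma>' s)) (at s)"
    and L': "((\<lambda>s. sqrt ((a' s)\<^sup>2 + (b' s)\<^sup>2)) has_integral L') {c..\<beta>}"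
    using q unfolding horizontal_path_def by blast
  have ac: "absolutely_continuous_curve \<alpha> \<beta> ?g"
  proof (rule absolutely_continuous_curve_combine[of _ c])
    show "absolutely_continuous_curve \<alpha> c ?g"
      by (rule absolutely_continuous_curve_cong[OF E(2)]) auto
    show "absolutely_continuous_curve c \<beta> ?g"
      by (rule absolutely_continuous_curve_cong[OF E'(2)]) (use eq in auto)
  qed (use E E' in auto)
  \<comment> \<open>The corner at \<open>c\<close>, where the velocities of the two pieces may
    differ, goes into the exceptional set.\<close>
  have 1: "(?g has_vector_derivative ?a s *\<^sub>R heis_X (?g s) + ?b s *\<^sub>R heis_Y (?g s)) (at s)"
    if "s \<in> {\<alpha><..<\<beta>} - (E \<union> E' \<union> {c})" for s
  proof (cases "s < c")
    case True
    have "(?g has_vector_derivative a s *\<^sub>R heis_X (\<gamma> s) + b s *\<^sub>R heis_Y (\<gamma> s)) (at s)"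
      by (rule has_vector_derivative_transform_within_open[OF d, where S="{\<alpha><..<c}"]) (use that True in auto)
    then show ?thesis using True by simp
  next
    case False
    then have "c < s" using that by auto
    have "(?g has_vector_derivative a' s *\<^sub>R heis_X (\<gamma>' s) + b' s *\<^sub>R heis_Y (\<gamma>' s)) (at s)"
      by (rule has_vector_derivative_transform_within_open[OF d', where S="{c<..<\<beta>}"]) (use that \<open>c < s\<close> in auto)
    then show ?thesis using \<open>c < s\<close> by simp
  qed
  have 2: "negligible (E \<union> E' \<union> {c})" using E E' by (simp add: negligible_Un)
  have 3: "((\<lambda>s. sqrt ((?a s)\<^sup>2 + (?b s)\<^sup>2)) has_integral (L + L')) {\<alpha>..\<beta>}"
  proof (rule has_integral_combine[of _ c])
    show "((\<lambda>s. sqrt ((?a s)\<^sup>2 + (?b s)\<^sup>2)) has_integral L) {\<alpha>..c}"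
      by (rule has_integral_eq[OF _ L]) auto
    show "((\<lambda>s. sqrt ((?a s)\<^sup>2 + (?b s)\<^sup>2)) has_integral L') {c..\<beta>}"
      by (rule has_integral_spike[OF negligible_sing[of c] _ L']) auto
  qed (use E E' in auto)
  show ?thesis
    unfolding horizontal_path_def using ac 1 2 3 E(1) E'(1) by (meson less_trans)
qed

lemma joins_trans:
  assumes "joins P Q L" "joins Q S M"
  shows "joins P S (L + M)"
proof -
  obtain \<alpha> \<beta> \<gamma> a b where 1: "horizontal_path \<alpha> \<beta> \<gamma> a b L" "\<gamma> \<alpha> = P" "\<gamma> \<beta> = Q"
    using assms(1) unfolding joins_def by blast
  obtain \<alpha>' \<beta>' \<gamma>' a' b' where 2: "horizontal_path \<alpha>' \<beta>' \<gamma>' a' b' M" "\<gamma>' \<alpha>' = Q" "\<gamma>' \<beta>' = S"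
    using assms(2) unfolding joins_def by blast
  have ord: "\<alpha> < \<beta>" "\<alpha>' < \<beta>'" using 1 2 by (auto simp: horizontal_path_def)
  define c where "c = \<beta> - \<alpha>'"
  have "horizontal_path \<beta> (\<beta>' + c) (\<lambda>s. \<gamma>' (s - c)) (\<lambda>s. a' (s - c)) (\<lambda>s. b' (s - c)) M"
    using horizontal_path_shift[OF 2(1), of c] by (simp add: c_def)
  from horizontal_path_combine[OF 1(1) this] show ?thesis
    unfolding joins_def using 1 2 ord by (fastforce simp: c_def)
qed

text \<open>Left translations, rotations, dilations and the reflection are all affine in these
  coordinates and map the horizontal frame to combinations of itself, so one application of the
  chain rule covers them. The factor \<open>r\<close> is the scaling of horizontal speed.\<close>

lemma joins_affine:
  fixes \<Phi> A :: "heis \<Rightarrow> heis" and p q :: "real \<Rightarrow> real \<Rightarrow> real"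
  assumes j: "joins P Q L" and A: "bounded_linear A" and \<Phi>: "\<And>P. \<Phi> P = c + A P"
    and frame: "\<And>P a b. A (a *\<^sub>R heis_X P + b *\<^sub>R heis_Y P) = p a b *\<^sub>R heis_X (\<Phi> P) + q a b *\<^sub>R heis_Y (\<Phi> P)"
    and speed: "\<And>a b. sqrt ((p a b)\<^sup>2 + (q a b)\<^sup>2) = r * sqrt (a\<^sup>2 + b\<^sup>2)"
  shows "joins (\<Phi> P) (\<Phi> Q) (r * L)"
proof -
  obtain \<alpha> \<beta> \<gamma> a b where hp: "horizontal_path \<alpha> \<beta> \<gamma> a b L" and PQ: "\<gamma> \<alpha> = P" "\<gamma> \<beta> = Q"
    using j unfolding joins_def by blast
  then obtain E where E: "\<alpha> < \<beta>" "absolutely_continuous_curve \<alpha> \<beta> \<gamma>" "negligible E"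
    and d: "\<And>s. s \<in> {\<alpha><..<\<beta>} - E \<Longrightarrow>
      (\<gamma> has_vector_derivative a s *\<^sub>R heis_X (\<gamma> s) + b s *\<^sub>R heis_Y (\<gamma> s)) (at s)"
    and L: "((\<lambda>s. sqrt ((a s)\<^sup>2 + (b s)\<^sup>2)) has_integral L) {\<alpha>..\<beta>}"
    unfolding horizontal_path_def by blast
  obtain K where K: "\<And>x. norm (A x) \<le> norm x * K" using A bounded_linear.bounded by blast
  have "absolutely_continuous_curve \<alpha> \<beta> (\<lambda>s. \<Phi> (\<gamma> s))"
  proof (rule absolutely_continuous_curve_lipschitz[OF E(2)])
    show "norm (\<Phi> x - \<Phi> y) \<le> K * norm (x - y)" for x y
      using K[of "x - y"] by (simp add: \<Phi> mult.commute linear_diff[OF bounded_linear.linear[OF A]])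
  qed
  moreover have "((\<lambda>s. \<Phi> (\<gamma> s)) has_vector_derivative
      p (a s) (b s) *\<^sub>R heis_X (\<Phi> (\<gamma> s)) + q (a s) (b s) *\<^sub>R heis_Y (\<Phi> (\<gamma> s))) (at s)"
    if "s \<in> {\<alpha><..<\<beta>} - E" for s
    using bounded_linear.has_vector_derivative[OF A d[OF that]] unfolding frame
    by (simp add: \<Phi> has_vector_derivative_add_const add.commute[of c])
  moreover have "((\<lambda>s. sqrt ((p (a s) (b s))\<^sup>2 + (q (a s) (b s))\<^sup>2)) has_integral (r * L)) {\<alpha>..\<beta>}"
    unfolding speed using L by (rule has_integral_mult_right)
  ultimately have "horizontal_path \<alpha> \<beta> (\<lambda>s. \<Phi> (\<gamma> s)) (\<lambda>s. p (a s) (b s)) (\<lambda>s. q (a s) (b s)) (r * L)"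
    unfolding horizontal_path_def using E(1,3) by blast
  then show ?thesis unfolding joins_def using PQ by blast
qed

text \<open>On a straight line through the origin the vertical components of
  \<open>x *\<^sub>R heis_X\<close> and \<open>y *\<^sub>R heis_Y\<close> cancel, so the line is
  horizontal with constant velocity.\<close>

lemma joins_segment: "joins (0, 0, 0) (x, y, 0) (sqrt (x\<^sup>2 + y\<^sup>2))"
proof -
  let ?g = "\<lambda>s. s *\<^sub>R (x, y, 0 :: real)"
  have "absolutely_continuous_curve 0 1 ?g"
    unfolding absolutely_continuous_curve_def
  proof (intro allI impI)
    fix e :: real assume e: "e > 0"
    define M where "M = norm (x, y, 0 :: real) + 1"
    have M: "M > 0" by (simp add: M_def add_nonneg_pos)
    have "(\<Sum>(u, v)\<in>D. norm (?g v - ?g u)) < e"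
      if "\<forall>(u, v)\<in>D. 0 \<le> u \<and> u < v \<and> v \<le> 1" "(\<Sum>(u, v)\<in>D. v - u) < e / M" for D :: "(real \<times> real) set"
    proof -
      have "(\<Sum>(u, v)\<in>D. norm (?g v - ?g u)) \<le> (\<Sum>(u, v)\<in>D. M * (v - u))"
      proof (rule sum_mono)
        fix i assume "i \<in> D"
        obtain u v where uv: "i = (u, v)" by (cases i)
        with bspec[OF that(1) \<open>i \<in> D\<close>] have i: "i = (u, v)" "u < v" by auto
        have "norm (?g v - ?g u) = (v - u) * norm (x, y, 0 :: real)"
          using i(2) unfolding scaleR_left_diff_distrib[symmetric] norm_scaleR by simp
        also have "\<dots> \<le> (v - u) * M" using i by (intro mult_left_mono) (auto simp: M_def)
        finally show "(case i of (u, v) \<Rightarrow> norm (?g v - ?g u)) \<le> (case i of (u, v) \<Rightarrow> M * (v - u))"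
          by (simp only: i prod.case mult.commute)
      qed
      also have "\<dots> = M * (\<Sum>(u, v)\<in>D. v - u)" by (simp add: sum_distrib_left case_prod_beta)
      also have "\<dots> < e" using that(2) M by (simp add: field_simps)
      finally show ?thesis .
    qed
    then show "\<exists>\<delta>>0. \<forall>D :: (real \<times> real) set. finite D \<longrightarrow> (\<forall>(u, v)\<in>D. 0 \<le> u \<and> u < v \<and> v \<le> 1) \<longrightarrow>
      disjoint_family_on (\<lambda>(u, v). {u<..<v}) D \<longrightarrow>
      (\<Sum>(u, v)\<in>D. v - u) < \<delta> \<longrightarrow> (\<Sum>(u, v)\<in>D. norm (?g v - ?g u)) < e"
      using e M divide_pos_pos[OF e M(1)] by blast
  qed
  moreover have "(?g has_vector_derivative x *\<^sub>R heis_X (?g s) + y *\<^sub>R heis_Y (?g s)) (at s)" for s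
    unfolding has_vector_derivative_def
    by (auto intro!: derivative_eq_intros simp: heis_X_def heis_Y_def)
  moreover have "((\<lambda>s. sqrt (x\<^sup>2 + y\<^sup>2)) has_integral sqrt (x\<^sup>2 + y\<^sup>2)) {0..1::real}"
    using has_integral_const_real[of "sqrt (x\<^sup>2 + y\<^sup>2)" 0 1] by simp
  ultimately have "horizontal_path 0 1 ?g (\<lambda>_. x) (\<lambda>_. y) (sqrt (x\<^sup>2 + y\<^sup>2))"
    unfolding horizontal_path_def by (auto intro!: exI[of _ "{}"])
  then show ?thesis
    unfolding joins_def by (intro exI[of _ 0] exI[of _ 1] exI[of _ ?g] exI[of _ "\<lambda>_. x"] exI[of _ "\<lambda>_. y"])
      (simp add: zero_prod_def)
qed

text \<open>A calibration argument: \<open>le\<close> says that the horizontal gradient of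
  \<open>F\<close> has norm at most 1. The Lipschitz bound enters only qualitatively, to make
  \<open>F\<close> absolutely continuous along the curve; its constant does not affect the
  conclusion.\<close>

lemma joins_diff_le:
  fixes F :: "heis \<Rightarrow> real"
  assumes j: "joins P Q L"
    and lip: "\<And>x y. \<bar>F x - F y\<bar> \<le> K * norm (x - y)"
    and F: "\<And>P. (F has_derivative F' P) (at P)"
    and le: "\<And>P a b. F' P (a *\<^sub>R heis_X P + b *\<^sub>R heis_Y P) \<le> sqrt (a\<^sup>2 + b\<^sup>2)"
  shows "F Q - F P \<le> L"
proof -
  obtain \<alpha> \<beta> \<gamma> a b where hp: "horizontal_path \<alpha> \<beta> \<gamma> a b L" and PQ: "\<gamma> \<alpha> = P" "\<gamma> \<beta> = Q"
    using j unfolding joins_def by blast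
  then obtain E where E: "\<alpha> < \<beta>" "absolutely_continuous_curve \<alpha> \<beta> \<gamma>" "negligible E"
    and d: "\<And>s. s \<in> {\<alpha><..<\<beta>} - E \<Longrightarrow>
      (\<gamma> has_vector_derivative a s *\<^sub>R heis_X (\<gamma> s) + b s *\<^sub>R heis_Y (\<gamma> s)) (at s)"
    and L: "((\<lambda>s. sqrt ((a s)\<^sup>2 + (b s)\<^sup>2)) has_integral L) {\<alpha>..\<beta>}"
    unfolding horizontal_path_def by blast
  let ?v = "\<lambda>s. a s *\<^sub>R heis_X (\<gamma> s) + b s *\<^sub>R heis_Y (\<gamma> s)"
  have "((\<lambda>s. F' (\<gamma> s) (?v s)) has_integral F (\<gamma> \<beta>) - F (\<gamma> \<alpha>)) {\<alpha>..\<beta>}"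
  proof (rule absolutely_continuous_curve_has_integral)
    show "absolutely_continuous_curve \<alpha> \<beta> (\<lambda>s. F (\<gamma> s))"
      using absolutely_continuous_curve_lipschitz[OF E(2), of F K] lip by simp
    show "negligible (E \<union> {\<alpha>, \<beta>})" using E(3) by (simp add: negligible_Un)
    fix s assume "s \<in> {\<alpha>..\<beta>} - (E \<union> {\<alpha>, \<beta>})"
    then have "s \<in> {\<alpha><..<\<beta>} - E" by auto
    from has_derivative_compose[OF d[OF this, unfolded has_vector_derivative_def] F]
    have "((\<lambda>s. F (\<gamma> s)) has_vector_derivative F' (\<gamma> s) (?v s)) (at s)"
      unfolding has_vector_derivative_def
      using linear_cmul[OF has_derivative_linear[OF F]] by (metis (no_types, lifting) ext)
    then show "((\<lambda>s. F (\<gamma> s)) has_vector_derivative F' (\<gamma> s) (?v s)) (at s within {\<alpha>..\<beta>})"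
      by (rule has_vector_derivative_at_within)
  qed (use E in auto)
  from has_integral_le[OF this L le] show ?thesis using PQ by simp
qed

subsection \<open>The Koranyi lower bound\<close>

text \<open>The Koranyi gauge, the fourth root of \<open>|z|^4 + t^2\<close>, smoothed by \<delta>:
  at the origin the gauge itself is neither differentiable nor Lipschitz for the Euclidean
  norm.\<close>

definition koranyi_reg :: "real \<Rightarrow> heis \<Rightarrow> real" where
  "koranyi_reg \<delta> = (\<lambda>(x, y, t). sqrt (sqrt ((x\<^sup>2 + y\<^sup>2)\<^sup>2 + t\<^sup>2 + \<delta>)))"

lemma koranyi_reg_derivative:
  assumes "\<delta> > 0"
  shows "(koranyi_reg \<delta> has_derivative (\<lambda>(a, b, c).
    (2 * (x\<^sup>2 + y\<^sup>2) * (x * a + y * b) + t * c) /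
      (2 * sqrt ((x\<^sup>2 + y\<^sup>2)\<^sup>2 + t\<^sup>2 + \<delta>) * koranyi_reg \<delta> (x, y, t)))) (at (x, y, t))"
proof -
  have pos: "(x\<^sup>2 + y\<^sup>2)\<^sup>2 + t\<^sup>2 + \<delta> > 0" using assms by (simp add: add_nonneg_pos)
  have eq: "koranyi_reg \<delta> = (\<lambda>P. sqrt (sqrt (((fst P)\<^sup>2 + (fst (snd P))\<^sup>2)\<^sup>2 + (snd (snd P))\<^sup>2 + \<delta>)))"
    by (simp add: koranyi_reg_def fun_eq_iff case_prod_beta)
  show ?thesis
    unfolding eq using pos
    by (auto intro!: derivative_eq_intros simp: fun_eq_iff divide_simps) (simp add: algebra_simps power2_eq_square)
qed

lemma koranyi_reg_bounds:
  fixes x y t \<delta> :: real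
  assumes "\<delta> > 0"
  defines "w \<equiv> sqrt ((x\<^sup>2 + y\<^sup>2)\<^sup>2 + t\<^sup>2 + \<delta>)" and "v \<equiv> koranyi_reg \<delta> (x, y, t)"
  shows "0 < w" "0 < v" "x\<^sup>2 + y\<^sup>2 \<le> w" "\<bar>t\<bar> \<le> w" "sqrt (x\<^sup>2 + y\<^sup>2) \<le> v" "sqrt (sqrt \<delta>) \<le> v"
    "sqrt ((x\<^sup>2 + y\<^sup>2)\<^sup>2 + t\<^sup>2) \<le> w"
proof -
  have v: "v = sqrt w" by (simp add: v_def w_def koranyi_reg_def)
  show "0 < w" using assms(1) by (simp add: w_def add_nonneg_pos)
  then show "0 < v" by (simp add: v)
  show 1: "x\<^sup>2 + y\<^sup>2 \<le> w" unfolding w_def using assms(1) by (intro real_le_rsqrt) simp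
  show "\<bar>t\<bar> \<le> w" unfolding w_def using assms(1) by (intro real_le_rsqrt) simp
  show "sqrt (x\<^sup>2 + y\<^sup>2) \<le> v" using 1 by (simp add: v)
  show "sqrt (sqrt \<delta>) \<le> v" unfolding v w_def by (intro real_sqrt_le_mono) simp
  show "sqrt ((x\<^sup>2 + y\<^sup>2)\<^sup>2 + t\<^sup>2) \<le> w" unfolding w_def using assms(1) by (intro real_sqrt_le_mono) simp
qed

lemma inner2_le_sqrt: "a * x + b * y \<le> sqrt (a\<^sup>2 + b\<^sup>2) * sqrt (x\<^sup>2 + y\<^sup>2)" for a b x y :: real
  using norm_cauchy_schwarz[of "Complex a b" "Complex x y"]
  by (simp add: inner_complex_def cmod_def)

text \<open>The vertical derivative is at most \<open>1 / (2 * v)\<close> for the value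
  \<open>v\<close> of the smoothed gauge, and \<open>v\<close> never falls below
  \<open>sqrt (sqrt \<delta>)\<close>. The constant blows up as \<delta> tends to 0, but
  \<open>joins_diff_le\<close> asks only for a finite one.\<close>

lemma koranyi_reg_lipschitz:
  assumes "\<delta> > 0"
  shows "\<bar>koranyi_reg \<delta> P - koranyi_reg \<delta> Q\<bar> \<le> (1 + 1 / sqrt (sqrt \<delta>)) * norm (P - Q)"
proof -
  let ?K = "1 + 1 / sqrt (sqrt \<delta>)"
  define D where "D P h = (case P of (x, y, t) \<Rightarrow> case h of (a, b, c) \<Rightarrow>
    (2 * (x\<^sup>2 + y\<^sup>2) * (x * a + y * b) + t * c) /
      (2 * sqrt ((x\<^sup>2 + y\<^sup>2)\<^sup>2 + t\<^sup>2 + \<delta>) * koranyi_reg \<delta> (x, y, t)))" for P h :: heis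
  have "norm (koranyi_reg \<delta> P - koranyi_reg \<delta> Q) \<le> ?K * norm (P - Q)"
  proof (rule differentiable_bound[of UNIV _ D])
    show "(koranyi_reg \<delta> has_derivative D X) (at X within UNIV)" for X
    proof -
      obtain x y t where X: "X = (x, y, t)" by (cases X)
      show ?thesis unfolding X D_def prod.case using koranyi_reg_derivative[OF assms] by simp
    qed
    show "onorm (D X) \<le> ?K" for X
    proof (rule onorm_le)
      fix h :: heis
      obtain x y t where X: "X = (x, y, t)" by (cases X)
      obtain a b c where h: "h = (a, b, c)" by (cases h)
      define w v where "w = sqrt ((x\<^sup>2 + y\<^sup>2)\<^sup>2 + t\<^sup>2 + \<delta>)" and "v = koranyi_reg \<delta> (x, y, t)"
      note kb = koranyi_reg_bounds[OF assms, where x=x and y=y and t=t, folded w_def v_def]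
      have nh: "sqrt (a\<^sup>2 + b\<^sup>2) \<le> norm h" "\<bar>c\<bar> \<le> norm h"
        by (simp_all add: h norm_Pair real_le_rsqrt)
      have 1: "\<bar>x * a + y * b\<bar> \<le> v * norm h"
      proof -
        have "\<bar>x * a + y * b\<bar> \<le> sqrt (x\<^sup>2 + y\<^sup>2) * sqrt (a\<^sup>2 + b\<^sup>2)"
          using inner2_le_sqrt[of x a y b] inner2_le_sqrt[of "-x" a "-y" b] by (simp add: abs_le_iff)
        also have "\<dots> \<le> v * norm h" using kb nh by (intro mult_mono) auto
        finally show ?thesis .
      qed
      have "\<bar>2 * (x\<^sup>2 + y\<^sup>2) * (x * a + y * b) + t * c\<bar> \<le> 2 * (x\<^sup>2 + y\<^sup>2) * \<bar>x * a + y * b\<bar> + \<bar>t\<bar> * \<bar>c\<bar>"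
        by (rule order_trans[OF abs_triangle_ineq]) (simp add: abs_mult)
      also have "\<dots> \<le> 2 * w * (v * norm h) + w * norm h"
        using kb nh 1 by (intro add_mono mult_mono) auto
      also have "\<dots> = (2 * w * v) * ((1 + 1 / (2 * v)) * norm h)"
        using kb by (simp add: field_simps)
      also have "\<dots> \<le> (2 * w * v) * (?K * norm h)"
      proof -
        have "sqrt (sqrt \<delta>) > 0" using assms by simp
        then have "1 / (2 * v) \<le> 1 / sqrt (sqrt \<delta>)" using kb by (intro divide_left_mono) auto
        then show ?thesis using kb by (intro mult_left_mono mult_right_mono) auto
      qed
      finally have "\<bar>2 * (x\<^sup>2 + y\<^sup>2) * (x * a + y * b) + t * c\<bar> / (2 * w * v) \<le> ?K * norm h"
        using kb by (simp add: field_simps)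
      moreover have "norm (D X h) = \<bar>2 * (x\<^sup>2 + y\<^sup>2) * (x * a + y * b) + t * c\<bar> / (2 * w * v)"
        using kb by (simp add: D_def X h w_def[symmetric] v_def[symmetric] abs_mult)
      ultimately show "norm (D X h) \<le> ?K * norm h" by simp
    qed
  qed auto
  then show ?thesis by simp
qed

text \<open>The horizontal gradient of the smoothed gauge has norm at most 1, so along a horizontal
  curve the gauge grows no faster than length; then the smoothing is removed.\<close>

lemma koranyi_le_joins:
  assumes j: "joins (0, 0, 0) (x, y, t) L"
  shows "0 \<le> L \<and> (x\<^sup>2 + y\<^sup>2)\<^sup>2 + t\<^sup>2 \<le> L ^ 4"
proof -
  let ?k = "sqrt (sqrt ((x\<^sup>2 + y\<^sup>2)\<^sup>2 + t\<^sup>2))"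
  have main: "koranyi_reg \<delta> (x, y, t) - koranyi_reg \<delta> (0, 0, 0) \<le> L" if \<delta>: "\<delta> > 0" for \<delta>
  proof (rule joins_diff_le[OF j koranyi_reg_lipschitz[OF \<delta>]])
    let ?D = "\<lambda>P h. (case P of (x, y, t) \<Rightarrow> case h of (a, b, c) \<Rightarrow>
      (2 * (x\<^sup>2 + y\<^sup>2) * (x * a + y * b) + t * c) /
        (2 * sqrt ((x\<^sup>2 + y\<^sup>2)\<^sup>2 + t\<^sup>2 + \<delta>) * koranyi_reg \<delta> (x, y, t)))"
    fix P :: heis and a b :: real
    obtain x y t where P: "P = (x, y, t)" by (cases P)
    show "(koranyi_reg \<delta> has_derivative ?D P) (at P)"
      unfolding P prod.case using koranyi_reg_derivative[OF \<delta>] by simp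
    define w v where "w = sqrt ((x\<^sup>2 + y\<^sup>2)\<^sup>2 + t\<^sup>2 + \<delta>)" and "v = koranyi_reg \<delta> (x, y, t)"
    note kb = koranyi_reg_bounds[OF \<delta>, where x=x and y=y and t=t, folded w_def v_def]
    let ?\<rho> = "x\<^sup>2 + y\<^sup>2"
    have "?D P (a *\<^sub>R heis_X P + b *\<^sub>R heis_Y P) = ((?\<rho> * x + t * y) * a + (?\<rho> * y - t * x) * b) / (w * v)"
    proof -
      have "?D P (a *\<^sub>R heis_X P + b *\<^sub>R heis_Y P) =
          (2 * ?\<rho> * (x * a + y * b) + t * (a * (2 * y) - b * (2 * x))) / (2 * (w * v))"
        by (simp add: P heis_X_def heis_Y_def w_def v_def)
      also have "2 * ?\<rho> * (x * a + y * b) + t * (a * (2 * y) - b * (2 * x)) =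
          2 * ((?\<rho> * x + t * y) * a + (?\<rho> * y - t * x) * b)"
        by (simp add: algebra_simps)
      also have "2 * ((?\<rho> * x + t * y) * a + (?\<rho> * y - t * x) * b) / (2 * (w * v)) =
          ((?\<rho> * x + t * y) * a + (?\<rho> * y - t * x) * b) / (w * v)"
        by (rule mult_divide_mult_cancel_left) simp
      finally show ?thesis .
    qed
    also have "\<dots> \<le> sqrt (a\<^sup>2 + b\<^sup>2)"
    proof -
      have "(?\<rho> * x + t * y) * a + (?\<rho> * y - t * x) * b
        \<le> sqrt ((?\<rho> * x + t * y)\<^sup>2 + (?\<rho> * y - t * x)\<^sup>2) * sqrt (a\<^sup>2 + b\<^sup>2)"
        by (rule inner2_le_sqrt)
      \<comment> \<open>The mixed terms of the two squares cancel. What remains factors into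
        \<open>sqrt ?\<rho> * sqrt (?\<rho>\<^sup>2 + t\<^sup>2)\<close>, and this is at most the
        denominator \<open>w * v\<close>.\<close>
      also have "(?\<rho> * x + t * y)\<^sup>2 + (?\<rho> * y - t * x)\<^sup>2 = ?\<rho> * (?\<rho>\<^sup>2 + t\<^sup>2)"
        by algebra
      also have "sqrt (?\<rho> * (?\<rho>\<^sup>2 + t\<^sup>2)) = sqrt ?\<rho> * sqrt (?\<rho>\<^sup>2 + t\<^sup>2)" by (rule real_sqrt_mult)
      also have "\<dots> * sqrt (a\<^sup>2 + b\<^sup>2) \<le> (v * w) * sqrt (a\<^sup>2 + b\<^sup>2)"
        using kb by (intro mult_right_mono mult_mono) auto
      finally show ?thesis using kb(1,2) by (simp add: field_simps)
    qed
    finally show "?D P (a *\<^sub>R heis_X P + b *\<^sub>R heis_Y P) \<le> sqrt (a\<^sup>2 + b\<^sup>2)" .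
  qed
  have "?k \<le> L"
  proof (rule field_le_epsilon)
    fix e :: real assume "e > 0"
    \<comment> \<open>For \<delta> equal to \<open>e ^ 4\<close> the smoothed gauge has the value
      \<open>e\<close> at the origin, so the smoothing costs exactly \<open>e\<close>.\<close>
    then have "koranyi_reg (e ^ 4) (x, y, t) - koranyi_reg (e ^ 4) (0, 0, 0) \<le> L" by (intro main) simp
    moreover have "koranyi_reg (e ^ 4) (0, 0, 0) = e"
    proof -
      have "sqrt (e ^ 4) = e\<^sup>2" by (rule real_sqrt_unique) auto
      then show ?thesis using \<open>e > 0\<close> by (simp add: koranyi_reg_def)
    qed
    moreover have "?k \<le> koranyi_reg (e ^ 4) (x, y, t)"
      unfolding koranyi_reg_def using \<open>e > 0\<close> by simp
    ultimately show "?k \<le> L + e" by simp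
  qed
  moreover have "?k ^ 4 = (x\<^sup>2 + y\<^sup>2)\<^sup>2 + t\<^sup>2"
    using power_mult[of ?k 2 2] by simp
  moreover have "0 \<le> ?k" by simp
  ultimately show ?thesis using power_mono[of ?k L 4] by linarith
qed

subsection \<open>The control distance as a homogeneous norm\<close>

text \<open>The cocycle of the group law in complex notation: \<open>(z, t)\<close> times
  \<open>(w, s)\<close> is \<open>(z + w, t + s + sform z w)\<close>.\<close>

definition sform :: "complex \<Rightarrow> complex \<Rightarrow> real" where
  "sform z w = 2 * Im (z * cnj w)"

definition heis_of :: "complex \<Rightarrow> real \<Rightarrow> heis" where
  "heis_of z t = (Re z, Im z, t)"

text \<open>By left invariance the distances from the origin determine the metric, which is thereby
  reduced to a homogeneous norm of a planar and a vertical part.\<close>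

definition ccn :: "complex \<Rightarrow> real \<Rightarrow> real" where
  "ccn z t = control_dist (0, 0, 0) (heis_of z t)"

lemma joins_left:
  assumes "joins P Q L"
  shows "joins (heis_mult S P) (heis_mult S Q) L"
proof -
  obtain u v s where S: "S = (u, v, s)" by (cases S)
  have "joins (heis_mult S P) (heis_mult S Q) (1 * L)"
  proof (rule joins_affine[OF assms, where c=S and A="\<lambda>P. (fst P, fst (snd P), snd (snd P) + 2 * (fst P * v - u * fst (snd P)))"
      and p="\<lambda>a b. a" and q="\<lambda>a b. b"])
    show "bounded_linear (\<lambda>P. (fst P, fst (snd P), snd (snd P) + 2 * (fst P * v - u * fst (snd P))))"
      by (intro linear_conv_bounded_linear[THEN iffD1] linearI) (auto simp: algebra_simps)
  qed (auto simp: S heis_mult_def heis_X_def heis_Y_def algebra_simps)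
  then show ?thesis by simp
qed

text \<open>Multiplication of the plane by \<mu> multiplies \<open>sform\<close> by the squared
  modulus of \<mu>, so scaling the vertical axis by the same factor gives a group homomorphism.
  Rotations and dilations are thus treated together.\<close>

lemma joins_similarity:
  assumes "joins (0, 0, 0) (heis_of z t) L"
  shows "joins (0, 0, 0) (heis_of (\<mu> * z) ((cmod \<mu>)\<^sup>2 * t)) (cmod \<mu> * L)"
proof -
  define c d where "c = Re \<mu>" and "d = Im \<mu>"
  have n: "(cmod \<mu>)\<^sup>2 = c\<^sup>2 + d\<^sup>2" by (simp add: c_def d_def cmod_power2)
  let ?A = "\<lambda>P :: heis. (c * fst P - d * fst (snd P), d * fst P + c * fst (snd P), (c\<^sup>2 + d\<^sup>2) * snd (snd P))"
  have "joins (?A (0, 0, 0)) (?A (heis_of z t)) (cmod \<mu> * L)"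
  proof (rule joins_affine[OF assms, where c="(0, 0, 0)" and A="?A" and p="\<lambda>a b. c * a - d * b" and q="\<lambda>a b. d * a + c * b"])
    show "bounded_linear ?A"
      by (intro linear_conv_bounded_linear[THEN iffD1] linearI) (auto simp: algebra_simps)
    show "sqrt ((c * a - d * b)\<^sup>2 + (d * a + c * b)\<^sup>2) = cmod \<mu> * sqrt (a\<^sup>2 + b\<^sup>2)" for a b
    proof -
      have "(c * a - d * b)\<^sup>2 + (d * a + c * b)\<^sup>2 = (c\<^sup>2 + d\<^sup>2) * (a\<^sup>2 + b\<^sup>2)" by algebra
      then show ?thesis by (simp add: real_sqrt_mult c_def d_def cmod_def)
    qed
    show "?A (a *\<^sub>R heis_X P + b *\<^sub>R heis_Y P) =
        (c * a - d * b) *\<^sub>R heis_X (?A P) + (d * a + c * b) *\<^sub>R heis_Y (?A P)" for P a b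
      by (cases P) (auto simp: heis_X_def heis_Y_def algebra_simps power2_eq_square)
  qed auto
  then show ?thesis by (simp add: heis_of_def n) (simp add: c_def d_def algebra_simps)
qed

lemma joins_cnj:
  assumes "joins (0, 0, 0) (heis_of z t) L"
  shows "joins (0, 0, 0) (heis_of (cnj z) (- t)) L"
proof -
  let ?A = "\<lambda>P :: heis. (fst P, - fst (snd P), - snd (snd P))"
  have "joins (?A (0, 0, 0)) (?A (heis_of z t)) (1 * L)"
  proof (rule joins_affine[OF assms, where c="(0, 0, 0)" and A="?A" and p="\<lambda>a b. a" and q="\<lambda>a b. - b"])
    show "bounded_linear ?A"
      by (intro linear_conv_bounded_linear[THEN iffD1] linearI) (auto simp: algebra_simps)
  qed (auto simp: heis_X_def heis_Y_def)
  then show ?thesis by (simp add: heis_of_def)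
qed

lemma joins_mult:
  assumes "joins (0, 0, 0) (heis_of z t) L" "joins (0, 0, 0) (heis_of w s) M"
  shows "joins (0, 0, 0) (heis_of (z + w) (t + s + sform z w)) (L + M)"
proof -
  have "heis_mult (heis_of z t) (0, 0, 0) = heis_of z t"
    "heis_mult (heis_of z t) (heis_of w s) = heis_of (z + w) (t + s + sform z w)"
    by (auto simp: heis_mult_def heis_of_def sform_def algebra_simps)
  with joins_left[OF assms(2), of "heis_of z t"] joins_trans[OF assms(1)] show ?thesis by metis
qed

lemma joins_horizontal: "joins (0, 0, 0) (heis_of z 0) (cmod z)"
  using joins_segment[of "Re z" "Im z"] by (simp add: heis_of_def cmod_def)

text \<open>Walk around a square of side \<open>a\<close>: the loop closes in the plane, rises by
  four times its signed area, and has length \<open>4 * a\<close>. The sign \<sigma> selects the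
  orientation.\<close>

lemma joins_vertical: "joins (0, 0, 0) (heis_of 0 t) (2 * sqrt \<bar>t\<bar>)"
proof -
  define a where "a = sqrt \<bar>t\<bar> / 2"
  define \<sigma> :: real where "\<sigma> = (if t \<ge> 0 then 1 else - 1)"
  have a: "4 * a\<^sup>2 = \<bar>t\<bar>" "a \<ge> 0" by (simp_all add: a_def power_divide)
  have \<sigma>: "\<sigma> * \<bar>t\<bar> = t" "\<sigma> * \<sigma> = 1" by (auto simp: \<sigma>_def)
  let ?z = "complex_of_real a" and ?w = "Complex 0 (- \<sigma> * a)"
  have n: "cmod ?z = a" "cmod ?w = a" "cmod (- ?z) = a" "cmod (- ?w) = a"
    using a(2) \<sigma>(2) by (auto simp: cmod_def \<sigma>_def power2_eq_square)
  have j: "joins (0, 0, 0) (heis_of (?z + ?w + - ?z + - ?w) (0 + 0 + sform ?z ?w + 0 + sform (?z + ?w) (- ?z) + 0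
    + sform (?z + ?w + - ?z) (- ?w))) (a + a + a + a)"
    using joins_mult[OF joins_mult[OF joins_mult[OF joins_horizontal[of ?z] joins_horizontal[of ?w]]
      joins_horizontal[of "- ?z"]] joins_horizontal[of "- ?w"]] unfolding n .
  have eqz: "?z + ?w + - ?z + - ?w = 0" by simp
  have eqt: "0 + 0 + sform ?z ?w + 0 + sform (?z + ?w) (- ?z) + 0 + sform (?z + ?w + - ?z) (- ?w) = t"
  proof -
    have "0 + 0 + sform ?z ?w + 0 + sform (?z + ?w) (- ?z) + 0 + sform (?z + ?w + - ?z) (- ?w) = \<sigma> * (4 * a\<^sup>2)"
      by (simp add: sform_def power2_eq_square algebra_simps)
    then show ?thesis using a \<sigma> by simp
  qed
  have eqL: "a + a + a + a = 2 * sqrt \<bar>t\<bar>" by (simp add: a_def)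
  show ?thesis using j unfolding eqz eqt eqL .
qed

lemma joins_bdd_below: "bdd_below {L. joins (0, 0, 0) (heis_of z t) L}"
  using koranyi_le_joins[of "Re z" "Im z" t] by (intro bdd_belowI[of _ 0]) (auto simp: heis_of_def)

lemma joins_nonempty: "{L. joins (0, 0, 0) (heis_of z t) L} \<noteq> {}"
  using joins_mult[OF joins_horizontal joins_vertical, of z t] by (auto simp: sform_def)

lemma ccn_le: "joins (0, 0, 0) (heis_of z t) L \<Longrightarrow> ccn z t \<le> L"
  unfolding ccn_def control_dist_eq_Inf using joins_bdd_below by (intro cInf_lower) auto

lemma ccn_ge: "(\<And>L. joins (0, 0, 0) (heis_of z t) L \<Longrightarrow> c \<le> L) \<Longrightarrow> c \<le> ccn z t"
  unfolding ccn_def control_dist_eq_Inf using joins_nonempty by (intro cInf_greatest) auto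

lemma ccn_nonneg [simp]: "0 \<le> ccn z t"
  using koranyi_le_joins[of "Re z" "Im z" t] by (intro ccn_ge) (auto simp: heis_of_def)

lemma ccn_koranyi: "(cmod z) ^ 4 + t\<^sup>2 \<le> (ccn z t) ^ 4"
proof -
  let ?k = "(cmod z) ^ 4 + t\<^sup>2"
  have "root 4 ?k \<le> ccn z t"
  proof (rule ccn_ge)
    fix L assume "joins (0, 0, 0) (heis_of z t) L"
    then have "0 \<le> L" "?k \<le> L ^ 4"
      using koranyi_le_joins[of "Re z" "Im z" t L] cmod_power2[of z] power_mult[of "cmod z" 2 2]
      by (auto simp: heis_of_def)
    then have "root 4 ?k \<le> root 4 (L ^ 4)" by (intro real_root_le_mono) auto
    then show "root 4 ?k \<le> L" using \<open>0 \<le> L\<close> by (simp add: real_root_power_cancel)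
  qed
  then have "(root 4 ?k) ^ 4 \<le> (ccn z t) ^ 4" by (intro power_mono) auto
  then show ?thesis by (simp add: real_root_pow_pos2)
qed

lemma ccn_mult: "ccn (z + w) (t + s + sform z w) \<le> ccn z t + ccn w s"
proof -
  have "ccn (z + w) (t + s + sform z w) - M \<le> ccn z t" if "joins (0, 0, 0) (heis_of w s) M" for M
  proof (rule ccn_ge)
    fix L assume "joins (0, 0, 0) (heis_of z t) L"
    from ccn_le[OF joins_mult[OF this that]] show "ccn (z + w) (t + s + sform z w) - M \<le> L" by simp
  qed
  then have "ccn (z + w) (t + s + sform z w) - ccn z t \<le> ccn w s"
    by (intro ccn_ge) (simp only: diff_le_eq add.commute)
  then show ?thesis by simp
qed

lemma ccn_scale: "ccn (\<mu> * z) ((cmod \<mu>)\<^sup>2 * t) = cmod \<mu> * ccn z t"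
proof -
  have le: "ccn (\<mu> * z) ((cmod \<mu>)\<^sup>2 * t) \<le> cmod \<mu> * ccn z t" if "\<mu> \<noteq> 0" for \<mu> z t
  proof -
    have "ccn (\<mu> * z) ((cmod \<mu>)\<^sup>2 * t) / cmod \<mu> \<le> ccn z t"
    proof (rule ccn_ge)
      fix L assume "joins (0, 0, 0) (heis_of z t) L"
      from ccn_le[OF joins_similarity[OF this, of \<mu>]] that
      show "ccn (\<mu> * z) ((cmod \<mu>)\<^sup>2 * t) / cmod \<mu> \<le> L" by (simp add: divide_le_eq mult.commute)
    qed
    then show ?thesis using that by (simp add: field_simps)
  qed
  show ?thesis
  proof (cases "\<mu> = 0")
    case True
    have "ccn 0 0 \<le> 0" using ccn_le[OF joins_vertical[of 0]] by simp
    then show ?thesis using True ccn_nonneg[of 0 0] by simp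
  next
    case False
    have n: "(cmod (inverse \<mu>))\<^sup>2 * ((cmod \<mu>)\<^sup>2 * t) = t"
      using False by (simp add: norm_inverse power_inverse)
    have "ccn z t = ccn (inverse \<mu> * (\<mu> * z)) ((cmod (inverse \<mu>))\<^sup>2 * ((cmod \<mu>)\<^sup>2 * t))"
      unfolding n using False by (simp add: mult.assoc[symmetric])
    also have "\<dots> \<le> cmod (inverse \<mu>) * ccn (\<mu> * z) ((cmod \<mu>)\<^sup>2 * t)"
      using False by (intro le) simp
    finally have "ccn z t \<le> ccn (\<mu> * z) ((cmod \<mu>)\<^sup>2 * t) / cmod \<mu>"
      by (simp add: norm_inverse divide_inverse mult.commute)
    then have "cmod \<mu> * ccn z t \<le> ccn (\<mu> * z) ((cmod \<mu>)\<^sup>2 * t)"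
      using False by (simp add: le_divide_eq mult.commute)
    with le[OF False] show ?thesis by (meson antisym)
  qed
qed

lemma ccn_cnj: "ccn (cnj z) (- t) = ccn z t"
proof -
  have "ccn (cnj z) (- t) \<le> ccn z t" for z t
    using ccn_le[OF joins_cnj] by (intro ccn_ge) auto
  from this[of z t] this[of "cnj z" "- t"] show ?thesis by simp
qed

text \<open>\<open>(- z, - t)\<close> is the group inverse, so this is the symmetry of the distance.
  Reflection gives \<open>(cnj z, - t)\<close>, and the rotation by \<mu> takes \<open>cnj z\<close>
  to \<open>- z\<close> without changing the vertical coordinate.\<close>

lemma ccn_uminus: "ccn (- z) (- t) = ccn z t"
proof (cases "z = 0")
  case True
  then show ?thesis using ccn_cnj[of 0 t] by simp
next
  case False
  define \<mu> where "\<mu> = - (z / cnj z)"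
  have "cmod \<mu> = 1" "\<mu> * cnj z = - z" using False by (auto simp: \<mu>_def norm_divide)
  then have "ccn (- z) (- t) = ccn (cnj z) (- t)"
    using ccn_scale[of \<mu> "cnj z" "- t"] by simp
  then show ?thesis by (simp add: ccn_cnj)
qed

lemma cmod_le_ccn: "cmod z \<le> ccn z t"
proof -
  have "(cmod z) ^ 4 \<le> (ccn z t) ^ 4" using ccn_koranyi[of z t] zero_le_power2[of t] by linarith
  then show ?thesis by (simp add: power_mono_iff)
qed

lemma abs_le_ccn: "\<bar>t\<bar> \<le> (ccn z t)\<^sup>2"
proof -
  have "(ccn z t) ^ 4 = ((ccn z t)\<^sup>2)\<^sup>2" using power_mult[of "ccn z t" 2 2] by simp
  then have "t\<^sup>2 \<le> ((ccn z t)\<^sup>2)\<^sup>2"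
    using ccn_koranyi[of z t] zero_le_power[OF norm_ge_zero, of z 4] by linarith
  then show ?thesis using abs_le_square_iff[of t "(ccn z t)\<^sup>2"] by simp
qed

lemma ccn_horizontal [simp]: "ccn z 0 = cmod z"
  using ccn_le[OF joins_horizontal] cmod_le_ccn by (meson antisym)

lemma ccn_vertical_le: "ccn 0 t \<le> 2 * sqrt \<bar>t\<bar>"
  by (rule ccn_le[OF joins_vertical])

lemma ccn_upper: "ccn z t \<le> cmod z + 2 * sqrt \<bar>t\<bar>"
  using ccn_mult[of z 0 0 t] ccn_vertical_le[of t] by (simp add: sform_def)

lemma control_dist_heis_of:
  "control_dist (heis_of z t) (heis_of w s) = ccn (w - z) (s - t - sform z w)"
proof -
  have 1: "heis_mult (heis_of z t) (0, 0, 0) = heis_of z t"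
    "heis_mult (heis_of z t) (heis_of (w - z) (s - t - sform z w)) = heis_of w s"
    "heis_mult (heis_of (- z) (- t)) (heis_of z t) = (0, 0, 0)"
    "heis_mult (heis_of (- z) (- t)) (heis_of w s) = heis_of (w - z) (s - t - sform z w)"
    by (auto simp: heis_mult_def heis_of_def sform_def algebra_simps)
  have "joins (heis_of z t) (heis_of w s) L \<longleftrightarrow> joins (0, 0, 0) (heis_of (w - z) (s - t - sform z w)) L" for L
    using joins_left[of "heis_of z t" "heis_of w s" L "heis_of (- z) (- t)"]
      joins_left[of "(0, 0, 0)" "heis_of (w - z) (s - t - sform z w)" L "heis_of z t"] 1 by auto
  then have "{L. joins (heis_of z t) (heis_of w s) L} =
      {L. joins (0, 0, 0) (heis_of (w - z) (s - t - sform z w)) L}" by blast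
  then show ?thesis unfolding ccn_def control_dist_eq_Inf by (rule arg_cong)
qed

lemma sform_simps:
  "sform (z + z') w = sform z w + sform z' w" "sform z (w + w') = sform z w + sform z w'"
  "sform (z - z') w = sform z w - sform z' w" "sform z (w - w') = sform z w - sform z w'"
  "sform (- z) w = - sform z w" "sform z (- w) = - sform z w" "sform z z = 0" "sform 0 w = 0" "sform z 0 = 0"
  "sform (complex_of_real a * z) w = a * sform z w" "sform z (complex_of_real a * w) = a * sform z w"
  by (auto simp: sform_def algebra_simps)

lemma sform_swap: "sform w z = - sform z w"
  by (simp add: sform_def)

lemma abs_sform_le: "\<bar>sform z w\<bar> \<le> 2 * (cmod z * cmod w)"
  using abs_Im_le_cmod[of "z * cnj w"] by (simp add: sform_def abs_mult norm_mult)

lemma sform_rotate: "sform (\<i> * z) z = 2 * (cmod z)\<^sup>2"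
  unfolding cmod_power2 by (simp add: sform_def power2_eq_square)

section \<open>The distance in complex coordinates\<close>

type_synonym hpoint = "complex \<times> real"

definition hdist :: "hpoint \<Rightarrow> hpoint \<Rightarrow> real" where
  "hdist P Q = ccn (fst Q - fst P) (snd Q - snd P - sform (fst P) (fst Q))"

lemma hdist_nonneg [simp]: "0 \<le> hdist P Q"
  by (simp add: hdist_def)

lemma hdist_commute: "hdist P Q = hdist Q P"
  using ccn_uminus[of "fst P - fst Q" "snd P - snd Q - sform (fst Q) (fst P)"]
  by (simp add: hdist_def sform_swap[of "fst P"] algebra_simps)

lemma hdist_triangle: "hdist P S \<le> hdist P Q + hdist Q S"
  using ccn_mult[of "fst Q - fst P" "fst S - fst Q" "snd Q - snd P - sform (fst P) (fst Q)"
    "snd S - snd Q - sform (fst Q) (fst S)"]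
  by (simp add: hdist_def sform_simps algebra_simps)

lemma cmod_diff_le_hdist: "cmod (fst Q - fst P) \<le> hdist P Q"
  by (simp add: hdist_def cmod_le_ccn)

lemma hdist_origin [simp]: "hdist (0, 0) P = ccn (fst P) (snd P)"
  by (simp add: hdist_def sform_simps)

subsection \<open>First-order upper bounds for the distance\<close>

text \<open>
  Conjugating the two middle factors by \<open>(W, 0)\<close> moves the endpoint only vertically, by
  \<open>2 * sform W (z\<^sub>1 + z\<^sub>2)\<close>.
\<close>

lemma ccn_conjugated_path:
  "ccn (p + (z1 + z2) + q) (a + t1 + t2 + b + sform p z1 + sform (p + z1) z2 + sform (p + (z1 + z2)) q
      + 2 * sform W (z1 + z2))
    \<le> ccn p a + 2 * cmod W + ccn z1 t1 + ccn z2 t2 + ccn q b"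
proof -
  have "p + (z1 + z2) + q = p + W + z1 + z2 + - W + q" by simp
  moreover have "a + t1 + t2 + b + sform p z1 + sform (p + z1) z2 + sform (p + (z1 + z2)) q + 2 * sform W (z1 + z2)
    = a + 0 + sform p W + t1 + sform (p + W) z1 + t2 + sform (p + W + z1) z2 + 0
      + sform (p + W + z1 + z2) (- W) + b + sform (p + W + z1 + z2 + - W) q"
    using sform_swap[of W] by (simp add: sform_simps)
  ultimately have "ccn (p + (z1 + z2) + q) (a + t1 + t2 + b + sform p z1 + sform (p + z1) z2
      + sform (p + (z1 + z2)) q + 2 * sform W (z1 + z2))
      \<le> ccn (p + W + z1 + z2 + - W) (a + 0 + sform p W + t1 + sform (p + W) z1 + t2 + sform (p + W + z1) z2 + 0
        + sform (p + W + z1 + z2) (- W)) + ccn q b"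
    by (simp only: ccn_mult)
  also have "\<dots> \<le> ccn (p + W + z1 + z2) (a + 0 + sform p W + t1 + sform (p + W) z1 + t2 + sform (p + W + z1) z2)
      + ccn (- W) 0 + ccn q b"
    by (intro add_right_mono ccn_mult)
  also have "\<dots> \<le> ccn (p + W + z1) (a + 0 + sform p W + t1 + sform (p + W) z1) + ccn z2 t2
      + ccn (- W) 0 + ccn q b"
    by (intro add_right_mono ccn_mult)
  also have "\<dots> \<le> ccn (p + W) (a + 0 + sform p W) + ccn z1 t1 + ccn z2 t2 + ccn (- W) 0 + ccn q b"
    by (intro add_right_mono ccn_mult)
  also have "\<dots> \<le> ccn p a + ccn W 0 + ccn z1 t1 + ccn z2 t2 + ccn (- W) 0 + ccn q b"
    by (intro add_right_mono ccn_mult)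
  finally show ?thesis by simp
qed

text \<open>The similarity with factor \<open>1 + w / z\<close> takes \<open>z\<close> to
  \<open>z + w\<close>. Its modulus \<open>m\<close> satisfies
  \<open>m \<le> (1 + m\<^sup>2) / 2\<close>, which gives a bound whose first-order part is linear
  in \<open>w\<close>, with an explicit quadratic remainder.\<close>

lemma ccn_dilate_le:
  assumes "z \<noteq> 0"
  shows "ccn (z + w) ((1 + 2 * Re (w / z) + (cmod (w / z))\<^sup>2) * t)
    \<le> ccn z t * (1 + Re (w / z) + (cmod (w / z))\<^sup>2 / 2)"
proof -
  let ?\<mu> = "w / z"
  have sq: "(cmod (1 + ?\<mu>))\<^sup>2 = 1 + 2 * Re ?\<mu> + (cmod ?\<mu>)\<^sup>2"
    unfolding cmod_power2 by (simp add: power2_eq_square algebra_simps)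
  have "2 * cmod (1 + ?\<mu>) \<le> 1 + (cmod (1 + ?\<mu>))\<^sup>2"
    using zero_le_power2[of "cmod (1 + ?\<mu>) - 1"] by (simp add: power2_eq_square algebra_simps)
  then have "cmod (1 + ?\<mu>) \<le> 1 + Re ?\<mu> + (cmod ?\<mu>)\<^sup>2 / 2" using sq by simp
  moreover have "z + w = (1 + ?\<mu>) * z" using assms by (simp add: field_simps)
  ultimately show ?thesis
    using ccn_scale[of "1 + ?\<mu>" z t] unfolding sq[symmetric]
    by (simp add: mult.commute[of "ccn z t"] mult_right_mono)
qed

lemma ex_real_linear_inner:
  fixes g :: "complex \<Rightarrow> real"
  assumes "linear g"
  obtains v where "\<And>z. g z = inner v z"
proof
  fix z
  have "z = Re z *\<^sub>R 1 + Im z *\<^sub>R \<i>" by (simp add: complex_eq_iff)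
  then have "g z = g (Re z *\<^sub>R 1 + Im z *\<^sub>R \<i>)" by simp
  then show "g z = inner (Complex (g 1) (g \<i>)) z"
    using assms by (simp add: linear_add linear_scale inner_complex_def)
qed

lemma Re_of_real_mult_divide: "Re (complex_of_real c * w / z) = c * Re (w / z)"
  by (simp flip: times_divide_eq_right)

text \<open>The left-hand side is the distance from \<open>(\<zeta>, \<tau>)\<close> to the end of a
  path from the origin with four factors. The start is moved by repairing the two middle factors,
  which by \<open>l\<close> and \<open>Z\<close> are nearly straight and nearly aligned.
  Similarities make them absorb \<open>- \<zeta>\<close> in the plane, the freedom of sharing it
  between them cancels the vertical defect to first order, and a conjugation as in
  \<open>ccn_conjugated_path\<close> removes the quadratic rest at quadratic cost. The vector
  \<open>v\<close> records the first-order change of length.\<close>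

lemma ccn_semiconcave:
  fixes s :: real
  assumes s: "0 < s" "s \<le> 1"
    and p: "cmod p \<le> 2" and l: "ccn z1 t1 \<le> (101 / 100) * s" "ccn z2 t2 \<le> (101 / 100) * s"
    and Z: "(19 / 10) * s \<le> cmod (z1 + z2)"
  obtains v where "\<And>\<zeta> \<tau> r. \<lbrakk>r \<le> s / 2; cmod \<zeta> \<le> r; \<bar>\<tau>\<bar> \<le> r\<^sup>2\<rbrakk> \<Longrightarrow>
    ccn (p + (z1 + z2) + q - \<zeta>)
      (a + t1 + t2 + b + sform p z1 + sform (p + z1) z2 + sform (p + (z1 + z2)) q - \<tau> - sform \<zeta> (p + (z1 + z2) + q))
    \<le> ccn p a + ccn z1 t1 + ccn z2 t2 + ccn q b - inner v \<zeta> + 2000 / s ^ 3 * r\<^sup>2"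
proof -
  define Z where "Z = z1 + z2"
  have z: "cmod z1 \<le> (101 / 100) * s" "cmod z2 \<le> (101 / 100) * s"
    using l cmod_le_ccn order_trans by blast+
  have zl: "(89 / 100) * s \<le> cmod z1" "(89 / 100) * s \<le> cmod z2"
    using z Z norm_triangle_ineq[of z1 z2] by linarith+
  have z0: "z1 \<noteq> 0" "z2 \<noteq> 0" using zl s by auto
  have ZZ: "(19 / 10) * s \<le> cmod Z" "cmod Z \<le> (202 / 100) * s"
    using Z z norm_triangle_ineq[of z1 z2] by (auto simp: Z_def)
  have t: "\<bar>t\<bar> \<le> (103 / 100) * s\<^sup>2" if "ccn z t \<le> (101 / 100) * s" for z t
  proof -
    have "\<bar>t\<bar> \<le> ((101 / 100) * s)\<^sup>2"
      using abs_le_ccn[of t z] power_mono[OF that, of 2] by simp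
    then show ?thesis unfolding power_mult_distrib using zero_le_power2[of s] by (simp add: power2_eq_square)
  qed
  have t1: "\<bar>t1\<bar> \<le> (103 / 100) * s\<^sup>2" and t2: "\<bar>t2\<bar> \<le> (103 / 100) * s\<^sup>2" using t l by auto
  have quot: "cmod (w / z1) \<le> cmod w / ((89 / 100) * s)" "cmod (w / z2) \<le> cmod w / ((89 / 100) * s)" for w
  proof -
    have "cmod (w / z) \<le> cmod w / ((89 / 100) * s)" if "(89 / 100) * s \<le> cmod z" for z
      unfolding norm_divide using that s by (intro frac_le) auto
    then show "cmod (w / z1) \<le> cmod w / ((89 / 100) * s)" "cmod (w / z2) \<le> cmod w / ((89 / 100) * s)"
      using zl by auto
  qed
  have quotR: "\<bar>Re (w / z1)\<bar> \<le> cmod w / ((89 / 100) * s)" "\<bar>Re (w / z2)\<bar> \<le> cmod w / ((89 / 100) * s)" for w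
    using quot[of w] abs_Re_le_cmod order_trans by blast+
  \<comment> \<open>\<open>M u\<close> is the first-order vertical change caused by transferring
    \<open>u\<close> from the second middle factor to the first. In the direction
    \<open>\<i> * Z\<close> the term \<open>sform u Z\<close> dominates.\<close>
  define M where "M u = 2 * Re (u / z1) * t1 - 2 * Re (u / z2) * t2 + sform u Z" for u
  define m where "m = M (\<i> * Z)"
  have m: "2 * s\<^sup>2 \<le> m"
  proof -
    \<comment> \<open>The summand \<i> has real part 0. This roughly halves the bound for the real
      parts, and only then does \<open>sform (\<i> * Z) Z\<close> outweigh the terms with
      \<open>t1\<close> and \<open>t2\<close>.\<close>
    have e: "\<i> * Z / z1 = \<i> + \<i> * z2 / z1" "\<i> * Z / z2 = \<i> + \<i> * z1 / z2"
      using z0 by (simp_all add: Z_def field_simps)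
    have q: "cmod (\<i> * w) / ((89 / 100) * s) \<le> (115 / 100)" if "cmod w \<le> (101 / 100) * s" for w
    proof -
      have "cmod (\<i> * w) / ((89 / 100) * s) \<le> ((101 / 100) * s) / ((89 / 100) * s)"
        using that s by (intro divide_right_mono) (auto simp: norm_mult)
      also have "\<dots> \<le> (115 / 100)" using s by simp
      finally show ?thesis .
    qed
    have r: "\<bar>Re (\<i> * Z / z1)\<bar> \<le> (115 / 100)" "\<bar>Re (\<i> * Z / z2)\<bar> \<le> (115 / 100)"
      unfolding e using quotR[of "\<i> * z2"] quotR[of "\<i> * z1"] q[OF z(1)] q[OF z(2)] by auto
    have "\<bar>2 * Re (\<i> * Z / z1) * t1\<bar> \<le> 2 * (115 / 100) * ((103 / 100) * s\<^sup>2)" "\<bar>2 * Re (\<i> * Z / z2) * t2\<bar> \<le> 2 * (115 / 100) * ((103 / 100) * s\<^sup>2)"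
      unfolding abs_mult using r t1 t2 by (intro mult_mono; simp)+
    moreover have "sform (\<i> * Z) Z \<ge> (722 / 100) * s\<^sup>2"
      using power_mono[OF ZZ(1), of 2] s by (simp add: sform_rotate power_mult_distrib power2_eq_square)
    ultimately show ?thesis unfolding m_def M_def using zero_le_power2[of s] by linarith
  qed
  have mpos: "m > 0" using m s by (smt (verit) zero_less_power)
  \<comment> \<open>The first-order vertical defect if the second middle factor alone absorbed
    \<open>- \<zeta>\<close>. The contributions of \<open>q\<close> to the path and to its target
    cancel.\<close>
  define L where "L \<zeta> = - 2 * Re (\<zeta> / z2) * t2 + 2 * sform \<zeta> p + sform \<zeta> Z + sform \<zeta> z1" for \<zeta>
  have L: "\<bar>L \<zeta>\<bar> \<le> 17 * cmod \<zeta>" for \<zeta>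
  proof -
    have "\<bar>2 * Re (\<zeta> / z2) * t2\<bar> \<le> 2 * (cmod \<zeta> / ((89 / 100) * s)) * ((103 / 100) * s\<^sup>2)"
      unfolding abs_mult using quotR(2)[of \<zeta>] t2 by (intro mult_mono) auto
    also have "\<dots> = (206 / 89) * s * cmod \<zeta>" using s by (simp add: power2_eq_square field_simps)
    also have "\<dots> \<le> (24 / 10) * cmod \<zeta>" using s by (intro mult_right_mono) auto
    finally have 1: "\<bar>2 * Re (\<zeta> / z2) * t2\<bar> \<le> (24 / 10) * cmod \<zeta>" .
    have B: "\<bar>sform \<zeta> w\<bar> \<le> 2 * (cmod \<zeta> * c)" if "cmod w \<le> c" for w c
      using abs_sform_le[of \<zeta> w] mult_left_mono[OF that, of "cmod \<zeta>"] by simp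
    have "cmod Z \<le> 202 / 100" "cmod z1 \<le> 101 / 100" using ZZ z s by auto
    from B[OF p] B[OF this(1)] B[OF this(2)] have
      "\<bar>sform \<zeta> p\<bar> \<le> 4 * cmod \<zeta>" "\<bar>sform \<zeta> Z\<bar> \<le> (404 / 100) * cmod \<zeta>"
      "\<bar>sform \<zeta> z1\<bar> \<le> (202 / 100) * cmod \<zeta>"
      by auto
    then show ?thesis unfolding L_def using 1 by linarith
  qed
  \<comment> \<open>The multiple of \<open>\<i> * Z\<close> for which \<open>M (u \<zeta>)\<close>
    cancels \<open>L \<zeta>\<close>. It depends linearly on \<zeta>, so the first-order change of
    length does too.\<close>
  define u where "u \<zeta> = complex_of_real (- L \<zeta> / m) * (\<i> * Z)" for \<zeta>
  have Mu: "M (u \<zeta>) = - L \<zeta>" for \<zeta>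
  proof -
    have "M (complex_of_real c * w) = c * M w" for c w
      unfolding M_def sform_simps Re_of_real_mult_divide by (simp add: algebra_simps)
    from this[of "- L \<zeta> / m" "\<i> * Z"] show ?thesis using mpos by (simp add: u_def m_def[symmetric])
  qed
  have ub: "cmod (u \<zeta>) \<le> 18 / s * cmod \<zeta>" for \<zeta>
  proof -
    have "cmod (u \<zeta>) = \<bar>L \<zeta>\<bar> * cmod Z / m" using mpos by (simp add: u_def norm_mult norm_divide)
    also have "\<dots> \<le> (17 * cmod \<zeta>) * ((202 / 100) * s) / (2 * s\<^sup>2)"
      using L[of \<zeta>] ZZ m s by (intro frac_le mult_mono) auto
    also have "\<dots> = (1717 / 100) / s * cmod \<zeta>" using s by (simp add: power2_eq_square field_simps)
    also have "\<dots> \<le> 18 / s * cmod \<zeta>" using s by (intro mult_right_mono divide_right_mono) auto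
    finally show ?thesis .
  qed
  define \<Lambda> where "\<Lambda> \<zeta> = - (ccn z1 t1 * Re (u \<zeta> / z1) + ccn z2 t2 * Re ((- \<zeta> - u \<zeta>) / z2))" for \<zeta>
  have "linear \<Lambda>"
  proof -
    have La: "L (x + y) = L x + L y" for x y
      unfolding L_def by (simp add: sform_simps add_divide_distrib algebra_simps)
    have Ls: "L (c *\<^sub>R x) = c * L x" for x c
      unfolding L_def scaleR_conv_of_real sform_simps Re_of_real_mult_divide by (simp add: algebra_simps)
    have ua: "u (x + y) = u x + u y" "u (c *\<^sub>R x) = complex_of_real c * u x" for x y c
      unfolding u_def La Ls by (simp_all add: add_divide_distrib algebra_simps diff_divide_distrib)
    show ?thesis
    proof (rule linearI)
      show "\<Lambda> (x + y) = \<Lambda> x + \<Lambda> y" for x y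
        unfolding \<Lambda>_def ua by (simp add: add_divide_distrib diff_divide_distrib algebra_simps)
      have "- (c *\<^sub>R x) - u (c *\<^sub>R x) = complex_of_real c * (- x - u x)" for c x
        unfolding ua by (simp add: scaleR_conv_of_real algebra_simps)
      then show "\<Lambda> (c *\<^sub>R x) = c *\<^sub>R \<Lambda> x" for c x
        unfolding \<Lambda>_def by (simp only: ua Re_of_real_mult_divide) (simp add: algebra_simps)
    qed
  qed
  then obtain v where v: "\<And>\<zeta>. \<Lambda> \<zeta> = inner v \<zeta>" using ex_real_linear_inner by blast
  show thesis
  proof (rule that)
    fix \<zeta> \<tau> r assume r: "r \<le> s / 2" "cmod \<zeta> \<le> r" "\<bar>\<tau>\<bar> \<le> r\<^sup>2"
    have r0: "0 \<le> r" using r(2) norm_ge_zero order_trans by blast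
    define w1 w2 where "w1 = u \<zeta>" and "w2 = - \<zeta> - u \<zeta>"
    have w1: "cmod w1 \<le> 18 * r / s"
      using ub[of \<zeta>] mult_left_mono[OF r(2), of "18 / s"] s by (simp add: w1_def)
    have w2: "cmod w2 \<le> 19 * r / s"
    proof -
      have "cmod w2 \<le> cmod \<zeta> + cmod w1" unfolding w1_def w2_def by (metis norm_minus_cancel norm_triangle_ineq4)
      moreover have "r \<le> r / s" using s r0 by (simp add: le_divide_eq mult_left_le)
      ultimately show ?thesis using w1 r(2) by simp
    qed
    define \<mu>1 \<mu>2 where "\<mu>1 = w1 / z1" and "\<mu>2 = w2 / z2"
    have mb: "(cmod \<mu>)\<^sup>2 \<le> 484 * r\<^sup>2 / s ^ 4" if "cmod \<mu> \<le> cmod w / ((89 / 100) * s)" "cmod w \<le> 19 * r / s" for \<mu> w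
    proof -
      have "cmod \<mu> \<le> (19 * r / s) / ((89 / 100) * s)"
        using that s by (meson divide_right_mono mult_nonneg_nonneg less_imp_le order_trans zero_le_numeral divide_nonneg_nonneg)
      also have "\<dots> = (1900 / 89) * (r / s\<^sup>2)" by (simp add: power2_eq_square)
      also have "\<dots> \<le> 22 * (r / s\<^sup>2)" using r0 by (intro mult_right_mono) auto
      finally have "(cmod \<mu>)\<^sup>2 \<le> (22 * (r / s\<^sup>2))\<^sup>2" by (intro power_mono) auto
      then show ?thesis by (simp add: power_mult_distrib power_divide flip: power_mult)
    qed
    have m1: "(cmod \<mu>1)\<^sup>2 \<le> 484 * r\<^sup>2 / s ^ 4"
    proof (rule mb)
      show "cmod \<mu>1 \<le> cmod w1 / ((89 / 100) * s)" unfolding \<mu>1_def by (rule quot)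
      have "18 * r / s \<le> 19 * r / s" using r0 s by (intro divide_right_mono) auto
      then show "cmod w1 \<le> 19 * r / s" using w1 by linarith
    qed
    have m2: "(cmod \<mu>2)\<^sup>2 \<le> 484 * r\<^sup>2 / s ^ 4"
      unfolding \<mu>2_def by (rule mb[OF quot(2) w2])
    define t1' t2' where "t1' = (1 + 2 * Re \<mu>1 + (cmod \<mu>1)\<^sup>2) * t1" and "t2' = (1 + 2 * Re \<mu>2 + (cmod \<mu>2)\<^sup>2) * t2"
    \<comment> \<open>The vertical defect that survives the choice of \<open>u\<close>. All of it
      has order \<open>r\<^sup>2\<close>, including \<tau>, whose size is restricted for this
      purpose.\<close>
    define R where "R = (cmod \<mu>1)\<^sup>2 * t1 + (cmod \<mu>2)\<^sup>2 * t2 + sform \<zeta> w1 + \<tau>"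
    have Rb: "\<bar>R\<bar> \<le> 1100 * r\<^sup>2 / s\<^sup>2"
    proof -
      have A: "\<bar>(cmod \<mu>)\<^sup>2 * t\<bar> \<le> 500 * r\<^sup>2 / s\<^sup>2" if "(cmod \<mu>)\<^sup>2 \<le> 484 * r\<^sup>2 / s ^ 4" "\<bar>t\<bar> \<le> (103 / 100) * s\<^sup>2" for \<mu> t
      proof -
        have "\<bar>(cmod \<mu>)\<^sup>2 * t\<bar> \<le> (484 * r\<^sup>2 / s ^ 4) * ((103 / 100) * s\<^sup>2)"
          unfolding abs_mult using that by (intro mult_mono) auto
        also have "\<dots> = (49852 / 100) * (r\<^sup>2 / s\<^sup>2)" using s by (simp add: field_simps power2_eq_square power4_eq_xxxx)
        also have "\<dots> \<le> 500 * (r\<^sup>2 / s\<^sup>2)" by (intro mult_right_mono) auto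
        finally show ?thesis by simp
      qed
      have "\<bar>sform \<zeta> w1\<bar> \<le> 2 * (r * (18 * r / s))"
        using abs_sform_le[of \<zeta> w1] mult_mono[OF r(2) w1] r0 by simp
      also have "\<dots> = 36 * (r\<^sup>2 / s)" by (simp add: power2_eq_square)
      also have "\<dots> \<le> 36 * (r\<^sup>2 / s\<^sup>2)"
        using s by (intro mult_left_mono divide_left_mono) (auto simp: power2_eq_square mult_left_le)
      finally have B: "\<bar>sform \<zeta> w1\<bar> \<le> 36 * (r\<^sup>2 / s\<^sup>2)" .
      have "r\<^sup>2 \<le> r\<^sup>2 / s\<^sup>2" using s by (simp add: le_divide_eq mult_left_le power_le_one)
      then show ?thesis unfolding R_def
        using A[OF m1 t1] A[OF m2 t2] B r(3) zero_le_power2[of r] by (simp add: abs_le_iff)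
    qed
    define Y where "Y = (z1 + w1) + (z2 + w2)"
    have Y: "Y = Z - \<zeta>" by (simp add: Y_def Z_def w1_def w2_def)
    have Yb: "s \<le> cmod Y" unfolding Y using ZZ norm_triangle_ineq2[of Z \<zeta>] r s by linarith
    have Y0: "cmod Y > 0" using Yb s by linarith
    \<comment> \<open>Perpendicular to \<open>Y\<close>, hence the shortest vector with the
      prescribed value of \<open>sform W Y\<close>. The detour costs
      \<open>\<bar>R\<bar> / (2 * cmod Y)\<close>, where the bound \<open>r \<le> s / 2\<close>
      keeps \<open>Y\<close> at least as long as \<open>s\<close>.\<close>
    define W where "W = complex_of_real (- R / (4 * (cmod Y)\<^sup>2)) * (\<i> * Y)"
    have WY: "2 * sform W Y = - R" unfolding W_def sform_simps sform_rotate using Y0 by simp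
    have Wb: "2 * cmod W \<le> 600 * r\<^sup>2 / s ^ 3"
    proof -
      have "2 * cmod W = \<bar>R\<bar> / (2 * cmod Y)"
        using Y0 by (simp add: W_def norm_mult norm_divide power2_eq_square)
      also have "\<dots> \<le> (1100 * r\<^sup>2 / s\<^sup>2) / (2 * s)"
        using Rb Yb s by (intro frac_le) auto
      also have "\<dots> = 550 * (r\<^sup>2 / s ^ 3)" by (simp add: power2_eq_square power3_eq_cube)
      also have "\<dots> \<le> 600 * (r\<^sup>2 / s ^ 3)" using s by (intro mult_right_mono) auto
      finally show ?thesis by simp
    qed
    have vert: "a + t1' + t2' + b + sform p (z1 + w1) + sform (p + (z1 + w1)) (z2 + w2) + sform (p + Y) q + 2 * sform W Y
      = a + t1 + t2 + b + sform p z1 + sform (p + z1) z2 + sform (p + (z1 + z2)) q - \<tau> - sform \<zeta> (p + (z1 + z2) + q)"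
    proof -
      have Mw: "2 * Re (w1 / z1) * t1 - 2 * Re (w1 / z2) * t2 + sform w1 Z
          = 2 * Re (\<zeta> / z2) * t2 - 2 * sform \<zeta> p - sform \<zeta> Z - sform \<zeta> z1"
        using Mu[of \<zeta>] by (simp add: M_def L_def w1_def)
      have w2: "w2 = - \<zeta> - w1" by (simp add: w1_def w2_def)
      have "t1' = t1 + 2 * Re (w1 / z1) * t1 + (cmod \<mu>1)\<^sup>2 * t1" by (simp add: t1'_def \<mu>1_def algebra_simps)
      moreover have "t2' = t2 - 2 * Re (\<zeta> / z2) * t2 - 2 * Re (w1 / z2) * t2 + (cmod \<mu>2)\<^sup>2 * t2"
        unfolding t2'_def \<mu>2_def w2 by (simp add: diff_divide_distrib algebra_simps)
      ultimately show ?thesis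
        using Mw sform_swap[of p \<zeta>] sform_swap[of z1 \<zeta>] sform_swap[of z1 w1] sform_swap[of \<zeta> w1]
        unfolding WY unfolding R_def Y w2 Z_def sform_simps by linarith
    qed
    have len: "ccn z1 t1 * (1 + Re \<mu>1 + (cmod \<mu>1)\<^sup>2 / 2) + ccn z2 t2 * (1 + Re \<mu>2 + (cmod \<mu>2)\<^sup>2 / 2)
        \<le> ccn z1 t1 + ccn z2 t2 - inner v \<zeta> + 500 * r\<^sup>2 / s ^ 3"
    proof -
      have A: "c * ((cmod \<mu>)\<^sup>2 / 2) \<le> 250 * (r\<^sup>2 / s ^ 3)"
        if "(cmod \<mu>)\<^sup>2 \<le> 484 * r\<^sup>2 / s ^ 4" "0 \<le> c" "c \<le> (101 / 100) * s" for \<mu> c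
      proof -
        have "c * ((cmod \<mu>)\<^sup>2 / 2) \<le> ((101 / 100) * s) * (484 * r\<^sup>2 / s ^ 4 / 2)"
          using that s by (intro mult_mono divide_right_mono) auto
        also have "\<dots> = (24442 / 100) * (r\<^sup>2 / s ^ 3)" using s by (simp add: field_simps power3_eq_cube power4_eq_xxxx)
        also have "\<dots> \<le> 250 * (r\<^sup>2 / s ^ 3)" using s by (intro mult_right_mono) auto
        finally show ?thesis .
      qed
      have "inner v \<zeta> = - (ccn z1 t1 * Re \<mu>1 + ccn z2 t2 * Re \<mu>2)"
        unfolding v[symmetric] by (simp add: \<Lambda>_def \<mu>1_def \<mu>2_def w1_def w2_def)
      then show ?thesis using A[OF m1 _ l(1)] A[OF m2 _ l(2)] by (simp add: algebra_simps)
    qed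
    have "ccn (p + (z1 + z2) + q - \<zeta>)
      (a + t1 + t2 + b + sform p z1 + sform (p + z1) z2 + sform (p + (z1 + z2)) q - \<tau> - sform \<zeta> (p + (z1 + z2) + q))
      = ccn (p + Y + q) (a + t1' + t2' + b + sform p (z1 + w1) + sform (p + (z1 + w1)) (z2 + w2) + sform (p + Y) q + 2 * sform W Y)"
    proof -
      have e: "p + (z1 + z2) + q - \<zeta> = p + Y + q" by (simp add: Y Z_def)
      show ?thesis by (simp only: vert e)
    qed
    also have "\<dots> \<le> ccn p a + 2 * cmod W + ccn (z1 + w1) t1' + ccn (z2 + w2) t2' + ccn q b"
      unfolding Y_def by (rule ccn_conjugated_path)
    also have "\<dots> \<le> ccn p a + 2 * cmod W + ccn z1 t1 * (1 + Re \<mu>1 + (cmod \<mu>1)\<^sup>2 / 2)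
        + ccn z2 t2 * (1 + Re \<mu>2 + (cmod \<mu>2)\<^sup>2 / 2) + ccn q b"
      unfolding t1'_def t2'_def \<mu>1_def \<mu>2_def by (intro add_mono order_refl ccn_dilate_le z0)
    also have "\<dots> \<le> ccn p a + ccn z1 t1 + ccn z2 t2 + ccn q b - inner v \<zeta> + 1100 * (r\<^sup>2 / s ^ 3)"
      using len Wb by simp
    also have "\<dots> \<le> ccn p a + ccn z1 t1 + ccn z2 t2 + ccn q b - inner v \<zeta> + 2000 * (r\<^sup>2 / s ^ 3)"
      using s by (intro add_left_mono mult_right_mono) auto
    finally show "ccn (p + (z1 + z2) + q - \<zeta>)
      (a + t1 + t2 + b + sform p z1 + sform (p + z1) z2 + sform (p + (z1 + z2)) q - \<tau> - sform \<zeta> (p + (z1 + z2) + q))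
      \<le> ccn p a + ccn z1 t1 + ccn z2 t2 + ccn q b - inner v \<zeta> + 2000 / s ^ 3 * r\<^sup>2"
      by simp
  qed
qed


text \<open>Vertical elements are central, so the vertical parts \<open>T i\<close> of all steps can
  be moved to the end and merged. Each is at most \<open>l\<^sup>2\<close>, and their sum costs a
  multiple of \<open>sqrt n * l\<close> instead of \<open>n * l\<close>.\<close>

lemma hdist_le_sum_horizontal:
  fixes Q :: "nat \<Rightarrow> hpoint"
  assumes l: "\<And>i. i < n \<Longrightarrow> hdist (Q i) (Q (Suc i)) \<le> l"
  shows "hdist (Q 0) (Q n) \<le> (\<Sum>i<n. cmod (fst (Q (Suc i)) - fst (Q i))) + 2 * sqrt (real n) * l"
proof -
  define T where "T i = snd (Q (Suc i)) - snd (Q i) - sform (fst (Q i)) (fst (Q (Suc i)))" for i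
  have T: "\<bar>T i\<bar> \<le> l\<^sup>2" if "i < n" for i
    using abs_le_ccn[of "T i" "fst (Q (Suc i)) - fst (Q i)"] power_mono[OF l[OF that], of 2]
    by (simp add: hdist_def T_def)
  \<comment> \<open>The vertical coordinate, relative to \<open>Q 0\<close>, of the product of the
    purely horizontal parts of the first \<open>m\<close> steps.\<close>
  define \<tau> where "\<tau> m = snd (Q m) - snd (Q 0) - sform (fst (Q 0)) (fst (Q m)) - (\<Sum>i<m. T i)" for m
  have "ccn (fst (Q m) - fst (Q 0)) (\<tau> m) \<le> (\<Sum>i<m. cmod (fst (Q (Suc i)) - fst (Q i)))" for m
  proof (induction m)
    case 0
    then show ?case by (simp add: \<tau>_def sform_simps)
  next
    case (Suc m)
    have "\<tau> (Suc m) = \<tau> m + 0 + sform (fst (Q m) - fst (Q 0)) (fst (Q (Suc m)) - fst (Q m))"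
      by (simp add: \<tau>_def T_def sform_simps)
    moreover have "fst (Q (Suc m)) - fst (Q 0) = (fst (Q m) - fst (Q 0)) + (fst (Q (Suc m)) - fst (Q m))"
      by simp
    ultimately have "ccn (fst (Q (Suc m)) - fst (Q 0)) (\<tau> (Suc m))
        \<le> ccn (fst (Q m) - fst (Q 0)) (\<tau> m) + ccn (fst (Q (Suc m)) - fst (Q m)) 0"
      by (metis ccn_mult)
    then show ?case using Suc by simp
  qed
  from this[of n] have 1: "ccn (fst (Q n) - fst (Q 0)) (\<tau> n) \<le> (\<Sum>i<n. cmod (fst (Q (Suc i)) - fst (Q i)))" .
  have "hdist (Q 0) (Q n) \<le> ccn (fst (Q n) - fst (Q 0)) (\<tau> n) + ccn 0 (\<Sum>i<n. T i)"
    using ccn_mult[of "fst (Q n) - fst (Q 0)" 0 "\<tau> n" "\<Sum>i<n. T i"]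
    by (simp add: hdist_def \<tau>_def sform_simps)
  also have "ccn 0 (\<Sum>i<n. T i) \<le> 2 * sqrt \<bar>\<Sum>i<n. T i\<bar>" by (rule ccn_vertical_le)
  also have "\<dots> \<le> 2 * (sqrt (real n) * \<bar>l\<bar>)"
  proof -
    have "\<bar>\<Sum>i<n. T i\<bar> \<le> (\<Sum>i<n. l\<^sup>2)"
      using T by (intro order_trans[OF sum_abs] sum_mono) auto
    then have "sqrt \<bar>\<Sum>i<n. T i\<bar> \<le> sqrt (real n * l\<^sup>2)" by (intro real_sqrt_le_mono) simp
    then show ?thesis by (simp add: real_sqrt_mult)
  qed
  also have "\<dots> = 2 * sqrt (real n) * l"
  \<comment> \<open>For an empty chain \<open>l\<close> may be negative, but then the factor
    \<open>sqrt (real n)\<close> vanishes.\<close>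
  proof (cases "n = 0")
    case False
    then have "0 \<le> l" using l[of 0] hdist_nonneg order_trans by blast
    then show ?thesis by simp
  qed simp
  finally show ?thesis using 1 by simp
qed

definition hbilip :: "real \<Rightarrow> (hpoint \<Rightarrow> hpoint) \<Rightarrow> bool" where
  "hbilip K f \<longleftrightarrow> (\<forall>P Q. inverse K * hdist P Q \<le> hdist (f P) (f Q) \<and> hdist (f P) (f Q) \<le> K * hdist P Q)"

lemma hdist_line:
  "hdist (complex_of_real x * e, 0) (complex_of_real y * e, 0) = \<bar>y - x\<bar> * cmod e"
proof -
  have "hdist (complex_of_real x * e, 0) (complex_of_real y * e, 0) = cmod (complex_of_real (y - x) * e)"
    unfolding hdist_def fst_conv snd_conv sform_simps left_diff_distrib[symmetric] of_real_diff[symmetric] by simp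
  then show ?thesis by (simp only: norm_mult norm_of_real)
qed

text \<open>
  The image of the segment from 0 to \<open>e\<close> need not be nearly straight near its starting point, but by
  \<open>hdist_le_sum_horizontal\<close> some short piece of it is, and bending that piece alone already gives
  the one-sided linear bound at the starting point.
\<close>

lemma hdist_image_semiconcave:
  assumes f: "hbilip (1 + \<epsilon>) f" and \<epsilon>: "0 < \<epsilon>" "\<epsilon> \<le> 1 / 100" and f0: "f (0, 0) = (0, 0)"
    and e: "cmod e = 1"
  obtains v where "\<And>\<zeta> \<tau> r. \<lbrakk>r \<le> 1 / 40000; cmod \<zeta> \<le> r; \<bar>\<tau>\<bar> \<le> r\<^sup>2\<rbrakk> \<Longrightarrow>
    hdist (\<zeta>, \<tau>) (f (e, 0)) \<le> 1 + \<epsilon> - inner v \<zeta> + 2000 * 20000 ^ 3 * r\<^sup>2"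
proof -
  \<comment> \<open>The 20000 steps are taken in 10000 pairs, whose vertical parts cost at most
    \<open>2 * 100 * ((1 + \<epsilon>) * (2 * s))\<close>, about 0.02. If every pair had projection
    at most \<open>(19 / 10) * s\<close>, the projections would sum to at most 0.95, too little for
    the distance 100/101 between the ends.\<close>
  define s :: real where "s = 1 / 20000"
  define Q where "Q j = f (complex_of_real (real j * s) * e, 0)" for j
  have s: "0 < s" "s \<le> 1" by (simp_all add: s_def)
  have Qu: "hdist (Q i) (Q j) \<le> (1 + \<epsilon>) * ((real j - real i) * s)" if "i \<le> j" for i j
  proof -
    have "hdist (Q i) (Q j) \<le> (1 + \<epsilon>) * \<bar>real j * s - real i * s\<bar>"
      using f unfolding hbilip_def Q_def by (metis e hdist_line mult.right_neutral)
    also have "real j * s - real i * s = (real j - real i) * s" by (simp add: left_diff_distrib)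
    also have "\<bar>(real j - real i) * s\<bar> = (real j - real i) * s" using that s by simp
    finally show ?thesis .
  qed
  have Q0: "Q 0 = (0, 0)" and Q1: "Q 20000 = f (e, 0)" by (simp_all add: Q_def f0 s_def)
  have "\<exists>i<10000. (19 / 10) * s \<le> cmod (fst (Q (2 * i + 2)) - fst (Q (2 * i)))"
  proof (rule ccontr)
    assume "\<not> ?thesis"
    then have neg: "cmod (fst (Q (2 * i + 2)) - fst (Q (2 * i))) \<le> (19 / 10) * s" if "i < 10000" for i
      using that by force
    have "hdist (Q (2 * 0)) (Q (2 * 10000)) \<le>
        (\<Sum>i<10000. cmod (fst (Q (2 * Suc i)) - fst (Q (2 * i)))) + 2 * sqrt (real 10000) * ((1 + \<epsilon>) * (2 * s))"
    proof (rule hdist_le_sum_horizontal)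
      fix i :: nat
      show "hdist (Q (2 * i)) (Q (2 * Suc i)) \<le> (1 + \<epsilon>) * (2 * s)"
        using Qu[of "2 * i" "2 * Suc i"] by simp
    qed
    also have "(\<Sum>i<10000. cmod (fst (Q (2 * Suc i)) - fst (Q (2 * i)))) \<le> (\<Sum>i<10000::nat. (19 / 10) * s)"
      using neg by (intro sum_mono) simp
    also have "(\<Sum>i<10000::nat. (19 / 10) * s) = 95 / 100" by (simp add: s_def)
    also have "sqrt (real 10000) = 100"
      by (rule real_sqrt_unique) auto
    finally have up: "hdist (Q 0) (Q 20000) \<le> 95 / 100 + 2 * 100 * ((1 + \<epsilon>) * (2 * s))" by simp
    have "inverse (1 + \<epsilon>) * hdist (0, 0) (e, 0) \<le> hdist (f (0, 0)) (f (e, 0))"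
      using f unfolding hbilip_def by blast
    moreover have "100 / 101 \<le> inverse (1 + \<epsilon>)"
      using \<epsilon> le_imp_inverse_le[of "1 + \<epsilon>" "101 / 100"] by simp
    ultimately have "100 / 101 \<le> hdist (Q 0) (Q 20000)"
      by (simp add: Q0 Q1 f0 e)
    moreover have "95 / 100 + 2 * 100 * ((1 + \<epsilon>) * (2 * s)) < 100 / 101"
      using \<epsilon> by (simp add: s_def field_simps)
    ultimately show False using up by linarith
  qed
  then obtain i where i: "i < 10000" "(19 / 10) * s \<le> cmod (fst (Q (2 * i + 2)) - fst (Q (2 * i)))" by blast
  define A B C D where "A = Q (2 * i)" and "B = Q (2 * i + 1)" and "C = Q (2 * i + 2)" and "D = Q 20000"
  define z1 z2 q where "z1 = fst B - fst A" and "z2 = fst C - fst B" and "q = fst D - fst C"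
  define t1 t2 b where "t1 = snd B - snd A - sform (fst A) (fst B)" and "t2 = snd C - snd B - sform (fst B) (fst C)"
    and "b = snd D - snd C - sform (fst C) (fst D)"
  have l1: "ccn z1 t1 \<le> (1 + \<epsilon>) * s"
    using Qu[of "2 * i" "2 * i + 1"] by (simp add: hdist_def A_def B_def z1_def t1_def)
  have l2: "ccn z2 t2 \<le> (1 + \<epsilon>) * s"
    using Qu[of "2 * i + 1" "2 * i + 2"] by (simp add: hdist_def B_def C_def z2_def t2_def)
  have lA: "ccn (fst A) (snd A) \<le> (1 + \<epsilon>) * (real (2 * i) * s)"
    using Qu[of 0 "2 * i"] by (simp add: Q0 A_def)
  have lD: "ccn q b \<le> (1 + \<epsilon>) * (1 - real (2 * i + 2) * s)"
  proof -
    have "real 20000 * s = 1" by (simp add: s_def)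
    then have "(real 20000 - real (2 * i + 2)) * s = 1 - real (2 * i + 2) * s" by (simp only: left_diff_distrib)
    then show ?thesis
      using Qu[of "2 * i + 2" 20000] i(1) unfolding hdist_def C_def D_def q_def b_def by simp
  qed
  \<comment> \<open>The upper Lipschitz bounds for the four stretches add up along the segment,
    however crooked the outer two are.\<close>
  have total: "ccn (fst A) (snd A) + ccn z1 t1 + ccn z2 t2 + ccn q b \<le> 1 + \<epsilon>"
    using l1 l2 lA lD by (simp add: algebra_simps)
  have p: "cmod (fst A) \<le> 2"
    using total cmod_le_ccn[of "fst A" "snd A"] \<epsilon> ccn_nonneg[of z1 t1] ccn_nonneg[of z2 t2] ccn_nonneg[of q b]
    by linarith
  have l: "ccn z1 t1 \<le> (101 / 100) * s" "ccn z2 t2 \<le> (101 / 100) * s"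
  proof -
    have "(1 + \<epsilon>) * s \<le> (101 / 100) * s" using \<epsilon> s by (intro mult_right_mono) auto
    then show "ccn z1 t1 \<le> (101 / 100) * s" "ccn z2 t2 \<le> (101 / 100) * s" using l1 l2 by linarith+
  qed
  have Z: "(19 / 10) * s \<le> cmod (z1 + z2)" using i(2) by (simp add: z1_def z2_def A_def C_def)
  obtain v where v: "\<And>\<zeta> \<tau> r. \<lbrakk>r \<le> s / 2; cmod \<zeta> \<le> r; \<bar>\<tau>\<bar> \<le> r\<^sup>2\<rbrakk> \<Longrightarrow>
    ccn (fst A + (z1 + z2) + q - \<zeta>)
      (snd A + t1 + t2 + b + sform (fst A) z1 + sform (fst A + z1) z2 + sform (fst A + (z1 + z2)) q - \<tau>
        - sform \<zeta> (fst A + (z1 + z2) + q))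
    \<le> ccn (fst A) (snd A) + ccn z1 t1 + ccn z2 t2 + ccn q b - inner v \<zeta> + 2000 / s ^ 3 * r\<^sup>2"
    using ccn_semiconcave[OF s p l Z, where q=q and a="snd A" and b=b] by blast
  show thesis
  proof (rule that)
    fix \<zeta> \<tau> r assume r: "r \<le> 1 / 40000" "cmod \<zeta> \<le> r" "\<bar>\<tau>\<bar> \<le> r\<^sup>2"
    have eqz: "fst A + (z1 + z2) + q = fst D" by (simp add: z1_def z2_def q_def)
    have eqt: "snd A + t1 + t2 + b + sform (fst A) z1 + sform (fst A + z1) z2 + sform (fst A + (z1 + z2)) q = snd D"
      by (simp add: t1_def t2_def b_def z1_def z2_def q_def sform_simps)
    have "hdist (\<zeta>, \<tau>) (f (e, 0)) = ccn (fst D - \<zeta>) (snd D - \<tau> - sform \<zeta> (fst D))"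
      by (simp add: hdist_def D_def Q1)
    also have "\<dots> \<le> ccn (fst A) (snd A) + ccn z1 t1 + ccn z2 t2 + ccn q b - inner v \<zeta> + 2000 / s ^ 3 * r\<^sup>2"
      using v[OF _ r(2,3)] r(1) unfolding eqz eqt by (simp add: s_def)
    also have "\<dots> \<le> 1 + \<epsilon> - inner v \<zeta> + 2000 / s ^ 3 * r\<^sup>2" using total by simp
    also have "2000 / s ^ 3 = 2000 * 20000 ^ 3" by (simp add: s_def power_one_over)
    finally show "hdist (\<zeta>, \<tau>) (f (e, 0)) \<le> 1 + \<epsilon> - inner v \<zeta> + 2000 * 20000 ^ 3 * r\<^sup>2" .
  qed
qed

subsection \<open>Almost isometries near a point\<close>

lemma hbilip_origin:
  assumes "hbilip K f" "f (0, 0) = (0, 0)"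
  shows "hdist (0, 0) (f Q) \<le> K * hdist (0, 0) Q"
  using assms unfolding hbilip_def by metis

lemma inverse_one_plus_ge: "1 - \<epsilon> \<le> inverse (1 + \<epsilon>)" if "0 < \<epsilon>" for \<epsilon> :: real
proof -
  have "(1 - \<epsilon>) * (1 + \<epsilon>) \<le> 1" by (simp add: algebra_simps)
  then show ?thesis using that by (simp add: inverse_eq_divide le_divide_eq)
qed

text \<open>For \<open>Q\<close> with projection \<xi>, the distance from \<open>Q\<close> to
  \<open>(e, 0)\<close> is at least \<open>1 - inner e \<xi>\<close>; this bounds
  \<open>inner v\<close> from above with error \<open>3 + K\<close>. The same at \<open>- e\<close>
  bounds \<open>inner v'\<close> from above, and as \<open>v + v'\<close> nearly vanishes, with
  error \<open>4 + 2 * K\<close>, that is a lower bound for \<open>inner v\<close>. The constant is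
  the sum of the two errors.\<close>

lemma hbilip_projection_linear:
  fixes r :: real
  defines "K \<equiv> 2000 * 20000 ^ 3 :: real"
  assumes f: "hbilip (1 + r\<^sup>2) f" and f0: "f (0, 0) = (0, 0)" and r: "0 < r" "r \<le> 1 / 40000"
    and e: "cmod e = 1"
  obtains v where "cmod v \<le> 1 + (7 + 3 * K) * r"
    "\<And>Q. hdist (0, 0) Q \<le> r / 2 \<Longrightarrow> \<bar>inner v (fst (f Q)) - inner e (fst Q)\<bar> \<le> (7 + 3 * K) * r\<^sup>2"
proof -
  define \<epsilon> where "\<epsilon> = r\<^sup>2"
  have K: "0 < K" by (simp add: K_def)
  have rsq: "r\<^sup>2 \<le> (1 / 40000)\<^sup>2" using r by (intro power_mono) auto
  have \<epsilon>: "0 < \<epsilon>" "\<epsilon> \<le> 1 / 100" using r rsq by (simp_all add: \<epsilon>_def power_one_over)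
  note f = f[folded \<epsilon>_def]
  obtain v where v: "\<And>\<zeta> \<tau>. \<lbrakk>cmod \<zeta> \<le> r; \<bar>\<tau>\<bar> \<le> r\<^sup>2\<rbrakk> \<Longrightarrow>
      hdist (\<zeta>, \<tau>) (f (e, 0)) \<le> 1 + \<epsilon> - inner v \<zeta> + K * r\<^sup>2"
    using hdist_image_semiconcave[OF f \<epsilon> f0 e, folded K_def] r by metis
  have e': "cmod (- e) = 1" using e by simp
  obtain v' where v': "\<And>\<zeta> \<tau>. \<lbrakk>cmod \<zeta> \<le> r; \<bar>\<tau>\<bar> \<le> r\<^sup>2\<rbrakk> \<Longrightarrow>
      hdist (\<zeta>, \<tau>) (f (- e, 0)) \<le> 1 + \<epsilon> - inner v' \<zeta> + K * r\<^sup>2"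
    using hdist_image_semiconcave[OF f \<epsilon> f0 e', folded K_def] r by metis
  have low: "(1 - \<epsilon>) * hdist P Q \<le> hdist (f P) (f Q)" for P Q
    using f mult_right_mono[OF inverse_one_plus_ge[OF \<epsilon>(1)] hdist_nonneg[of P Q]]
    unfolding hbilip_def by (meson order_trans)
  have opp: "2 - 2 * \<epsilon> \<le> hdist (f (e, 0)) (f (- e, 0))"
  proof -
    have "hdist (e, 0) (- e, 0) = 2" using hdist_line[of 1 e "- 1"] e by simp
    then show ?thesis using low[of "(e, 0)" "(- e, 0)"] by simp
  qed
  have sum: "inner (v + v') \<zeta> \<le> (4 + 2 * K) * r\<^sup>2" if "cmod \<zeta> \<le> r" for \<zeta>
  proof -
    have "hdist (f (e, 0)) (f (- e, 0)) \<le> hdist (\<zeta>, 0) (f (e, 0)) + hdist (\<zeta>, 0) (f (- e, 0))"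
      using hdist_triangle[of "f (e, 0)" "f (- e, 0)" "(\<zeta>, 0)"] by (simp add: hdist_commute)
    then show ?thesis
      using opp v[OF that, of 0] v'[OF that, of 0] by (simp add: inner_add_left \<epsilon>_def algebra_simps)
  qed
  show thesis
  proof (rule that)
    show "cmod v \<le> 1 + (7 + 3 * K) * r"
    proof (cases "v = 0")
      case False
      \<comment> \<open>Moving a distance \<open>r\<close> along \<open>v\<close> can bring the
        point closer to \<open>f (e, 0)\<close> by at most \<open>r\<close>, whereas the linear
        bound promises a gain of about \<open>r * cmod v\<close>.\<close>
      define \<zeta> where "\<zeta> = (r / cmod v) *\<^sub>R v"
      have n: "cmod \<zeta> = r" using False r by (simp add: \<zeta>_def)
      have i: "inner v \<zeta> = r * cmod v"
        using False by (simp add: \<zeta>_def power2_norm_eq_inner[symmetric] power2_eq_square)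
      have "1 - \<epsilon> \<le> hdist (0, 0) (f (e, 0))" using low[of "(0, 0)" "(e, 0)"] e by (simp add: f0)
      also have "\<dots> \<le> r + hdist (\<zeta>, 0) (f (e, 0))"
        using hdist_triangle[of "(0, 0)" "f (e, 0)" "(\<zeta>, 0)"] n by simp
      also have "\<dots> \<le> r + (1 + \<epsilon> - r * cmod v + K * r\<^sup>2)"
        using v[of \<zeta> 0] n i by simp
      finally have "r * cmod v \<le> r * (1 + (2 + K) * r)"
        by (simp add: \<epsilon>_def power2_eq_square algebra_simps)
      then have "cmod v \<le> 1 + (2 + K) * r" using r by simp
      also have "\<dots> \<le> 1 + (7 + 3 * K) * r" using r K by (intro add_left_mono mult_right_mono) auto
      finally show ?thesis .
    qed (use r K in simp)
  next
    fix Q assume Q: "hdist (0, 0) Q \<le> r / 2"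
    define \<zeta> \<tau> \<xi> where "\<zeta> = fst (f Q)" and "\<tau> = snd (f Q)" and "\<xi> = fst Q"
    have fQ: "f Q = (\<zeta>, \<tau>)" by (simp add: \<zeta>_def \<tau>_def)
    \<comment> \<open>Starting in half the radius leaves room for the expansion, so the image stays
      in the ball where both linear bounds are valid.\<close>
    have c: "ccn \<zeta> \<tau> \<le> r"
    proof -
      have "ccn \<zeta> \<tau> \<le> (1 + \<epsilon>) * hdist (0, 0) Q" using hbilip_origin[OF f f0, of Q] by (simp add: fQ)
      also have "\<dots> \<le> 2 * (r / 2)" using Q \<epsilon> by (intro mult_mono) auto
      finally show ?thesis by simp
    qed
    have z: "cmod \<zeta> \<le> r" "\<bar>\<tau>\<bar> \<le> r\<^sup>2"
      using c cmod_le_ccn[of \<zeta> \<tau>] abs_le_ccn[of \<tau> \<zeta>] power_mono[OF c, of 2] by auto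
    have x: "cmod \<xi> \<le> 1" using cmod_le_ccn[of \<xi> "snd Q"] Q r by (simp add: \<xi>_def)
    have one: "inner w \<zeta> \<le> inner e1 \<xi> + (3 + K) * r\<^sup>2"
      if e1: "cmod e1 = 1" and w: "hdist (\<zeta>, \<tau>) (f (e1, 0)) \<le> 1 + \<epsilon> - inner w \<zeta> + K * r\<^sup>2" for e1 w
    proof -
      have b: "\<bar>inner e1 \<xi>\<bar> \<le> 1" using Cauchy_Schwarz_ineq2[of e1 \<xi>] e1 x by simp
      have "1 - inner e1 \<xi> = inner e1 (e1 - \<xi>)"
        using e1 by (simp add: inner_diff_right power2_norm_eq_inner[symmetric])
      also have "\<dots> \<le> cmod (e1 - \<xi>)" using norm_cauchy_schwarz[of e1 "e1 - \<xi>"] e1 by simp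
      also have "\<dots> \<le> hdist Q (e1, 0)" using cmod_diff_le_hdist[of "(e1, 0)" Q] by (simp add: \<xi>_def)
      finally have "(1 - \<epsilon>) * (1 - inner e1 \<xi>) \<le> (1 - \<epsilon>) * hdist Q (e1, 0)"
        using \<epsilon> by (intro mult_left_mono) auto
      also have "\<dots> \<le> 1 + \<epsilon> - inner w \<zeta> + K * r\<^sup>2" using low[of Q "(e1, 0)"] w by (simp add: fQ)
      finally have "inner w \<zeta> \<le> inner e1 \<xi> + \<epsilon> + \<epsilon> * (1 - inner e1 \<xi>) + K * r\<^sup>2"
        by (simp add: algebra_simps)
      also have "\<epsilon> * (1 - inner e1 \<xi>) \<le> \<epsilon> * 2" using b \<epsilon> by (intro mult_left_mono) auto
      finally show ?thesis by (simp add: \<epsilon>_def algebra_simps)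
    qed
    have u: "inner v \<zeta> \<le> inner e \<xi> + (3 + K) * r\<^sup>2" by (rule one[OF e v[OF z]])
    have u': "inner v' \<zeta> \<le> - inner e \<xi> + (3 + K) * r\<^sup>2" using one[OF e' v'[OF z]] by simp
    have "- inner (v + v') \<zeta> \<le> (4 + 2 * K) * r\<^sup>2" using sum[of "- \<zeta>"] z by simp
    then have "inner e \<xi> - (7 + 3 * K) * r\<^sup>2 \<le> inner v \<zeta>"
      using u' by (simp add: inner_add_left algebra_simps)
    moreover have "(3 + K) * r\<^sup>2 \<le> (7 + 3 * K) * r\<^sup>2" using K by (intro mult_right_mono) auto
    ultimately show "\<bar>inner v (fst (f Q)) - inner e (fst Q)\<bar> \<le> (7 + 3 * K) * r\<^sup>2"
      using u by (simp add: \<zeta>_def[symmetric] \<xi>_def[symmetric] abs_le_iff)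
  qed
qed

text \<open>The vectors found for the directions 1 and \<i> are nearly orthonormal, so the
  projection of \<open>f\<close> is nearly a rotation or a reflection. Their lengths are known up to
  order \<open>q\<^sup>2\<close>, but their orthogonality only up to order \<open>q\<close>: almost
  unit vectors whose inner product misses 1 by order \<open>q\<^sup>2\<close> may be at a distance
  of order \<open>q\<close>.\<close>

lemma hbilip_projection_almost_orthogonal:
  fixes r q C :: real
  defines "C \<equiv> 7 + 3 * (2000 * 20000 ^ 3)"
  assumes f: "hbilip (1 + r\<^sup>2) f" and f0: "f (0, 0) = (0, 0)" and r: "0 < r" "r \<le> 1 / 40000"
    and q: "C * r = q\<^sup>2" "0 < q" "q \<le> 1 / 4"
  obtains u where "cmod u = 1"
    "(\<forall>Q. hdist (0, 0) Q \<le> r / 2 \<longrightarrow> cmod (cnj u * fst (f Q) - fst Q) \<le> 400 * q * r) \<or>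
     (\<forall>Q. hdist (0, 0) Q \<le> r / 2 \<longrightarrow> cmod (cnj u * fst (f Q) - cnj (fst Q)) \<le> 400 * q * r)"
proof -
  have C: "C \<ge> 7" by (simp add: C_def)
  have rq: "r \<le> q\<^sup>2" unfolding q(1)[symmetric] using C r by simp
  have Crr: "C * r\<^sup>2 = q\<^sup>2 * r" using q(1) by (simp add: power2_eq_square mult.assoc[symmetric])
  have qq: "q\<^sup>2 \<le> q / 4" "q\<^sup>2 \<le> 1 / 16"
    using q(2,3) mult_left_mono[of q "1/4" q] power_mono[of q "1/4" 2] by (auto simp: power2_eq_square)
  have one: "cmod (1 :: complex) = 1" "cmod \<i> = 1" by auto
  obtain v1 where v1: "cmod v1 \<le> 1 + q\<^sup>2"
    "\<And>Q. hdist (0, 0) Q \<le> r / 2 \<Longrightarrow> \<bar>inner v1 (fst (f Q)) - inner 1 (fst Q)\<bar> \<le> q\<^sup>2 * r"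
    using hbilip_projection_linear[OF f f0 r one(1), folded C_def] unfolding Crr q(1) by blast
  obtain v2 where v2: "cmod v2 \<le> 1 + q\<^sup>2"
    "\<And>Q. hdist (0, 0) Q \<le> r / 2 \<Longrightarrow> \<bar>inner v2 (fst (f Q)) - inner \<i> (fst Q)\<bar> \<le> q\<^sup>2 * r"
    using hbilip_projection_linear[OF f f0 r one(2), folded C_def] unfolding Crr q(1) by blast
  have r2: "1 + r\<^sup>2 \<le> 1 + q\<^sup>2"
  proof -
    have "r\<^sup>2 \<le> r * 1" unfolding power2_eq_square using r by (intro mult_left_mono) auto
    then show ?thesis using rq by simp
  qed
  have img: "cmod (fst (f (complex_of_real (r / 2) * e, 0))) \<le> (1 + q\<^sup>2) * (r / 2) \<and>
      hdist (0, 0) (complex_of_real (r / 2) * e, 0) \<le> r / 2" if "cmod e = 1" for e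
  proof -
    have d: "hdist (0, 0) (complex_of_real (r / 2) * e, 0) = r / 2" using that r by (simp add: norm_mult)
    have "cmod (fst (f (complex_of_real (r / 2) * e, 0))) \<le> (1 + r\<^sup>2) * (r / 2)"
      using hbilip_origin[OF f f0, of "(complex_of_real (r / 2) * e, 0)"] cmod_le_ccn order_trans d
      by (metis hdist_origin)
    also have "\<dots> \<le> (1 + q\<^sup>2) * (r / 2)" using r2 r by (intro mult_right_mono) auto
    finally show ?thesis using d by simp
  qed
  \<comment> \<open>The image of the point \<open>(r / 2) e\<close> has a projection of length at
    most \<open>(1 + q\<^sup>2) * (r / 2)\<close>, yet its inner product with \<open>v\<close> is
    almost \<open>r / 2\<close>; so \<open>v\<close> cannot be short.\<close>
  have lower: "1 - 3 * q\<^sup>2 \<le> cmod v"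
    if "cmod e = 1" and v: "\<And>Q. hdist (0, 0) Q \<le> r / 2 \<Longrightarrow> \<bar>inner v (fst (f Q)) - inner e (fst Q)\<bar> \<le> q\<^sup>2 * r"
      and vb: "cmod v \<le> 1 + q\<^sup>2" for e v
  proof -
    define \<zeta> where "\<zeta> = fst (f (complex_of_real (r / 2) * e, 0))"
    have z: "cmod \<zeta> \<le> (1 + q\<^sup>2) * (r / 2)" and d: "hdist (0, 0) (complex_of_real (r / 2) * e, 0) \<le> r / 2"
      using img[OF that(1)] by (auto simp: \<zeta>_def)
    have "inner e (complex_of_real (r / 2) * e) = r / 2"
      unfolding scaleR_conv_of_real[symmetric] inner_scaleR_right power2_norm_eq_inner[symmetric]
      using that(1) by simp
    then have "r / 2 - q\<^sup>2 * r \<le> inner v \<zeta>" using v[OF d] by (simp add: \<zeta>_def abs_le_iff)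
    also have "\<dots> \<le> cmod v * cmod \<zeta>" by (rule norm_cauchy_schwarz)
    also have "\<dots> \<le> cmod v * ((1 + q\<^sup>2) * (r / 2))" using z by (intro mult_left_mono) auto
    finally have "r * (1 - 2 * q\<^sup>2) \<le> r * (cmod v * (1 + q\<^sup>2))" by (simp add: algebra_simps)
    then have "1 - 2 * q\<^sup>2 \<le> cmod v * (1 + q\<^sup>2)" using r by (simp only: mult_le_cancel_left_pos)
    then have *: "1 - 2 * q\<^sup>2 \<le> cmod v + cmod v * q\<^sup>2" by (simp add: algebra_simps)
    show ?thesis
    proof (rule ccontr)
      assume "\<not> ?thesis"
      then have c: "cmod v < 1 - 3 * q\<^sup>2" by simp
      then have "cmod v \<le> 1" using zero_le_power2[of q] by linarith
      then have "cmod v * q\<^sup>2 \<le> 1 * q\<^sup>2" by (intro mult_right_mono) auto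
      then show False using * c by simp
    qed
  qed
  have l1: "1 - 3 * q\<^sup>2 \<le> cmod v1" by (rule lower[OF one(1) v1(2,1)])
  have l2: "1 - 3 * q\<^sup>2 \<le> cmod v2" by (rule lower[OF one(2) v2(2,1)])
  have v1pos: "1 / 2 \<le> cmod v1" using l1 qq by linarith
  then have v1n: "v1 \<noteq> 0" by auto
  have v12: "\<bar>inner v2 v1\<bar> \<le> 9 * q"
  proof -
    define \<zeta> where "\<zeta> = fst (f (complex_of_real (r / 2) * 1, 0))"
    \<comment> \<open>The rescaled image of the point in direction 1 is nearly a unit vector, nearly
      equal to \<open>v1\<close> and nearly orthogonal to \<open>v2\<close>, so it transfers
      orthogonality to \<open>v1\<close>.\<close>
    define a where "a = (2 / r) *\<^sub>R \<zeta>"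
    have z: "cmod \<zeta> \<le> (1 + q\<^sup>2) * (r / 2)" and d: "hdist (0, 0) (complex_of_real (r / 2) * 1, 0) \<le> r / 2"
      using img[OF one(1)] by (auto simp: \<zeta>_def)
    have "cmod a = 2 / r * cmod \<zeta>" using r by (simp add: a_def)
    also have "\<dots> \<le> 2 / r * ((1 + q\<^sup>2) * (r / 2))" using z r by (intro mult_left_mono) auto
    finally have a: "cmod a \<le> 1 + q\<^sup>2" using r by simp
    have "r / 2 - q\<^sup>2 * r \<le> inner v1 \<zeta>" using v1(2)[OF d] by (simp add: \<zeta>_def abs_le_iff inner_complex_def)
    then have "2 / r * (r / 2 - q\<^sup>2 * r) \<le> 2 / r * inner v1 \<zeta>"
      using r by (intro mult_left_mono) auto
    then have "2 / r * (r / 2 - q\<^sup>2 * r) \<le> inner v1 a" by (simp only: a_def inner_scaleR_right)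
    then have a1: "1 - 2 * q\<^sup>2 \<le> inner v1 a" using r by (simp add: algebra_simps)
    have "\<bar>inner v2 \<zeta>\<bar> \<le> q\<^sup>2 * r" using v2(2)[OF d] by (simp add: \<zeta>_def inner_complex_def)
    then have "2 / r * \<bar>inner v2 \<zeta>\<bar> \<le> 2 / r * (q\<^sup>2 * r)" using r by (intro mult_left_mono) auto
    then have a2: "\<bar>inner v2 a\<bar> \<le> 2 * q\<^sup>2" using r by (simp add: a_def abs_mult)
    have sq: "(1 + q\<^sup>2)\<^sup>2 \<le> 1 + 3 * q\<^sup>2"
    proof -
      have "q\<^sup>2 * q\<^sup>2 \<le> q\<^sup>2 * 1" using qq by (intro mult_left_mono) auto
      then show ?thesis by (simp add: power2_eq_square algebra_simps)
    qed
    have "(cmod (v1 - a))\<^sup>2 = (cmod v1)\<^sup>2 + (cmod a)\<^sup>2 - 2 * inner v1 a"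
      by (simp add: power2_norm_eq_inner inner_diff_left inner_diff_right inner_commute)
    also have "\<dots> \<le> (1 + 3 * q\<^sup>2) + (1 + 3 * q\<^sup>2) - 2 * (1 - 2 * q\<^sup>2)"
      by (intro diff_mono add_mono mult_left_mono a1 order_trans[OF power_mono sq] v1(1) a) auto
    also have "\<dots> \<le> (4 * q)\<^sup>2" by (simp add: power_mult_distrib)
    finally have "(cmod (v1 - a))\<^sup>2 \<le> (4 * q)\<^sup>2" .
    then have d1: "cmod (v1 - a) \<le> 4 * q" by (rule power2_le_imp_le) (use q in simp)
    have "\<bar>inner v2 v1\<bar> = \<bar>inner v2 a + inner v2 (v1 - a)\<bar>" by (simp add: inner_diff_right)
    also have "\<dots> \<le> 2 * q\<^sup>2 + cmod v2 * cmod (v1 - a)"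
      using a2 Cauchy_Schwarz_ineq2[of v2 "v1 - a"] by linarith
    also have "\<dots> \<le> 2 * q\<^sup>2 + (1 + q\<^sup>2) * (4 * q)"
      using v2(1) d1 by (intro add_left_mono mult_mono) auto
    also have "\<dots> \<le> 9 * q"
    proof -
      have "q\<^sup>2 * q \<le> (1 / 16) * q" using qq q by (intro mult_right_mono) auto
      moreover have "(1 + q\<^sup>2) * (4 * q) = 4 * q + 4 * (q\<^sup>2 * q)" by (simp add: algebra_simps)
      ultimately show ?thesis using qq q by linarith
    qed
    finally show ?thesis .
  qed
  define u where "u = v1 /\<^sub>R cmod v1"
  have u: "cmod u = 1" using v1n by (simp add: u_def)
  have v1u: "cmod (u - v1) \<le> 3 * q\<^sup>2"
  proof -
    have "v1 = cmod v1 *\<^sub>R u" using v1n by (simp add: u_def)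
    then have "u - v1 = (1 - cmod v1) *\<^sub>R u" by (metis scaleR_left_diff_distrib scaleR_one)
    then show ?thesis using l1 v1(1) u by simp
  qed
  define \<alpha> \<beta> where "\<alpha> = inner v2 u" and "\<beta> = inner v2 (\<i> * u)"
  have \<alpha>: "\<bar>\<alpha>\<bar> \<le> 18 * q"
  proof -
    have "\<bar>\<alpha>\<bar> = \<bar>inner v2 v1\<bar> / cmod v1" by (simp add: \<alpha>_def u_def abs_mult divide_inverse mult.commute)
    also have "\<dots> \<le> 9 * q / (1 / 2)" using v12 v1pos q by (intro frac_le) auto
    finally show ?thesis by simp
  qed
  have uu: "(Re u)\<^sup>2 + (Im u)\<^sup>2 = 1" using u by (simp add: cmod_def)
  have \<alpha>\<beta>: "\<alpha>\<^sup>2 + \<beta>\<^sup>2 = (cmod v2)\<^sup>2"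
  proof -
    have "\<alpha>\<^sup>2 + \<beta>\<^sup>2 = ((Re v2)\<^sup>2 + (Im v2)\<^sup>2) * ((Re u)\<^sup>2 + (Im u)\<^sup>2)"
      unfolding \<alpha>_def \<beta>_def inner_complex_def by simp algebra
    then show ?thesis by (simp add: uu cmod_power2)
  qed
  \<comment> \<open>Since \<alpha> and \<beta> are the coordinates of \<open>v2\<close> in the
    orthonormal basis \<open>u\<close>, \<open>\<i> * u\<close>, the near unit length of
    \<open>v2\<close> and the smallness of \<alpha> determine \<beta> up to sign. The inserted
    factor \<open>\<bar>\<beta>\<bar> + 1\<close> reduces this to squares.\<close>
  have \<beta>: "\<bar>\<bar>\<beta>\<bar> - 1\<bar> \<le> 90 * q"
  proof -
    have "\<bar>\<bar>\<beta>\<bar> - 1\<bar> * 1 \<le> \<bar>\<bar>\<beta>\<bar> - 1\<bar> * (\<bar>\<beta>\<bar> + 1)" by (intro mult_left_mono) auto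
    also have "\<dots> = \<bar>\<beta>\<^sup>2 - 1\<bar>"
    proof -
      have "\<beta>\<^sup>2 - 1 = (\<bar>\<beta>\<bar> - 1) * (\<bar>\<beta>\<bar> + 1)" by (simp add: algebra_simps power2_eq_square)
      then show ?thesis by (simp add: abs_mult)
    qed
    also have "\<dots> \<le> 331 * q\<^sup>2"
    proof -
      have "\<alpha>\<^sup>2 \<le> (18 * q)\<^sup>2" using \<alpha> abs_le_square_iff[of \<alpha> "18 * q"] q by simp
      then have "\<alpha>\<^sup>2 \<le> 324 * q\<^sup>2" by (simp add: power_mult_distrib)
      moreover have "q\<^sup>2 * q\<^sup>2 \<le> q\<^sup>2 * 1" using qq by (intro mult_left_mono) auto
      then have "(cmod v2)\<^sup>2 \<le> 1 + 3 * q\<^sup>2"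
        using power_mono[OF v2(1), of 2] by (simp add: power2_eq_square algebra_simps)
      moreover have "(1 - 3 * q\<^sup>2)\<^sup>2 \<le> (cmod v2)\<^sup>2" using l2 qq by (intro power_mono) auto
      moreover have "(1 - 3 * q\<^sup>2)\<^sup>2 = 1 - 6 * q\<^sup>2 + (3 * q\<^sup>2)\<^sup>2"
        by (simp add: power2_diff)
      ultimately have "1 - 6 * q\<^sup>2 \<le> (cmod v2)\<^sup>2" "\<alpha>\<^sup>2 \<le> 324 * q\<^sup>2" "(cmod v2)\<^sup>2 \<le> 1 + 3 * q\<^sup>2"
        using zero_le_power2[of "3 * q\<^sup>2"] by linarith+
      moreover have "0 \<le> \<alpha>\<^sup>2" by simp
      ultimately show ?thesis unfolding abs_le_iff using \<alpha>\<beta> zero_le_power2[of q] by linarith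
    qed
    also have "\<dots> \<le> 90 * q" using qq q by linarith
    finally show ?thesis by simp
  qed
  \<comment> \<open>The orientation: 1 leads to a rotation, \<open>- 1\<close> to a rotation
    composed with conjugation.\<close>
  define \<sigma> :: real where "\<sigma> = (if \<beta> \<ge> 0 then 1 else - 1)"
  have \<sigma>: "\<bar>\<beta> - \<sigma>\<bar> \<le> 90 * q" using \<beta> by (auto simp: \<sigma>_def)
  have v2u: "cmod (\<sigma> *\<^sub>R (\<i> * u) - v2) \<le> 108 * q"
  proof -
    have "v2 = \<alpha> *\<^sub>R u + \<beta> *\<^sub>R (\<i> * u)"
    proof -
      have "v2 = v2 * ((Re u)\<^sup>2 + (Im u)\<^sup>2)" by (simp add: uu)
      also have "\<dots> = \<alpha> *\<^sub>R u + \<beta> *\<^sub>R (\<i> * u)"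
        by (simp add: complex_eq_iff \<alpha>_def \<beta>_def inner_complex_def algebra_simps power2_eq_square)
      finally show ?thesis .
    qed
    then have "\<sigma> *\<^sub>R (\<i> * u) - v2 = - (\<alpha> *\<^sub>R u) + (\<sigma> - \<beta>) *\<^sub>R (\<i> * u)"
      by (simp add: scaleR_left_diff_distrib)
    then have "cmod (\<sigma> *\<^sub>R (\<i> * u) - v2) \<le> \<bar>\<alpha>\<bar> + \<bar>\<sigma> - \<beta>\<bar>"
      using norm_triangle_ineq[of "- (\<alpha> *\<^sub>R u)" "(\<sigma> - \<beta>) *\<^sub>R (\<i> * u)"] u by (simp add: norm_mult)
    then show ?thesis using \<alpha> \<sigma> by simp
  qed
  have est: "\<bar>inner u (fst (f Q)) - Re (fst Q)\<bar> \<le> 4 * q * r \<and>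
      \<bar>\<sigma> * inner (\<i> * u) (fst (f Q)) - Im (fst Q)\<bar> \<le> 217 * q * r" if Q: "hdist (0, 0) Q \<le> r / 2" for Q
  proof -
    define \<zeta> where "\<zeta> = fst (f Q)"
    have z: "cmod \<zeta> \<le> 2 * r"
    proof -
      have "cmod \<zeta> \<le> (1 + r\<^sup>2) * hdist (0, 0) Q"
        using hbilip_origin[OF f f0, of Q] cmod_le_ccn[of \<zeta> "snd (f Q)"] by (simp add: \<zeta>_def)
      also have "\<dots> \<le> 2 * (r / 2)" using r2 qq Q by (intro mult_mono) auto
      finally show ?thesis using r by simp
    qed
    have qr: "q\<^sup>2 * r \<le> q / 4 * r" using qq r by (intro mult_right_mono) auto
    have A: "\<bar>inner w \<zeta> - c\<bar> \<le> q\<^sup>2 * r + b * (2 * r)"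
      if "\<bar>inner v \<zeta> - c\<bar> \<le> q\<^sup>2 * r" "cmod (w - v) \<le> b" for v w c b
    proof -
      have "\<bar>inner (w - v) \<zeta>\<bar> \<le> b * (2 * r)"
        using Cauchy_Schwarz_ineq2[of "w - v" \<zeta>] mult_mono[OF that(2) z] order_trans[OF norm_ge_zero that(2)]
        by (meson norm_ge_zero order_trans)
      then show ?thesis using that(1) by (simp add: inner_diff_left)
    qed
    have "\<bar>inner u \<zeta> - Re (fst Q)\<bar> \<le> q\<^sup>2 * r + (3 * q\<^sup>2) * (2 * r)"
      by (rule A[OF _ v1u]) (use v1(2)[OF Q] in \<open>simp add: \<zeta>_def inner_complex_def\<close>)
    moreover have "\<bar>inner (\<sigma> *\<^sub>R (\<i> * u)) \<zeta> - Im (fst Q)\<bar> \<le> q\<^sup>2 * r + (108 * q) * (2 * r)"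
      by (rule A[OF _ v2u]) (use v2(2)[OF Q] in \<open>simp add: \<zeta>_def inner_complex_def\<close>)
    moreover have "q\<^sup>2 * r + (3 * q\<^sup>2) * (2 * r) \<le> 4 * q * r" "q\<^sup>2 * r + (108 * q) * (2 * r) \<le> 217 * q * r"
    proof -
      have "q\<^sup>2 * r + (3 * q\<^sup>2) * (2 * r) = 7 * (q\<^sup>2 * r)" "q / 4 * r = (q * r) / 4" "0 \<le> q * r"
        using q r by simp_all
      then show "q\<^sup>2 * r + (3 * q\<^sup>2) * (2 * r) \<le> 4 * q * r" "q\<^sup>2 * r + (108 * q) * (2 * r) \<le> 217 * q * r"
        using qr by linarith+
    qed
    ultimately show ?thesis unfolding inner_scaleR_left \<zeta>_def by linarith
  qed
  have re: "Re (cnj u * z) = inner u z" and im: "Im (cnj u * z) = inner (\<i> * u) z" for z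
    by (simp_all add: inner_complex_def)
  have fin: "cmod z \<le> 400 * q * r" if "\<bar>Re z\<bar> \<le> 4 * q * r" "\<bar>Im z\<bar> \<le> 217 * q * r" for z
  proof -
    have "0 \<le> q * r" using q r by simp
    then show ?thesis using cmod_le[of z] that by linarith
  qed
  show thesis
  proof (rule that[OF u])
    show "(\<forall>Q. hdist (0, 0) Q \<le> r / 2 \<longrightarrow> cmod (cnj u * fst (f Q) - fst Q) \<le> 400 * q * r) \<or>
     (\<forall>Q. hdist (0, 0) Q \<le> r / 2 \<longrightarrow> cmod (cnj u * fst (f Q) - cnj (fst Q)) \<le> 400 * q * r)"
    proof (cases "\<beta> \<ge> 0")
      case True
      have "cmod (cnj u * fst (f Q) - fst Q) \<le> 400 * q * r" if "hdist (0, 0) Q \<le> r / 2" for Q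
        using est[OF that] True by (intro fin) (simp_all only: minus_complex.simps re im, simp_all add: \<sigma>_def)
      then show ?thesis by blast
    next
      case False
      have "cmod (cnj u * fst (f Q) - cnj (fst Q)) \<le> 400 * q * r" if "hdist (0, 0) Q \<le> r / 2" for Q
        using est[OF that] False
        by (intro fin) (simp_all only: minus_complex.simps complex_cnj re im, simp_all add: \<sigma>_def abs_le_iff)
      then show ?thesis by blast
    qed
  qed
qed

text \<open>A horizontal step \<open>w\<close> has an image displacement \<open>(z, s)\<close> of
  length \<open>y\<close> hardly above \<open>cmod w\<close>, while closeness of the projections
  forces \<open>cmod z\<close> to be hardly below it. The Koranyi bound then gives
  \<open>s\<^sup>2 \<le> 4 * (y - cmod z) * y ^ 3\<close>, so \<open>s\<close> has order
  \<open>\<omega> ^ 18\<close>. The change in \<open>sform\<close> has order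
  \<open>\<omega> ^ 20\<close>. Each of the five steps to \<open>Q\<close> thus adds at most
  \<open>7 * C * \<omega> ^ 18\<close> to the vertical error, and \<open>ccn_upper\<close> takes the
  final square root.\<close>

lemma hbilip_close_to_id:
  fixes \<omega> C :: real
  assumes g: "hbilip (1 + (\<omega> ^ 8)\<^sup>2) g" and g0: "g (0, 0) = (0, 0)"
    and \<omega>: "0 < \<omega>" "\<omega> \<le> 1" and C: "1 \<le> C"
    and close: "\<And>Q. hdist (0, 0) Q \<le> \<omega> ^ 8 / 2 \<Longrightarrow> cmod (fst (g Q) - fst Q) \<le> C * \<omega> ^ 12"
    and Q: "hdist (0, 0) Q \<le> \<omega> ^ 8 / 6"
  shows "hdist (g Q) Q \<le> 15 * C * \<omega> ^ 9"
proof -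
  define r where "r = \<omega> ^ 8"
  have r: "0 < r" "r \<le> 1" using \<omega> by (simp_all add: r_def power_le_one)
  have r2: "r\<^sup>2 \<le> 1" using r by (simp add: power_le_one)
  have pw: "\<omega> ^ m \<le> \<omega> ^ n" if "n \<le> m" for m n
    using \<omega> that by (simp add: power_decreasing)
  define E where "E P = \<bar>snd (g P) - snd P\<bar>" for P
  have big: "hdist (0, 0) (g P) \<le> r" if "hdist (0, 0) P \<le> r / 2" for P
  proof -
    have "hdist (0, 0) (g P) \<le> (1 + r\<^sup>2) * hdist (0, 0) P" using hbilip_origin[OF g g0] by (simp add: r_def)
    also have "\<dots> \<le> 2 * (r / 2)" using that r2 by (intro mult_mono) auto
    finally show ?thesis by simp
  qed
  have step: "hdist (0, 0) (x + w, t + sform x w) \<le> \<rho> + cmod w \<and> E (x + w, t + sform x w) \<le> E (x, t) + 7 * C * \<omega> ^ 18"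
    if P: "hdist (0, 0) (x, t) \<le> \<rho>" and w: "\<rho> + cmod w \<le> r / 2" for x w t \<rho>
  proof -
    define P P' where "P = (x, t)" and "P' = (x + w, t + sform x w)"
    have d: "hdist P P' = cmod w" by (simp add: hdist_def P_def P'_def sform_simps)
    have dP': "hdist (0, 0) P' \<le> \<rho> + cmod w"
      using hdist_triangle[of "(0, 0)" P' P] P d by (simp add: P_def)
    have wr: "cmod w \<le> r / 2" using P w hdist_nonneg[of "(0, 0)" "(x, t)"] by linarith
    have in2: "hdist (0, 0) P \<le> r / 2" "hdist (0, 0) P' \<le> r / 2"
      using P w dP' norm_ge_zero[of w] unfolding P_def by linarith+
    define z s where "z = fst (g P') - fst (g P)" and "s = snd (g P') - snd (g P) - sform (fst (g P)) (fst (g P'))"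
    define y where "y = ccn z s"
    have y1: "y \<le> (1 + r\<^sup>2) * cmod w"
    proof -
      have "y = hdist (g P) (g P')" by (simp add: y_def z_def s_def hdist_def)
      also have "\<dots> \<le> (1 + r\<^sup>2) * hdist P P'" using g by (simp only: hbilip_def r_def)
      finally show ?thesis by (simp only: d)
    qed
    have cP: "cmod (fst (g P) - fst P) \<le> C * \<omega> ^ 12" "cmod (fst (g P') - fst P') \<le> C * \<omega> ^ 12"
      using close in2 by (auto simp: r_def)
    have "cmod w = cmod (z - (fst (g P') - fst P') + (fst (g P) - fst P))"
      by (simp add: z_def P_def P'_def)
    also have "\<dots> \<le> cmod z + cmod (fst (g P') - fst P') + cmod (fst (g P) - fst P)"
      by (meson norm_triangle_ineq norm_triangle_ineq4 order_trans add_right_mono)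
    finally have zl: "cmod w \<le> cmod z + 2 * (C * \<omega> ^ 12)" using cP by linarith
    have "r\<^sup>2 * cmod w \<le> r\<^sup>2 * 1" using wr r by (intro mult_left_mono) auto
    also have "\<dots> \<le> 1 * \<omega> ^ 12" using pw[of 12 16] by (simp add: r_def flip: power_mult)
    also have "\<dots> \<le> C * \<omega> ^ 12" using C \<omega> by (intro mult_right_mono) auto
    finally have yz: "y - cmod z \<le> 3 * (C * \<omega> ^ 12)" using y1 zl by (simp add: algebra_simps)
    have "(1 + r\<^sup>2) * cmod w \<le> 2 * (r / 2)" using wr r2 by (intro mult_mono) auto
    then have "y \<le> 2 * (r / 2)" using y1 by linarith
    then have yr: "y \<le> \<omega> ^ 8" by (simp add: r_def)
    have zy: "cmod z \<le> y" "0 \<le> y" by (simp_all add: y_def cmod_le_ccn)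
    have "s\<^sup>2 \<le> y ^ 4 - cmod z ^ 4" using ccn_koranyi[of z s] by (simp add: y_def)
    also have "\<dots> = (y - cmod z) * (y ^ 3 + y\<^sup>2 * cmod z + y * (cmod z)\<^sup>2 + cmod z ^ 3)"
      by (simp add: algebra_simps power2_eq_square power3_eq_cube power4_eq_xxxx)
    also have "\<dots> \<le> (y - cmod z) * (y ^ 3 + y\<^sup>2 * y + y * y\<^sup>2 + y ^ 3)"
      using zy by (intro mult_left_mono add_mono mult_mono power_mono) auto
    also have "\<dots> = (y - cmod z) * (4 * y ^ 3)" by (simp add: power2_eq_square power3_eq_cube)
    also have "\<dots> \<le> (3 * (C * \<omega> ^ 12)) * (4 * (\<omega> ^ 8) ^ 3)"
      using yz zy yr C \<omega> by (intro mult_mono power_mono mult_nonneg_nonneg) auto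
    also have "\<dots> = 12 * C * (\<omega> ^ 18)\<^sup>2" by (simp flip: power_mult power_add)
    also have "\<dots> \<le> (4 * C * \<omega> ^ 18)\<^sup>2"
    proof -
      have "12 * C \<le> 16 * C\<^sup>2" using C by (simp add: power2_eq_square)
      then have "12 * C * (\<omega> ^ 18)\<^sup>2 \<le> 16 * C\<^sup>2 * (\<omega> ^ 18)\<^sup>2" by (intro mult_right_mono) auto
      then show ?thesis by (simp add: power_mult_distrib)
    qed
    finally have s: "\<bar>s\<bar> \<le> 4 * C * \<omega> ^ 18"
      using C \<omega> by (simp add: abs_le_square_iff[symmetric])
    have "sform (fst (g P)) (fst (g P')) - sform (fst P) (fst P')
        = sform (fst (g P) - fst P) (fst (g P')) + sform (fst P) (fst (g P') - fst P')"
      by (simp add: sform_simps)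
    also have "\<bar>\<dots>\<bar> \<le> 2 * (C * \<omega> ^ 12 * r) + 2 * (r / 2 * (C * \<omega> ^ 12))"
    proof (rule order_trans[OF abs_triangle_ineq add_mono])
      have "cmod (fst (g P')) \<le> r"
        using big[OF in2(2)] cmod_le_ccn[of "fst (g P')" "snd (g P')"] by simp
      then show "\<bar>sform (fst (g P) - fst P) (fst (g P'))\<bar> \<le> 2 * (C * \<omega> ^ 12 * r)"
        using abs_sform_le[of "fst (g P) - fst P" "fst (g P')"] mult_mono[OF cP(1), of "cmod (fst (g P'))" r] C \<omega>
        by simp
      have "cmod (fst P) \<le> r / 2"
        using in2(1) cmod_le_ccn[of "fst P" "snd P"] by simp
      then show "\<bar>sform (fst P) (fst (g P') - fst P')\<bar> \<le> 2 * (r / 2 * (C * \<omega> ^ 12))"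
        using abs_sform_le[of "fst P" "fst (g P') - fst P'"] mult_mono[OF _ cP(2), of "cmod (fst P)" "r / 2"] r
        by simp
    qed
    also have "\<dots> = 3 * C * \<omega> ^ 20" by (simp add: r_def flip: power_add)
    also have "\<dots> \<le> 3 * C * \<omega> ^ 18" using C by (intro mult_left_mono pw) auto
    finally have sf: "\<bar>sform (fst (g P)) (fst (g P')) - sform (fst P) (fst P')\<bar> \<le> 3 * C * \<omega> ^ 18" .
    have "snd (g P') - snd P' = (snd (g P) - snd P) + s + (sform (fst (g P)) (fst (g P')) - sform (fst P) (fst P'))"
      by (simp add: s_def P_def P'_def sform_simps)
    then have "E P' \<le> E P + 7 * C * \<omega> ^ 18" using s sf unfolding E_def by linarith
    then show ?thesis using dP' by (simp add: P_def P'_def)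
  qed
  define \<xi> \<tau> where "\<xi> = fst Q" and "\<tau> = snd Q"
  \<comment> \<open>The side of the square loop that produces \<tau>. It is at most
    \<open>r / 12\<close>, so the five steps stay within \<open>r / 6 + 4 * a \<le> r / 2\<close>;
    this fixes the radius \<open>\<omega> ^ 8 / 6\<close> allowed for \<open>Q\<close>.\<close>
  define a where "a = sqrt \<bar>\<tau>\<bar> / 2"
  define w w' where "w = complex_of_real a" and "w' = Complex 0 (if \<tau> \<ge> 0 then - a else a)"
  have c: "ccn \<xi> \<tau> \<le> r / 6" using Q by (simp add: \<xi>_def \<tau>_def r_def)
  have a0: "0 \<le> a" by (simp add: a_def)
  have ar: "a \<le> r / 12"
  proof -
    have "\<bar>\<tau>\<bar> \<le> (r / 6)\<^sup>2" using abs_le_ccn[of \<tau> \<xi>] power_mono[OF c, of 2] by simp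
    then have "sqrt \<bar>\<tau>\<bar> \<le> r / 6" using r by (intro real_le_lsqrt) auto
    then show ?thesis by (simp add: a_def)
  qed
  have aa: "4 * a\<^sup>2 = \<bar>\<tau>\<bar>" by (simp add: a_def power_divide)
  have nw: "cmod w = a" "cmod w' = a" "cmod (- w) = a" "cmod (- w') = a"
    using a0 by (auto simp: w_def w'_def cmod_def)
  have \<xi>r: "cmod \<xi> \<le> r / 6" using c cmod_le_ccn order_trans by blast
  have E0: "E (0, 0) = 0" by (simp add: E_def g0)
  have p1: "hdist (0, 0) (\<xi>, 0) \<le> r / 6" "E (\<xi>, 0) \<le> 7 * C * \<omega> ^ 18"
    using step[of 0 0 0 \<xi>] \<xi>r r E0 by (simp_all add: sform_simps)
  define t1 where "t1 = 0 + sform \<xi> w"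
  have p2: "hdist (0, 0) (\<xi> + w, t1) \<le> r / 6 + a" "E (\<xi> + w, t1) \<le> 14 * C * \<omega> ^ 18"
    using step[OF p1(1), of w] p1 nw ar r by (auto simp: t1_def)
  define t2 where "t2 = t1 + sform (\<xi> + w) w'"
  have p3: "hdist (0, 0) (\<xi> + w + w', t2) \<le> r / 6 + 2 * a" "E (\<xi> + w + w', t2) \<le> 21 * C * \<omega> ^ 18"
    using step[OF p2(1), of w'] p2 nw ar r by (auto simp: t2_def)
  define t3 where "t3 = t2 + sform (\<xi> + w + w') (- w)"
  have p4: "hdist (0, 0) (\<xi> + w + w' + - w, t3) \<le> r / 6 + 3 * a" "E (\<xi> + w + w' + - w, t3) \<le> 28 * C * \<omega> ^ 18"
    using step[OF p3(1), of "- w"] p3 nw ar r unfolding t3_def by auto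
  define t4 where "t4 = t3 + sform (\<xi> + w + w' + - w) (- w')"
  have p5: "E (\<xi> + w + w' + - w + - w', t4) \<le> 35 * C * \<omega> ^ 18"
    using step[OF p4(1), of "- w'"] p4 nw ar r unfolding t4_def by auto
  have "t4 = \<tau>"
  proof -
    \<comment> \<open>The terms with \<xi> cancel because the loop closes in the plane, and each
      half of the loop contributes \<open>sform w w'\<close>.\<close>
    have "t4 = 2 * sform w w'"
      using sform_swap[of w w'] by (simp add: t1_def t2_def t3_def t4_def sform_simps)
    also have "\<dots> = \<tau>" using aa by (auto simp: sform_def w_def w'_def power2_eq_square abs_if split: if_splits)
    finally show ?thesis .
  qed
  then have EQ: "\<bar>snd (g Q) - \<tau>\<bar> \<le> 35 * C * \<omega> ^ 18" using p5 by (simp add: E_def \<xi>_def \<tau>_def)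
  have cQ: "cmod (fst (g Q) - \<xi>) \<le> C * \<omega> ^ 12"
  proof -
    have "0 \<le> \<omega> ^ 8" using \<omega> by simp
    then have "hdist (0, 0) Q \<le> \<omega> ^ 8 / 2" using Q by linarith
    from close[OF this] show ?thesis by (simp add: \<xi>_def)
  qed
  have sf: "\<bar>sform (fst (g Q)) \<xi>\<bar> \<le> C * \<omega> ^ 18"
  proof -
    have "sform (fst (g Q)) \<xi> = sform (fst (g Q) - \<xi>) \<xi>" by (simp add: sform_simps)
    also have "\<bar>\<dots>\<bar> \<le> 2 * (C * \<omega> ^ 12 * (r / 6))"
    proof -
      have "cmod (fst (g Q) - \<xi>) * cmod \<xi> \<le> C * \<omega> ^ 12 * (r / 6)"
        using C \<omega> by (intro mult_mono cQ \<xi>r) auto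
      then show ?thesis using abs_sform_le[of "fst (g Q) - \<xi>" \<xi>] by linarith
    qed
    also have "\<dots> = (C / 3) * \<omega> ^ 20" by (simp add: r_def flip: power_add)
    also have "\<dots> \<le> C * \<omega> ^ 18" using C \<omega> pw[of 18 20] by (intro mult_mono) auto
    finally show ?thesis .
  qed
  have "hdist (g Q) Q \<le> cmod (\<xi> - fst (g Q)) + 2 * sqrt \<bar>\<tau> - snd (g Q) - sform (fst (g Q)) \<xi>\<bar>"
    unfolding hdist_def \<xi>_def \<tau>_def by (rule ccn_upper)
  also have "\<dots> \<le> C * \<omega> ^ 9 + 2 * (7 * C * \<omega> ^ 9)"
  proof (rule add_mono)
    have "C * \<omega> ^ 12 \<le> C * \<omega> ^ 9" using C by (intro mult_left_mono pw) auto
    then show "cmod (\<xi> - fst (g Q)) \<le> C * \<omega> ^ 9" using cQ by (simp add: norm_minus_commute)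
    have "\<bar>\<tau> - snd (g Q) - sform (fst (g Q)) \<xi>\<bar> \<le> 36 * C * \<omega> ^ 18" using EQ sf by linarith
    also have "\<dots> \<le> (7 * C * \<omega> ^ 9)\<^sup>2"
    proof -
      have "36 * C \<le> 49 * C\<^sup>2" using C by (simp add: power2_eq_square)
      then have "36 * C * \<omega> ^ 18 \<le> 49 * C\<^sup>2 * \<omega> ^ 18" using \<omega> by (intro mult_right_mono) auto
      then show ?thesis by (simp add: power_mult_distrib flip: power_mult)
    qed
    finally have "sqrt \<bar>\<tau> - snd (g Q) - sform (fst (g Q)) \<xi>\<bar> \<le> 7 * C * \<omega> ^ 9"
      using C \<omega> by (intro real_le_lsqrt) auto
    then show "2 * sqrt \<bar>\<tau> - snd (g Q) - sform (fst (g Q)) \<xi>\<bar> \<le> 2 * (7 * C * \<omega> ^ 9)" by simp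
  qed
  finally show ?thesis by simp
qed

section \<open>Comparison with a rotation or a reflection\<close>

lemma hdist_rotate:
  assumes "cmod u = 1"
  shows "hdist (u * z, t) (u * w, s) = hdist (z, t) (w, s)"
proof -
  have "sform (u * z) (u * w) = sform z w"
  proof -
    have "u * z * cnj (u * w) = (u * cnj u) * (z * cnj w)" by simp
    also have "u * cnj u = 1" using assms by (simp add: complex_norm_square[symmetric])
    finally show ?thesis unfolding sform_def by (simp only: mult_1_left)
  qed
  moreover have "ccn (u * w - u * z) c = ccn (w - z) c" for c
    using ccn_scale[of u "w - z" c] assms by (simp add: right_diff_distrib)
  ultimately show ?thesis by (simp add: hdist_def)
qed

lemma hdist_cnj: "hdist (cnj z, - t) (cnj w, - s) = hdist (z, t) (w, s)"
proof -
  have "sform (cnj z) (cnj w) = - sform z w" by (simp add: sform_def)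
  then show ?thesis using ccn_cnj[of "w - z" "s - t - sform z w"] by (simp add: hdist_def algebra_simps)
qed

text \<open>Undoing the rotation by \<open>u\<close>, and the reflection if there is one, makes
  \<open>f\<close> close to the identity in projection with constant \<open>400 * C\<close>; the
  factor 6000 is 15 times 400.\<close>

lemma hbilip_near_isometry:
  fixes \<omega> C :: real
  defines "C \<equiv> 7 + 3 * (2000 * 20000 ^ 3)"
  assumes f: "hbilip (1 + \<omega> ^ 16) f" and f0: "f (0, 0) = (0, 0)" and \<omega>: "0 < \<omega>" "\<omega> \<le> 1 / (40000 * C)"
  obtains T where "\<And>P Q. hdist (T P) (T Q) = hdist P Q"
    "\<And>Q. hdist (0, 0) Q \<le> \<omega> ^ 8 / 6 \<Longrightarrow> hdist (f Q) (T Q) \<le> 6000 * C * \<omega> ^ 9"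
proof -
  define r where "r = \<omega> ^ 8"
  have C: "C \<ge> 7" by (simp add: C_def)
  have "1 / (40000 * C) \<le> 1 / 40000" using C by (intro divide_left_mono) auto
  then have \<omega>1: "\<omega> \<le> 1 / 40000" "\<omega> \<le> 1" using \<omega> by linarith+
  have "r \<le> \<omega> ^ 1" unfolding r_def using \<omega> \<omega>1 by (intro power_decreasing) auto
  then have r: "0 < r" "r \<le> 1 / 40000" using \<omega> \<omega>1 by (auto simp: r_def)
  have r16: "r\<^sup>2 = \<omega> ^ 16" by (simp add: r_def flip: power_mult)
  \<comment> \<open>The solution of \<open>C * r = q\<^sup>2\<close>, so that \<open>q * r\<close>
    has order \<open>\<omega> ^ 12\<close>. The bound on \<omega> yields both
    \<open>r \<le> 1 / 40000\<close> and \<open>q \<le> 1 / 4\<close>.\<close>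
  define q where "q = sqrt C * \<omega> ^ 4"
  have qC: "sqrt C \<le> C" using C by (intro real_le_lsqrt) (auto simp: power2_eq_square)
  have q: "C * r = q\<^sup>2" "0 < q" "q \<le> 1 / 4"
  proof -
    show "C * r = q\<^sup>2" using C by (simp add: q_def r_def power_mult_distrib flip: power_mult)
    show "0 < q" using C \<omega> by (simp add: q_def)
    have "q \<le> C * \<omega> ^ 1"
      unfolding q_def using qC C \<omega> \<omega>1 by (intro mult_mono power_decreasing) auto
    also have "\<dots> \<le> C * (1 / (40000 * C))" using \<omega> C by (intro mult_left_mono) auto
    finally show "q \<le> 1 / 4" using C by simp
  qed
  obtain u where u: "cmod u = 1" and alt:
    "(\<forall>Q. hdist (0, 0) Q \<le> r / 2 \<longrightarrow> cmod (cnj u * fst (f Q) - fst Q) \<le> 400 * q * r) \<or>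
     (\<forall>Q. hdist (0, 0) Q \<le> r / 2 \<longrightarrow> cmod (cnj u * fst (f Q) - cnj (fst Q)) \<le> 400 * q * r)"
    using hbilip_projection_almost_orthogonal[of r f q, folded C_def, unfolded r16, OF f f0 r q] by blast
  have qr: "400 * q * r \<le> (400 * C) * \<omega> ^ 12"
  proof -
    have "400 * q * r = 400 * sqrt C * \<omega> ^ 12" by (simp add: q_def r_def flip: power_add)
    then show ?thesis using qC \<omega> by simp
  qed
  have uc: "cmod (cnj u) = 1" "u * cnj u = 1" "cnj u * u = 1"
    using u by (simp_all add: complex_norm_square[symmetric] mult.commute)
  have C4: "1 \<le> 400 * C" using C by simp
  from alt show thesis
  proof
    assume A: "\<forall>Q. hdist (0, 0) Q \<le> r / 2 \<longrightarrow> cmod (cnj u * fst (f Q) - fst Q) \<le> 400 * q * r"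
    define g where "g Q = (cnj u * fst (f Q), snd (f Q))" for Q
    have gg: "hdist (g P) (g Q) = hdist (f P) (f Q)" for P Q
      using hdist_rotate[OF uc(1), of "fst (f P)" "snd (f P)" "fst (f Q)" "snd (f Q)"] by (simp add: g_def)
    have g: "hbilip (1 + (\<omega> ^ 8)\<^sup>2) g" using f r16 by (simp add: hbilip_def gg r_def)
    have g0: "g (0, 0) = (0, 0)" by (simp add: g_def f0)
    have cl: "cmod (fst (g Q) - fst Q) \<le> 400 * C * \<omega> ^ 12" if "hdist (0, 0) Q \<le> \<omega> ^ 8 / 2" for Q
      using A that qr by (force simp: g_def r_def)
    define T where "T Q = (u * fst Q, snd Q)" for Q :: hpoint
    show thesis
    proof (rule that)
      show "hdist (T P) (T Q) = hdist P Q" for P Q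
        using hdist_rotate[OF u, of "fst P" "snd P" "fst Q" "snd Q"] by (simp add: T_def)
      fix Q assume Q: "hdist (0, 0) Q \<le> \<omega> ^ 8 / 6"
      have eq: "u * (cnj u * fst (f Q)) = fst (f Q)" by (simp add: uc(2) mult.assoc[symmetric])
      have "hdist (f Q) (T Q) = hdist (g Q) Q"
        using hdist_rotate[OF u, of "cnj u * fst (f Q)" "snd (f Q)" "fst Q" "snd Q"] unfolding eq by (simp add: T_def g_def)
      then show "hdist (f Q) (T Q) \<le> 6000 * C * \<omega> ^ 9"
        using hbilip_close_to_id[OF g g0 \<omega>(1) \<omega>1(2) C4 cl Q] by simp
    qed
  next
    assume A: "\<forall>Q. hdist (0, 0) Q \<le> r / 2 \<longrightarrow> cmod (cnj u * fst (f Q) - cnj (fst Q)) \<le> 400 * q * r"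
    \<comment> \<open>Conjugation reverses the sign of \<open>sform\<close>, so it is an isometry
      only together with a sign change of the vertical coordinate.\<close>
    define g where "g Q = (cnj (cnj u * fst (f Q)), - snd (f Q))" for Q
    have gg: "hdist (g P) (g Q) = hdist (f P) (f Q)" for P Q
      using hdist_rotate[OF uc(1), of "fst (f P)" "snd (f P)" "fst (f Q)" "snd (f Q)"]
        hdist_cnj[of "cnj u * fst (f P)" "snd (f P)" "cnj u * fst (f Q)" "snd (f Q)"] by (simp add: g_def)
    have g: "hbilip (1 + (\<omega> ^ 8)\<^sup>2) g" using f r16 by (simp add: hbilip_def gg r_def)
    have g0: "g (0, 0) = (0, 0)" by (simp add: g_def f0)
    have cl: "cmod (fst (g Q) - fst Q) \<le> 400 * C * \<omega> ^ 12" if "hdist (0, 0) Q \<le> \<omega> ^ 8 / 2" for Q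
    proof -
      have "cmod (fst (g Q) - fst Q) = cmod (cnj (cnj u * fst (f Q) - cnj (fst Q)))" by (simp add: g_def)
      also have "\<dots> = cmod (cnj u * fst (f Q) - cnj (fst Q))" by (rule complex_mod_cnj)
      also have "\<dots> \<le> 400 * q * r" using A[rule_format, of Q] that by (simp add: r_def)
      finally show ?thesis using qr by simp
    qed
    define T where "T Q = (u * cnj (fst Q), - snd Q)" for Q :: hpoint
    show thesis
    proof (rule that)
      show "hdist (T P) (T Q) = hdist P Q" for P Q
        using hdist_rotate[OF u, of "cnj (fst P)" "- snd P" "cnj (fst Q)" "- snd Q"]
          hdist_cnj[of "fst P" "snd P" "fst Q" "snd Q"] by (simp add: T_def)
      fix Q assume Q: "hdist (0, 0) Q \<le> \<omega> ^ 8 / 6"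
      have eq: "u * (cnj u * fst (f Q)) = fst (f Q)" by (simp add: uc(2) mult.assoc[symmetric])
      have "hdist (f Q) (T Q) = hdist (cnj u * fst (f Q), snd (f Q)) (cnj (fst Q), - snd Q)"
        using hdist_rotate[OF u, of "cnj u * fst (f Q)" "snd (f Q)" "cnj (fst Q)" "- snd Q"] unfolding eq by (simp add: T_def)
      also have "\<dots> = hdist (g Q) Q"
        using hdist_cnj[of "cnj u * fst (f Q)" "snd (f Q)" "cnj (fst Q)" "- snd Q"] by (simp add: g_def)
      finally show "hdist (f Q) (T Q) \<le> 6000 * C * \<omega> ^ 9"
        using hbilip_close_to_id[OF g g0 \<omega>(1) \<omega>1(2) C4 cl Q] by simp
    qed
  qed
qed

section \<open>Rescaling and return to the original coordinates\<close>

definition hpoint_of :: "heis \<Rightarrow> hpoint" where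
  "hpoint_of = (\<lambda>(x, y, t). (Complex x y, t))"

definition heis_of_hpoint :: "hpoint \<Rightarrow> heis" where
  "heis_of_hpoint P = heis_of (fst P) (snd P)"

lemma hpoint_of_inverse [simp]: "heis_of_hpoint (hpoint_of P) = P" "hpoint_of (heis_of_hpoint Q) = Q"
  by (auto simp: hpoint_of_def heis_of_hpoint_def heis_of_def split: prod.split)

lemma control_dist_eq_hdist: "control_dist P Q = hdist (hpoint_of P) (hpoint_of Q)"
  using control_dist_heis_of[of "fst (hpoint_of P)" "snd (hpoint_of P)" "fst (hpoint_of Q)" "snd (hpoint_of Q)"]
  unfolding heis_of_hpoint_def[symmetric] by (simp add: hdist_def)

text \<open>The dilation by \<open>m\<close> followed by the left translation by
  \<open>S\<close>.\<close>

definition hsim :: "hpoint \<Rightarrow> real \<Rightarrow> hpoint \<Rightarrow> hpoint" where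
  "hsim S m P = (fst S + complex_of_real m * fst P, snd S + m\<^sup>2 * snd P + sform (fst S) (complex_of_real m * fst P))"

definition hsim_inv :: "hpoint \<Rightarrow> real \<Rightarrow> hpoint \<Rightarrow> hpoint" where
  "hsim_inv S m P = (complex_of_real (1 / m) * (fst P - fst S), (1 / m)\<^sup>2 * (snd P - snd S - sform (fst S) (fst P)))"

lemma hdist_hsim:
  assumes "0 \<le> m"
  shows "hdist (hsim S m P) (hsim S m Q) = m * hdist P Q"
proof -
  have "fst (hsim S m Q) - fst (hsim S m P) = complex_of_real m * (fst Q - fst P)"
    by (simp add: hsim_def right_diff_distrib)
  moreover have "snd (hsim S m Q) - snd (hsim S m P) - sform (fst (hsim S m P)) (fst (hsim S m Q))
      = (cmod (complex_of_real m))\<^sup>2 * (snd Q - snd P - sform (fst P) (fst Q))"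
    unfolding hsim_def fst_conv snd_conv sform_simps using sform_swap[of "fst S" "fst P"]
    by (simp add: power2_eq_square algebra_simps)
  ultimately show ?thesis using assms by (simp only: hdist_def ccn_scale) simp
qed

lemma hsim_inverse: "m \<noteq> 0 \<Longrightarrow> hsim S m (hsim_inv S m P) = P"
  by (simp add: hsim_def hsim_inv_def sform_simps power_divide prod_eq_iff)

lemma hsim_inv_base: "hsim_inv S m S = (0, 0)"
  by (simp add: hsim_inv_def sform_simps)

theorem theoremD:
  shows "\<exists>\<epsilon>\<^sub>0>0. \<exists>C>0. \<forall>(\<epsilon>::real) (f :: heis \<Rightarrow> heis) (R::real) (P\<^sub>0 :: heis).
    0 < \<epsilon> \<longrightarrow> \<epsilon> < \<epsilon>\<^sub>0 \<longrightarrow> heis_biLipschitz (1 + \<epsilon>) f \<longrightarrow> R > 0 \<longrightarrow>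
    (\<exists>T. heis_isometry T \<and>
      (\<forall>P. control_dist P P\<^sub>0 \<le> R \<longrightarrow>
        control_dist (f P) (T P) \<le> C * \<epsilon> powr (1 / 2 ^ 11) * R))"
proof -
  define C :: real where "C = 7 + 3 * (2000 * 20000 ^ 3)"
  have C: "C \<ge> 7" by (simp add: C_def)
  \<comment> \<open>As \<omega> will be the 16th root of \<epsilon>, this is the bound on \<omega>
    that \<open>hbilip_near_isometry\<close> asks for.\<close>
  define \<epsilon>0 where "\<epsilon>0 = (1 / (40000 * C)) ^ 16"
  have \<epsilon>0: "0 < \<epsilon>0" "\<epsilon>0 \<le> 1" using C by (auto simp: \<epsilon>0_def intro!: power_le_one)
  have main: "\<exists>T. heis_isometry T \<and>
      (\<forall>P. control_dist P P0 \<le> R \<longrightarrow> control_dist (f P) (T P) \<le> 36000 * C * \<epsilon> powr (1 / 2 ^ 11) * R)"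
    if \<epsilon>: "0 < \<epsilon>" "\<epsilon> < \<epsilon>0" and f: "heis_biLipschitz (1 + \<epsilon>) f" and R: "R > 0" for \<epsilon> f R P0
  proof -
    define \<omega> where "\<omega> = \<epsilon> powr (1 / 16)"
    have \<omega>16: "\<omega> ^ 16 = \<epsilon>" using \<epsilon> by (simp add: \<omega>_def powr_powr flip: powr_realpow)
    have \<omega>0: "0 < \<omega>" using \<epsilon> by (simp add: \<omega>_def)
    have "\<omega> ^ 16 \<le> (1 / (40000 * C)) ^ 16" using \<epsilon> by (simp add: \<omega>16 \<epsilon>0_def)
    then have \<omega>1: "\<omega> \<le> 1 / (40000 * C)" using \<omega>0 C by (subst (asm) power_mono_iff) auto
    \<comment> \<open>The dilation factor that carries the ball of radius
      \<open>\<omega> ^ 8 / 6\<close>, where \<open>hbilip_near_isometry\<close> controls the map,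
      to a ball of radius \<open>R\<close>.\<close>
    define m where "m = 6 * R / \<omega> ^ 8"
    have m: "m > 0" using R \<omega>0 by (simp add: m_def)
    define S where "S = hpoint_of P0"
    define S' where "S' = hpoint_of (f P0)"
    \<comment> \<open>Similarities with the same factor \<open>m\<close> on both sides leave the
      bi-Lipschitz constant unchanged; their base points \<open>P0\<close> and \<open>f P0\<close>
      make \<open>F\<close> fix the origin.\<close>
    define F where "F Q = hsim_inv S' m (hpoint_of (f (heis_of_hpoint (hsim S m Q))))" for Q
    have hF: "hsim S' m (F Q) = hpoint_of (f (heis_of_hpoint (hsim S m Q)))" for Q
      using m by (simp add: F_def hsim_inverse)
    have dF: "m * hdist (F P) (F Q)
        = control_dist (f (heis_of_hpoint (hsim S m P))) (f (heis_of_hpoint (hsim S m Q)))" for P Q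
      using hdist_hsim[of m S' "F P" "F Q"] m by (simp add: hF control_dist_eq_hdist)
    have dS: "control_dist (heis_of_hpoint (hsim S m P)) (heis_of_hpoint (hsim S m Q)) = m * hdist P Q" for P Q
      using m by (simp add: control_dist_eq_hdist hdist_hsim)
    have "hbilip (1 + \<omega> ^ 16) F"
      unfolding hbilip_def \<omega>16
    proof (intro allI)
      fix P Q
      have "inverse (1 + \<epsilon>) * (m * hdist P Q) \<le> m * hdist (F P) (F Q) \<and>
          m * hdist (F P) (F Q) \<le> (1 + \<epsilon>) * (m * hdist P Q)"
        using f[unfolded heis_biLipschitz_def, rule_format,
          of "heis_of_hpoint (hsim S m P)" "heis_of_hpoint (hsim S m Q)"] by (simp only: dF dS)
      then have "m * (inverse (1 + \<epsilon>) * hdist P Q) \<le> m * hdist (F P) (F Q)"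
        "m * hdist (F P) (F Q) \<le> m * ((1 + \<epsilon>) * hdist P Q)" by (simp_all add: algebra_simps)
      then show "inverse (1 + \<epsilon>) * hdist P Q \<le> hdist (F P) (F Q) \<and> hdist (F P) (F Q) \<le> (1 + \<epsilon>) * hdist P Q"
        using m by (simp only: mult_le_cancel_left_pos)
    qed
    moreover have "F (0, 0) = (0, 0)"
      by (simp add: F_def hsim_def S_def S'_def hsim_inv_base sform_simps)
    ultimately obtain T0 where T0: "\<And>P Q. hdist (T0 P) (T0 Q) = hdist P Q"
      "\<And>Q. hdist (0, 0) Q \<le> \<omega> ^ 8 / 6 \<Longrightarrow> hdist (F Q) (T0 Q) \<le> 6000 * C * \<omega> ^ 9"
      using hbilip_near_isometry[of \<omega> F, folded C_def] \<omega>0 \<omega>1 by metis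
    define T where "T P = heis_of_hpoint (hsim S' m (T0 (hsim_inv S m (hpoint_of P))))" for P
    have inv: "m * hdist (hsim_inv S m P) (hsim_inv S m Q) = hdist P Q" for P Q
      using hdist_hsim[of m S "hsim_inv S m P" "hsim_inv S m Q"] m by (simp add: hsim_inverse)
    have "heis_isometry T"
      unfolding heis_isometry_def using m by (simp add: T_def control_dist_eq_hdist hdist_hsim T0(1) inv)
    moreover have "control_dist (f P) (T P) \<le> 36000 * C * \<epsilon> powr (1 / 2 ^ 11) * R"
      if P: "control_dist P P0 \<le> R" for P
    proof -
      define Q where "Q = hsim_inv S m (hpoint_of P)"
      have "m * hdist (0, 0) Q = control_dist P P0"
        using inv[of S "hpoint_of P"] by (simp add: Q_def hsim_inv_base control_dist_eq_hdist S_def hdist_commute)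
      then have "hdist (0, 0) Q \<le> R / m" using P m by (simp add: field_simps)
      also have "R / m = \<omega> ^ 8 / 6" using R \<omega>0 by (simp add: m_def)
      finally have "hdist (F Q) (T0 Q) \<le> 6000 * C * \<omega> ^ 9" by (rule T0(2))
      then have "m * hdist (F Q) (T0 Q) \<le> m * (6000 * C * \<omega> ^ 9)" using m by (intro mult_left_mono) auto
      also have "\<dots> = 36000 * C * \<omega> * R" using \<omega>0 by (simp add: m_def field_simps flip: power_Suc)
      also have "\<dots> \<le> 36000 * C * \<epsilon> powr (1 / 2 ^ 11) * R"
      proof -
        \<comment> \<open>The bound obtained has exponent 1/16; as \<epsilon> is at most 1, a
          smaller exponent only weakens it.\<close>
        have "\<omega> \<le> \<epsilon> powr (1 / 2 ^ 11)"
          unfolding \<omega>_def using \<epsilon> \<epsilon>0 by (intro powr_mono') auto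
        then show ?thesis using C R by (intro mult_right_mono mult_left_mono) auto
      qed
      also have "m * hdist (F Q) (T0 Q) = control_dist (f P) (T P)"
        using hdist_hsim[of m S' "F Q" "T0 Q"] m
        by (simp add: hF T_def Q_def[symmetric] control_dist_eq_hdist) (simp add: Q_def hsim_inverse)
      finally show ?thesis .
    qed
    ultimately show ?thesis by blast
  qed
  show ?thesis
    by (intro exI[of _ \<epsilon>0] conjI \<epsilon>0(1) exI[of _ "36000 * C"]) (use C main in auto)
qed

end
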